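(* For all integers $n \geq 42$, \[ \det\begin{pmatrix} \overline{p}(n) & \overline{p}(n+1) & \overline{p}(n+2) \\ \overline{p}(n-1) & \overline{p}(n) & \overline{p}(n+1) \\ \overline{p}(n-2) & \overline{p}(n-1) & \overline{p}(n) \end{pmatrix} > 0. \]
   Context: An overpartition of a nonnegative integer $n$ is a nonincreasing sequence of positive integers summing to $n$ in which the first occurrence of each distinct part may (or may not) be overlined. $\overline{p}(n)$ denotes the number of overpartitions of $n$, with $\overline{p}(0)=1$. For example $\overline{p}(3)=8$. *)

theory Defs
  imports "HOL-Analysis.Analysis" "HOL-Library.Multiset" "HOL-Library.Numeral_Type"
begin

text \<open>An overpartition of n: a partition of n (a multiset of positive integers
summing to n) together with the set of distinct parts whose first occurrence
is overlined.\<close>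
definition overpartitions :: "nat \<Rightarrow> (nat multiset \<times> nat set) set" where
  "overpartitions n = {(M, S). (\<forall>x\<in>#M. 0 < x) \<and> sum_mset M = n \<and> S \<subseteq> set_mset M}"

definition overpartition_count :: "nat \<Rightarrow> nat" where
  "overpartition_count n = card (overpartitions n)"

definition overpart_matrix :: "nat \<Rightarrow> int^3^3" where
  "overpart_matrix n = (let pb = (\<lambda>k. int (overpartition_count k)) in
     vector [vector [pb n, pb (n+1), pb (n+2)],
             vector [pb (n-1), pb n, pb (n+1)],
             vector [pb (n-2), pb (n-1), pb n]])"

end

theory Submission
  imports Defs "HOL-Complex_Analysis.Complex_Analysis" "HOL-Probability.Probability"
begin

text \<open>
By an identity of Gauss, the generating function of overpartitions is the reciprocal of
\<open>\<theta>(q) = 1 + 2 \<Sum>s\<ge>1. (-1)^s q^(s^2)\<close>, and Poisson summation describes \<open>\<theta>\<close> near \<open>q = 1\<close>. There the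
integrand of the coefficient integral over a circle is replaced by one that has an explicit
primitive in terms of the imaginary error function; on the rest of the circle the infinite product
gives a sufficient bound. This yields \<open>p(n)\<close> up to an error \<open>exp (17/10 * sqrt n)\<close>, against a main
term of size about \<open>exp (pi * sqrt n) / (8 * n)\<close>.

By the AM-GM inequality the determinant is at least
\<open>(p(n) - sqrt Q) (p(n)^2 + p(n) sqrt Q - 2 P)\<close> with \<open>P = p(n-1) p(n+1)\<close> and \<open>Q = p(n-2) p(n+2)\<close>.
The signs of the two factors depend on the second and fourth differences of the logarithm of
the main term, which settles \<open>n \<ge> 486\<close>. For the remaining \<open>n\<close>, Dodgson condensation turns the claim into
the strict log-concavity of \<open>p(n)^2 - p(n-1) p(n+1)\<close>, which is verified with the
recurrence that Gauss's identity provides.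
\<close>

section \<open>The generating function\<close>

text \<open>The second factor of the AM-GM bound dictates the accuracy. Let \<open>E\<close> be the
  exponential of the second difference of the logarithm of the main term. If
  \<open>sqrt Q / p(n)\<close> were exactly \<open>E^2\<close>, that factor divided by
  \<open>p(n)^2\<close> would be \<open>1 + E^2 - 2 E = (1 - E)^2\<close>. All leading terms cancel,
  and since \<open>1 - E\<close> has order \<open>n^(-3/2)\<close> only order \<open>n^(-3)\<close>
  is left. So the relative error of every entry must stay below a small multiple of
  \<open>n^(-3)\<close>. An exponentially small relative error achieves this once
  \<open>sqrt (n - 2) >= 22\<close>, which is the origin of 484 and 486. The deviation of
  \<open>sqrt Q / p(n)\<close> from \<open>E^2\<close> is a fourth difference, of order
  \<open>n^(-7/2)\<close>, hence smaller still.

  The circle does not pass through the saddle point of the main term. Near \<open>q = 1\<close> the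
  integral is evaluated by a primitive, whatever the radius, so the radius can be tuned to the bound
  on the rest of the circle. A circle closer to the unit circle than the saddle brings the exponent
  there from about \<open>1.87 sqrt n\<close> down to about \<open>1.38 sqrt n\<close>, apart from
  lower-order terms.\<close>

definition bounded_overpartitions :: "nat \<Rightarrow> nat \<Rightarrow> (nat multiset \<times> nat set) set" where
  "bounded_overpartitions k n = {(M, S) \<in> overpartitions n. \<forall>x\<in>#M. x \<le> k}"

lemma mem_bounded_overpartitions:
  "(M, S) \<in> bounded_overpartitions k n \<longleftrightarrow>
     (\<forall>x\<in>#M. 0 < x \<and> x \<le> k) \<and> sum_mset M = n \<and> S \<subseteq> set_mset M"
  unfolding bounded_overpartitions_def overpartitions_def by auto

lemma bounded_overpartitions_0: "bounded_overpartitions 0 n = (if n = 0 then {({#}, {})} else {})"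
proof -
  have "(M, S) \<in> bounded_overpartitions 0 n \<longleftrightarrow> n = 0 \<and> M = {#} \<and> S = {}" for M S
  proof -
    have "M = {#}" if "\<forall>x\<in>#M. 0 < x \<and> x \<le> 0"
      using that by (metis leD multiset_nonemptyE)
    then show ?thesis by (auto simp: mem_bounded_overpartitions)
  qed
  then show ?thesis by auto
qed

lemma part_le_sum_mset: "x \<in># M \<Longrightarrow> x \<le> sum_mset M" for x :: nat
  by (auto dest!: multi_member_split)

lemma bounded_overpartitions_Suc_less:
  assumes "n < Suc k"
  shows "bounded_overpartitions (Suc k) n = bounded_overpartitions k n"
proof -
  have "x \<le> k" if "sum_mset M = n" "x \<in># M" for x M
    using that assms part_le_sum_mset[of x M] by simp
  then have "(\<forall>x\<in>#M. 0 < x \<and> x \<le> Suc k) \<and> sum_mset M = n \<longleftrightarrow> (\<forall>x\<in>#M. 0 < x \<and> x \<le> k) \<and> sum_mset M = n" for M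
    using le_SucI by blast
  then have "(M, S) \<in> bounded_overpartitions (Suc k) n \<longleftrightarrow> (M, S) \<in> bounded_overpartitions k n" for M S
    unfolding mem_bounded_overpartitions by blast
  then show ?thesis by auto
qed

text \<open>The three pieces collect the overpartitions without a part \<open>k + 1\<close>, those in which \<open>k + 1\<close>
  is plain or repeated, and those in which it occurs exactly once and is overlined.\<close>
lemma bounded_overpartitions_Suc:
  assumes "Suc k \<le> n"
  shows "bounded_overpartitions (Suc k) n =
           bounded_overpartitions k n
           \<union> (\<lambda>(M, S). (add_mset (Suc k) M, S)) ` bounded_overpartitions (Suc k) (n - Suc k)
           \<union> (\<lambda>(M, S). (add_mset (Suc k) M, insert (Suc k) S)) ` bounded_overpartitions k (n - Suc k)"
    (is "?L = ?A \<union> ?f ` ?B \<union> ?g ` ?C")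
proof (rule set_eqI, clarify)
  fix M S
  show "(M, S) \<in> ?L \<longleftrightarrow> (M, S) \<in> ?A \<union> ?f ` ?B \<union> ?g ` ?C"
  proof
    assume L: "(M, S) \<in> ?L"
    show "(M, S) \<in> ?A \<union> ?f ` ?B \<union> ?g ` ?C"
    proof (cases "Suc k \<in># M")
      case False
      then have "(M, S) \<in> ?A"
        using L by (auto simp: mem_bounded_overpartitions le_Suc_eq)
      then show ?thesis by blast
    next
      case True
      then obtain M' where M': "M = add_mset (Suc k) M'" by (metis multi_member_split)
      show ?thesis
      proof (cases "S \<subseteq> set_mset M'")
        case True
        then have "(M', S) \<in> ?B"
          using L M' by (auto simp: mem_bounded_overpartitions)
        then have "(M, S) \<in> ?f ` ?B" using M' by force
        then show ?thesis by blast
      next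
        case False
        then have c: "Suc k \<in> S" "Suc k \<notin># M'"
          using L M' by (auto simp: mem_bounded_overpartitions)
        then have "(M', S - {Suc k}) \<in> ?C"
          using L M' unfolding mem_bounded_overpartitions
          by (auto dest: le_SucE simp: le_Suc_eq)
        moreover have "(M, S) = ?g (M', S - {Suc k})"
          using c M' by auto
        ultimately have "(M, S) \<in> ?g ` ?C" by blast
        then show ?thesis by blast
      qed
    qed
  next
    assume "(M, S) \<in> ?A \<union> ?f ` ?B \<union> ?g ` ?C"
    then consider "(M, S) \<in> ?A"
      | M' where "(M', S) \<in> ?B" "M = add_mset (Suc k) M'"
      | M' S' where "(M', S') \<in> ?C" "M = add_mset (Suc k) M'" "S = insert (Suc k) S'"
      by auto
    then show "(M, S) \<in> ?L"
    proof cases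
      case 1
      then show ?thesis by (auto simp: mem_bounded_overpartitions)
    next
      case 2
      then show ?thesis using assms by (auto simp: mem_bounded_overpartitions)
    next
      case 3
      then show ?thesis using assms by (auto simp: mem_bounded_overpartitions)
    qed
  qed
qed

lemma finite_bounded_overpartitions: "finite (bounded_overpartitions k n)"
proof (induction k arbitrary: n)
  case 0
  then show ?case by (simp add: bounded_overpartitions_0)
next
  case (Suc k)
  show ?case
  proof (induction n rule: less_induct)
    case (less n)
    then show ?case
      using Suc.IH bounded_overpartitions_Suc[of k n] bounded_overpartitions_Suc_less[of n k]
      by (cases "n < Suc k") auto
  qed
qed

definition bcount :: "nat \<Rightarrow> nat \<Rightarrow> nat" where
  "bcount k n = card (bounded_overpartitions k n)"

lemma bcount_0: "bcount 0 n = (if n = 0 then 1 else 0)"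
  by (simp add: bcount_def bounded_overpartitions_0)

text \<open>Coefficientwise form of \<open>(1 - q^(k+1)) F_(k+1) = (1 + q^(k+1)) F_k\<close>, where
  \<open>F_k\<close> generates the overpartitions with parts at most \<open>k\<close>. Each step
  thus contributes one factor of \<open>oprod\<close>.\<close>

lemma bcount_Suc:
  "bcount (Suc k) n = bcount k n +
     (if n < Suc k then 0 else bcount (Suc k) (n - Suc k) + bcount k (n - Suc k))"
proof (cases "n < Suc k")
  case True
  then show ?thesis by (simp add: bcount_def bounded_overpartitions_Suc_less)
next
  case False
  let ?A = "bounded_overpartitions k n"
  let ?B = "(\<lambda>(M, S). (add_mset (Suc k) M, S)) ` bounded_overpartitions (Suc k) (n - Suc k)"
  let ?C = "(\<lambda>(M, S). (add_mset (Suc k) M, insert (Suc k) S)) ` bounded_overpartitions k (n - Suc k)"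
  have nin: "Suc k \<notin># M" if "(M, S) \<in> bounded_overpartitions k m" for M S m
    using that by (auto simp: mem_bounded_overpartitions)
  have fin: "finite ?A" "finite ?B" "finite ?C"
    by (auto intro: finite_bounded_overpartitions)
  have d1: "?A \<inter> ?B = {}" and d2: "?A \<inter> ?C = {}"
    by (auto dest: nin)
  have d3: "?B \<inter> ?C = {}"
  proof (rule ccontr)
    assume "?B \<inter> ?C \<noteq> {}"
    then obtain M S' where 1: "(M, insert (Suc k) S') \<in> bounded_overpartitions (Suc k) (n - Suc k)"
      "(M, S') \<in> bounded_overpartitions k (n - Suc k)" by auto
    then have "Suc k \<in># M" by (auto simp: mem_bounded_overpartitions)
    then show False using nin 1(2) by blast
  qed
  have cB: "card ?B = bcount (Suc k) (n - Suc k)"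
    unfolding bcount_def by (rule card_image) (auto simp: inj_on_def)
  have cC: "card ?C = bcount k (n - Suc k)"
    unfolding bcount_def
  proof (rule card_image, rule inj_onI, clarify)
    fix M S M' S'
    assume "(M, S) \<in> bounded_overpartitions k (n - Suc k)" "(M', S') \<in> bounded_overpartitions k (n - Suc k)"
      and e: "add_mset (Suc k) M = add_mset (Suc k) M'" "insert (Suc k) S = insert (Suc k) S'"
    then have "Suc k \<notin> S" "Suc k \<notin> S'" using nin
      by (meson mem_bounded_overpartitions subsetD)+
    then show "M = M' \<and> S = S'" using e insert_ident[of "Suc k" S S'] by simp
  qed
  have "bcount (Suc k) n = card (?A \<union> ?B \<union> ?C)"
    using False by (simp add: bcount_def bounded_overpartitions_Suc)
  also have "\<dots> = card ?A + card ?B + card ?C"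
    using fin d1 d2 d3 by (simp add: card_Un_disjoint Int_Un_distrib2)
  finally show ?thesis using False cB cC by (simp add: bcount_def)
qed

lemma bounded_overpartitions_eq:
  assumes "n \<le> k"
  shows "bounded_overpartitions k n = overpartitions n"
proof -
  have "x \<le> k" if "sum_mset M = n" "x \<in># M" for x M
    using that assms part_le_sum_mset[of x M] by simp
  then show ?thesis
    unfolding bounded_overpartitions_def overpartitions_def by blast
qed

lemma bcount_eq_overpartition_count: "n \<le> k \<Longrightarrow> bcount k n = overpartition_count n"
  by (simp add: bcount_def overpartition_count_def bounded_overpartitions_eq)

lemma bcount_le_overpartition_count: "bcount k n \<le> overpartition_count n"
proof -
  have "finite (overpartitions n)"
    using finite_bounded_overpartitions[of n n] by (simp add: bounded_overpartitions_eq)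
  then show ?thesis
    unfolding bcount_def overpartition_count_def bounded_overpartitions_def
    by (intro card_mono) auto
qed

text \<open>The type is left open so that the product at a real argument can serve as a majorant of
  the one at a complex argument.\<close>

definition oprod :: "nat \<Rightarrow> 'a::{real_normed_field} \<Rightarrow> 'a" where
  "oprod k q = (\<Prod>i=1..k. (1 + q ^ i) / (1 - q ^ i))"

lemma oprod_0 [simp]: "oprod 0 q = 1"
  by (simp add: oprod_def)

lemma oprod_Suc: "oprod (Suc k) q = oprod k q * ((1 + q ^ Suc k) / (1 - q ^ Suc k))"
  by (simp add: oprod_def)

lemma power_Suc_neq:
  fixes q :: "'a::real_normed_field"
  assumes "norm q < 1"
  shows "1 - q ^ Suc k \<noteq> 0" "1 + q ^ Suc k \<noteq> 0"
proof -
  have "norm (q ^ Suc k) < 1"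
    unfolding norm_power using assms by (metis norm_ge_zero power_less_one_iff zero_less_Suc)
  then show "1 - q ^ Suc k \<noteq> 0" "1 + q ^ Suc k \<noteq> 0"
    by (metis norm_one less_irrefl right_minus_eq, metis norm_minus_cancel add_eq_0_iff norm_one less_irrefl)
qed

lemma sums_shift_right:
  fixes f :: "nat \<Rightarrow> 'a::real_normed_field"
  assumes "f sums a"
  shows "(\<lambda>n. if n < c then 0 else f (n - c)) sums a"
  using sums_zero_iff_shift[of c "\<lambda>n. if n < c then 0 else f (n - c)" a] assms by simp

text \<open>For nonnegative terms bounded partial sums suffice for summability: the recurrence
  bounds a partial sum by \<open>(1 + x^c) * oprod k x\<close> plus \<open>x^c < 1\<close> times
  itself. The complex version borrows its summability from here.\<close>

lemma bcount_sums_real: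
  fixes x :: real
  assumes "0 \<le> x" "x < 1"
  shows "(\<lambda>n. real (bcount k n) * x ^ n) sums oprod k x"
proof (induction k)
  case 0
  have "(\<lambda>n. real (bcount 0 n) * x ^ n) = (\<lambda>n. if n = 0 then 1 else 0)"
    by (auto simp: bcount_0)
  then show ?case using sums_If_finite_set[of "{0::nat}" "\<lambda>_. 1::real"] by (simp add: oprod_def)
next
  case (Suc k)
  define c where "c = Suc k"
  let ?f = "\<lambda>n. real (bcount c n) * x ^ n" and ?g = "\<lambda>n. real (bcount k n) * x ^ n"
  have xc: "x ^ c < 1" "0 \<le> x ^ c"
    using assms by (auto simp: c_def power_less_one_iff simp del: power_Suc)
  have rec: "?f n = ?g n + (if n < c then 0 else x ^ c * ?f (n - c)) + (if n < c then 0 else x ^ c * ?g (n - c))" for n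
  proof (cases "n < c")
    case False
    then have "x ^ n = x ^ c * x ^ (n - c)" by (metis le_add_diff_inverse not_less power_add)
    then show ?thesis using False bcount_Suc[of k n] by (simp add: c_def algebra_simps)
  qed (use bcount_Suc[of k n] in \<open>simp add: c_def\<close>)
  have g': "(\<lambda>n. if n < c then 0 else x ^ c * ?g (n - c)) sums (x ^ c * oprod k x)"
    by (intro sums_shift_right sums_mult Suc.IH)
  have bd: "sum ?f {..<N} \<le> (1 + x ^ c) * oprod k x / (1 - x ^ c)" for N
  proof -
    have nn: "0 \<le> ?f n" for n using assms by simp
    have "(\<Sum>n<N. if n < c then 0 else x ^ c * ?f (n - c)) \<le> x ^ c * sum ?f {..<N}"
    proof -
      have "(\<Sum>n<N. if n < c then 0 else x ^ c * ?f (n - c)) = (\<Sum>n\<in>{c..<N}. x ^ c * ?f (n - c))"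
        by (rule sum.mono_neutral_cong_right) auto
      also have "\<dots> = (\<Sum>n<N - c. x ^ c * ?f n)"
        by (rule sum.reindex_bij_witness[of _ "\<lambda>n. n + c" "\<lambda>n. n - c"]) auto
      also have "\<dots> \<le> (\<Sum>n<N. x ^ c * ?f n)"
        using nn xc by (intro sum_mono2) auto
      finally show ?thesis by (simp add: sum_distrib_left)
    qed
    moreover have "sum ?g {..<N} \<le> oprod k x"
      using Suc.IH assms by (metis (no_types, lifting) finite_lessThan mult_nonneg_nonneg of_nat_0_le_iff sum_le_suminf sums_iff zero_le_power)
    moreover have "(\<Sum>n<N. if n < c then 0 else x ^ c * ?g (n - c)) \<le> x ^ c * oprod k x"
      using g' assms sum_le_suminf[of "\<lambda>n. if n < c then 0 else x ^ c * ?g (n - c)" "{..<N}"]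
      by (auto simp: sums_iff)
    moreover have "sum ?f {..<N} = sum ?g {..<N} + (\<Sum>n<N. if n < c then 0 else x ^ c * ?f (n - c))
        + (\<Sum>n<N. if n < c then 0 else x ^ c * ?g (n - c))"
      by (subst rec) (simp add: sum.distrib)
    ultimately have "sum ?f {..<N} * (1 - x ^ c) \<le> (1 + x ^ c) * oprod k x"
      by (simp add: algebra_simps)
    then show ?thesis using xc by (simp add: pos_le_divide_eq)
  qed
  have "summable ?f"
    using assms bd by (intro summableI_nonneg_bounded[where x="(1 + x ^ c) * oprod k x / (1 - x ^ c)"]) auto
  then obtain a where a: "?f sums a" by (auto simp: summable_def)
  have "?f sums (oprod k x + x ^ c * a + x ^ c * oprod k x)"
    by (subst rec) (intro sums_add Suc.IH g' sums_shift_right sums_mult a)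
  then have "a = oprod k x + x ^ c * a + x ^ c * oprod k x" using a sums_unique2 by blast
  then have "a = oprod k x * ((1 + x ^ c) / (1 - x ^ c))"
    using xc by (simp add: field_simps)
  then show ?case using a by (simp only: oprod_Suc c_def)
qed

text \<open>The bound is uniform in \<open>k\<close>. It therefore controls the partial sums of the
  full series, and later the error terms in Gauss's identity.\<close>

lemma oprod_le_exp:
  fixes x :: real
  assumes "0 \<le> x" "x < 1"
  shows "oprod k x \<le> exp (2 / (1 - x)\<^sup>2)"
proof -
  have xi: "x ^ i \<le> x" if "i \<ge> 1" for i
    using assms that power_decreasing[of 1 i x] by simp
  have "oprod k x \<le> (\<Prod>i=1..k. exp (2 * x ^ i / (1 - x)))"
    unfolding oprod_def
  proof (intro prod_mono conjI)
    fix i assume i: "i \<in> {1..k}"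
    then have "x ^ i < 1" using xi[of i] assms by auto
    then show "0 \<le> (1 + x ^ i) / (1 - x ^ i)" using assms by auto
    have "(1 + x ^ i) / (1 - x ^ i) = 1 + 2 * x ^ i / (1 - x ^ i)"
      using \<open>x ^ i < 1\<close> by (simp add: field_simps)
    also have "\<dots> \<le> 1 + 2 * x ^ i / (1 - x)"
      using xi[of i] i assms by (intro add_left_mono divide_left_mono) auto
    also have "\<dots> \<le> exp (2 * x ^ i / (1 - x))" by (rule exp_ge_add_one_self)
    finally show "(1 + x ^ i) / (1 - x ^ i) \<le> exp (2 * x ^ i / (1 - x))" .
  qed
  also have "\<dots> = exp (2 / (1 - x) * (\<Sum>i=1..k. x ^ i))"
    by (simp add: exp_sum[symmetric] sum_distrib_left)
  also have "\<dots> \<le> exp (2 / (1 - x) * (1 / (1 - x)))"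
  proof -
    have "(\<Sum>i=1..k. x ^ i) \<le> (\<Sum>i. x ^ i)"
      using assms by (intro sum_le_suminf summable_geometric) auto
    also have "\<dots> = 1 / (1 - x)" using assms by (intro suminf_geometric) auto
    finally show ?thesis using assms by (intro iffD2[OF exp_le_cancel_iff] mult_left_mono) auto
  qed
  finally show ?thesis by (simp add: power2_eq_square)
qed

lemma summable_overpartition_count_real:
  fixes x :: real
  assumes "0 \<le> x" "x < 1"
  shows "summable (\<lambda>n. real (overpartition_count n) * x ^ n)"
proof (rule summableI_nonneg_bounded)
  fix N
  have "(\<Sum>n<N. real (overpartition_count n) * x ^ n) = (\<Sum>n<N. real (bcount N n) * x ^ n)"
    by (intro sum.cong) (auto simp: bcount_eq_overpartition_count)
  also have "\<dots> \<le> oprod N x"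
    using bcount_sums_real[OF assms, of N] assms sum_le_suminf[of "\<lambda>n. real (bcount N n) * x ^ n" "{..<N}"]
    by (auto simp: sums_iff)
  also have "\<dots> \<le> exp (2 / (1 - x)\<^sup>2)" by (rule oprod_le_exp[OF assms])
  finally show "(\<Sum>n<N. real (overpartition_count n) * x ^ n) \<le> exp (2 / (1 - x)\<^sup>2)" .
qed (use assms in auto)

definition ogf :: "complex \<Rightarrow> complex" where
  "ogf q = (\<Sum>n. of_nat (overpartition_count n) * q ^ n)"

lemma summable_overpartition_count:
  fixes q :: complex
  assumes "norm q < 1"
  shows "summable (\<lambda>n. of_nat (overpartition_count n) * q ^ n)"
    and "summable (\<lambda>n. norm (of_nat (overpartition_count n) * q ^ n))"
proof -
  show "summable (\<lambda>n. norm (of_nat (overpartition_count n) * q ^ n))"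
    using summable_overpartition_count_real[of "norm q"] assms by (simp add: norm_mult norm_power)
  then show "summable (\<lambda>n. of_nat (overpartition_count n) * q ^ n)"
    by (rule summable_norm_cancel)
qed

lemma bcount_sums:
  fixes q :: complex
  assumes "norm q < 1"
  shows "(\<lambda>n. of_nat (bcount k n) * q ^ n) sums oprod k q"
proof (induction k)
  case 0
  have "(\<lambda>n. of_nat (bcount 0 n) * q ^ n) = (\<lambda>n. if n = 0 then 1 else 0)"
    by (auto simp: bcount_0)
  then show ?case using sums_If_finite_set[of "{0::nat}" "\<lambda>_. 1::complex"] by (simp add: oprod_def)
next
  case (Suc k)
  define c where "c = Suc k"
  let ?f = "\<lambda>n. of_nat (bcount c n) * q ^ n" and ?g = "\<lambda>n. of_nat (bcount k n) * q ^ n"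
  have rec: "?f n = ?g n + (if n < c then 0 else q ^ c * ?f (n - c)) + (if n < c then 0 else q ^ c * ?g (n - c))" for n
  proof (cases "n < c")
    case False
    then have "q ^ n = q ^ c * q ^ (n - c)" by (metis le_add_diff_inverse not_less power_add)
    then show ?thesis using False bcount_Suc[of k n] by (simp add: c_def algebra_simps)
  qed (use bcount_Suc[of k n] in \<open>simp add: c_def\<close>)
  have "summable (\<lambda>n. norm (?f n))"
    using bcount_sums_real[of "norm q" c] assms by (simp add: norm_mult norm_power sums_iff)
  then obtain a where a: "?f sums a" by (metis summable_norm_cancel summable_def)
  have "?f sums (oprod k q + q ^ c * a + q ^ c * oprod k q)"
    by (subst rec) (intro sums_add Suc.IH sums_shift_right sums_mult a)
  then have "a = oprod k q + q ^ c * a + q ^ c * oprod k q" using a sums_unique2 by blast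
  then have "a = oprod k q * ((1 + q ^ c) / (1 - q ^ c))"
    using power_Suc_neq[OF assms, of k, folded c_def] by (simp add: field_simps)
  then show ?case using a by (simp only: oprod_Suc c_def)
qed

text \<open>Both series agree in the coefficients up to index \<open>k\<close>, and beyond that
  \<open>bcount\<close> never exceeds the full count. So the difference is dominated by a tail of a
  convergent series.\<close>

lemma oprod_tendsto_ogf:
  assumes "norm q < 1"
  shows "(\<lambda>k. oprod k q) \<longlonglongrightarrow> ogf q"
proof -
  let ?x = "norm q"
  let ?c = "\<lambda>n. real (overpartition_count n) * ?x ^ n"
  have sm: "summable ?c" using summable_overpartition_count_real[of ?x] assms by simp
  have b: "norm (ogf q - oprod k q) \<le> (\<Sum>n. ?c (n + k))" for k
  proof -
    let ?d = "\<lambda>n. of_nat (overpartition_count n) * q ^ n - of_nat (bcount k n) * q ^ n"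
    have 1: "?d sums (ogf q - oprod k q)"
      unfolding ogf_def by (intro sums_diff bcount_sums assms summable_sums summable_overpartition_count)
    have "?d n = 0" if "n < k" for n using that by (simp add: bcount_eq_overpartition_count)
    then have 2: "(\<lambda>n. ?d (n + k)) sums (ogf q - oprod k q)"
      using sums_zero_iff_shift[of k ?d] 1 by blast
    have "norm (?d n) \<le> ?c n" for n
    proof -
      have "?d n = of_nat (overpartition_count n - bcount k n) * q ^ n"
        by (simp add: bcount_le_overpartition_count of_nat_diff left_diff_distrib)
      then show ?thesis by (simp add: norm_mult norm_power mult_right_mono)
    qed
    then have "norm (\<Sum>n. ?d (n + k)) \<le> (\<Sum>n. ?c (n + k))"
      by (intro norm_suminf_le[OF _ ]) (use summable_ignore_initial_segment[OF sm, of k] in auto)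
    then show ?thesis using 2 by (simp add: sums_iff)
  qed
  have lim: "(\<lambda>k. \<Sum>n. ?c (n + k)) \<longlonglongrightarrow> 0" by (rule suminf_exist_split2[OF sm])
  have "(\<lambda>k. ogf q - oprod k q) \<longlonglongrightarrow> 0"
    by (rule Lim_null_comparison[OF always_eventually lim]) (use b in blast)
  from tendsto_diff[OF tendsto_const[of "ogf q"] this] show ?thesis by simp
qed

section \<open>Gauss's identity\<close>

lemma oprod_nonzero:
  assumes "norm q < 1"
  shows "oprod k q \<noteq> 0"
  using power_Suc_neq[OF assms] by (induction k) (simp_all add: oprod_Suc del: power_Suc)

text \<open>Summand of a finite form of Gauss's identity, in the manner of Shanks's proof of Euler's
  pentagonal number theorem: summed over \<open>s <= n\<close> it gives exactly the partial sum
  \<open>theta_partial q n\<close>. The factor \<open>q^(s (n+1))\<close> kills every term but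
  \<open>s = 0\<close> as \<open>n\<close> grows.\<close>

definition theta_term :: "complex \<Rightarrow> nat \<Rightarrow> nat \<Rightarrow> complex" where
  "theta_term q n s = (-1) ^ s * q ^ (s * Suc n) * (oprod s q / oprod n q) * (2 / (1 + q ^ s))"

text \<open>The increments in \<open>n\<close> have a closed partial sum in \<open>s\<close>. For
  \<open>m = n\<close> it equals \<open>(-1)^(n+1) q^((n+1)^2) * 2 / (1 + q^(n+1))\<close>, and the
  new term \<open>s = n + 1\<close> is the same times \<open>q^(n+1)\<close>. Together they make up
  the next theta summand \<open>2 (-1)^(n+1) q^((n+1)^2)\<close>.\<close>

lemma theta_term_telescope:
  assumes "norm q < 1"
  shows "(\<Sum>s\<le>m. theta_term q (Suc n) s - theta_term q n s) =
           (-1) ^ Suc m * q ^ (Suc m * Suc n) * (2 / (1 + q ^ Suc n)) * (oprod m q / oprod n q)"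
proof (induction m)
  case 0
  have *: "1 / (N * ((1 + b) / (1 - b))) - 1 / N = (-1) * b * (2 / (1 + b)) * (1 / N)"
    if "N \<noteq> 0" "1 - b \<noteq> 0" "1 + b \<noteq> 0" for N b :: complex
    using that by (simp add: divide_simps)
  show ?case
    using *[OF oprod_nonzero[OF assms, of n] power_Suc_neq[OF assms, of n]]
    by (simp add: theta_term_def oprod_Suc del: power_Suc)
next
  case (Suc m)
  have *: "e * (X * a) * (R * ((1 + a) / (1 - a)) / (N * ((1 + b) / (1 - b)))) * (2 / (1 + a))
        - e * X * (R * ((1 + a) / (1 - a)) / N) * (2 / (1 + a)) + e * X * (2 / (1 + b)) * (R / N)
      = (- e) * (X * b) * (2 / (1 + b)) * (R * ((1 + a) / (1 - a)) / N)"
    if "N \<noteq> 0" "1 - b \<noteq> 0" "1 + b \<noteq> 0" "1 - a \<noteq> 0" "1 + a \<noteq> 0" for N b a e X R :: complex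
    using that by (simp add: divide_simps) algebra
  have "Suc m * Suc (Suc n) = Suc m * Suc n + Suc m" "Suc (Suc m) * Suc n = Suc m * Suc n + Suc n"
    by simp_all
  then have p1: "q ^ (Suc m * Suc (Suc n)) = q ^ (Suc m * Suc n) * q ^ Suc m"
    and p2: "q ^ (Suc (Suc m) * Suc n) = q ^ (Suc m * Suc n) * q ^ Suc n"
    by (metis power_add)+
  have "(\<Sum>s\<le>Suc m. theta_term q (Suc n) s - theta_term q n s) =
      theta_term q (Suc n) (Suc m) - theta_term q n (Suc m) +
      (-1) ^ Suc m * q ^ (Suc m * Suc n) * (2 / (1 + q ^ Suc n)) * (oprod m q / oprod n q)"
    by (simp only: sum.atMost_Suc Suc.IH add.commute)
  also have "\<dots> = (- ((-1) ^ Suc m)) * (q ^ (Suc m * Suc n) * q ^ Suc n) * (2 / (1 + q ^ Suc n)) * (oprod (Suc m) q / oprod n q)"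
    unfolding theta_term_def p1 oprod_Suc
    by (rule *) (use oprod_nonzero[OF assms] power_Suc_neq[OF assms] in blast)+
  also have "\<dots> = (-1) ^ Suc (Suc m) * q ^ (Suc (Suc m) * Suc n) * (2 / (1 + q ^ Suc n)) * (oprod (Suc m) q / oprod n q)"
    by (simp only: p2 power_Suc[of "-1 :: complex" "Suc m"] mult_minus1)
  finally show ?case .
qed

definition theta_partial :: "complex \<Rightarrow> nat \<Rightarrow> complex" where
  "theta_partial q n = 1 + 2 * (\<Sum>s=1..n. (-1) ^ s * q ^ (s\<^sup>2))"

lemma theta_partial_eq:
  assumes "norm q < 1"
  shows "theta_partial q n = (\<Sum>s\<le>n. theta_term q n s)"
proof (induction n)
  case 0
  then show ?case by (simp add: theta_partial_def theta_term_def)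
next
  case (Suc n)
  have nz: "oprod n q \<noteq> 0" "oprod (Suc n) q \<noteq> 0" "1 + q ^ Suc n \<noteq> 0"
    using oprod_nonzero[OF assms] power_Suc_neq[OF assms] by blast+
  have "(\<Sum>s\<le>Suc n. theta_term q (Suc n) s) =
      (\<Sum>s\<le>n. theta_term q (Suc n) s - theta_term q n s) + theta_partial q n + theta_term q (Suc n) (Suc n)"
    by (simp add: sum_subtractf Suc.IH)
  also have "(\<Sum>s\<le>n. theta_term q (Suc n) s - theta_term q n s) = (-1) ^ Suc n * q ^ (Suc n * Suc n) * (2 / (1 + q ^ Suc n))"
    using nz by (simp add: theta_term_telescope[OF assms] del: power_Suc)
  also have "theta_term q (Suc n) (Suc n) = (-1) ^ Suc n * (q ^ (Suc n * Suc n) * q ^ Suc n) * (2 / (1 + q ^ Suc n))"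
  proof -
    have "Suc n * Suc (Suc n) = Suc n * Suc n + Suc n" by simp
    then have "q ^ (Suc n * Suc (Suc n)) = q ^ (Suc n * Suc n) * q ^ Suc n"
      by (metis power_add)
    then show ?thesis using nz by (simp add: theta_term_def del: power_Suc)
  qed
  also have "(-1) ^ Suc n * q ^ (Suc n * Suc n) * (2 / (1 + q ^ Suc n)) + theta_partial q n
      + (-1) ^ Suc n * (q ^ (Suc n * Suc n) * q ^ Suc n) * (2 / (1 + q ^ Suc n))
      = theta_partial q n + 2 * ((-1) ^ Suc n * q ^ (Suc n * Suc n))"
  proof -
    have "e * X * (2 / (1 + b)) + t + e * (X * b) * (2 / (1 + b)) = t + 2 * (e * X)"
      if "1 + b \<noteq> 0" for e X b t :: complex
      using that by (simp add: divide_simps) algebra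
    then show ?thesis using nz(3) by blast
  qed
  also have "\<dots> = theta_partial q (Suc n)"
    by (simp add: theta_partial_def power2_eq_square algebra_simps)
  finally show ?case by simp
qed

text \<open>What remains of the ratio is a product of inverted factors, and inverted factors obey
  the same real majorant as the original ones. The bound is therefore uniform in both
  indices.\<close>

lemma norm_oprod_ratio_le:
  assumes "norm q < 1" "s \<le> n"
  shows "norm (oprod s q / oprod n q) \<le> exp (2 / (1 - norm q)\<^sup>2)"
proof -
  let ?x = "norm q"
  have pw: "?x ^ i < 1" if "i \<ge> 1" for i
    using assms that by (simp add: power_less_one_iff)
  have split: "oprod n f = oprod s f * (\<Prod>i\<in>{s<..n}. (1 + f ^ i) / (1 - f ^ i))"
    for f :: "'b::real_normed_field"
    unfolding oprod_def using assms(2)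
    by (subst prod.union_disjoint[symmetric]) (auto intro: prod.cong)
  have "norm (oprod s q / oprod n q) = (\<Prod>i\<in>{s<..n}. norm ((1 - q ^ i) / (1 + q ^ i)))"
  proof -
    have "oprod s q / oprod n q = 1 / (\<Prod>i\<in>{s<..n}. (1 + q ^ i) / (1 - q ^ i))"
      unfolding split[of q] using oprod_nonzero[OF assms(1), of s] by simp
    also have "\<dots> = (\<Prod>i\<in>{s<..n}. (1 - q ^ i) / (1 + q ^ i))"
      by (simp add: prod_dividef)
    finally show ?thesis by (simp add: prod_norm)
  qed
  also have "\<dots> \<le> (\<Prod>i\<in>{s<..n}. (1 + ?x ^ i) / (1 - ?x ^ i))"
  proof (intro prod_mono conjI)
    fix i assume i: "i \<in> {s<..n}"
    have "norm (1 - q ^ i) \<le> 1 + ?x ^ i"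
      using norm_triangle_ineq4[of 1 "q ^ i"] by (simp add: norm_power)
    moreover have "1 - ?x ^ i \<le> norm (1 + q ^ i)"
      using norm_diff_ineq[of 1 "q ^ i"] by (simp add: norm_power)
    moreover have "?x ^ i < 1" using pw i by simp
    ultimately show "norm ((1 - q ^ i) / (1 + q ^ i)) \<le> (1 + ?x ^ i) / (1 - ?x ^ i)"
      unfolding norm_divide by (intro frac_le) auto
  qed auto
  also have "\<dots> \<le> oprod s ?x * (\<Prod>i\<in>{s<..n}. (1 + ?x ^ i) / (1 - ?x ^ i))"
  proof -
    have "1 \<le> (1 + ?x ^ i) / (1 - ?x ^ i)" if "i \<ge> 1" for i
      using pw[OF that] by simp
    then have "1 \<le> oprod s ?x" "0 \<le> (\<Prod>i\<in>{s<..n}. (1 + ?x ^ i) / (1 - ?x ^ i))"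
      unfolding oprod_def by (auto intro!: prod_ge_1 prod_nonneg dest: pw[of "_", OF less_imp_le_nat[THEN order_trans[rotated]]] simp: less_imp_le pw)
    then show ?thesis by (simp add: mult_left_le_one_le mult_le_cancel_right1 mult_le_cancel_right2)
  qed
  also have "\<dots> = oprod n ?x" by (rule split[symmetric])
  also have "\<dots> \<le> exp (2 / (1 - ?x)\<^sup>2)" by (rule oprod_le_exp) (use assms in auto)
  finally show ?thesis .
qed

text \<open>After multiplication by \<open>oprod n q\<close> the term \<open>s = 0\<close> is
  exactly 1. Each of the other \<open>n\<close> terms is at most a constant times
  \<open>norm q ^ n\<close>, so their sum tends to 0.\<close>

lemma theta_partial_tendsto:
  assumes "norm q < 1"
  shows "(\<lambda>n. theta_partial q n * oprod n q) \<longlonglongrightarrow> 1"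
proof -
  let ?x = "norm q"
  define C where "C = exp (2 / (1 - ?x)\<^sup>2)"
  have x: "0 \<le> ?x" "?x < 1" using assms by auto
  have C: "C > 0" "norm (oprod n q) \<le> C" for n
  proof -
    show "C > 0" by (simp add: C_def)
    have "norm (oprod n q) \<le> oprod n ?x"
      unfolding oprod_def prod_norm[symmetric]
    proof (intro prod_mono conjI)
      fix i assume i: "i \<in> {1..n}"
      have "norm (1 + q ^ i) \<le> 1 + ?x ^ i"
        using norm_triangle_ineq[of 1 "q ^ i"] by (simp add: norm_power)
      moreover have "1 - ?x ^ i \<le> norm (1 - q ^ i)"
        using norm_triangle_ineq2[of 1 "q ^ i"] by (simp add: norm_power)
      moreover have "?x ^ i < 1" using i x by (simp add: power_less_one_iff)
      ultimately show "norm ((1 + q ^ i) / (1 - q ^ i)) \<le> (1 + ?x ^ i) / (1 - ?x ^ i)"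
        unfolding norm_divide by (intro frac_le) auto
    qed auto
    then show "norm (oprod n q) \<le> C" using oprod_le_exp[OF x, of n] by (simp add: C_def)
  qed
  have b: "norm (theta_partial q n * oprod n q - 1) \<le> real n * ?x ^ n * (C * (2 / (1 - ?x)) * C)" for n
  proof -
    have "theta_partial q n = theta_term q n 0 + (\<Sum>s=1..n. theta_term q n s)"
    proof -
      have "{..n} = insert 0 {1..n}" by auto
      then show ?thesis unfolding theta_partial_eq[OF assms] by simp
    qed
    moreover have "theta_term q n 0 * oprod n q = 1"
      using oprod_nonzero[OF assms, of n] by (simp add: theta_term_def)
    ultimately have "norm (theta_partial q n * oprod n q - 1) = norm (\<Sum>s=1..n. theta_term q n s) * norm (oprod n q)"
      by (simp add: algebra_simps flip: norm_mult)
    also have "\<dots> \<le> (\<Sum>s=1..n. ?x ^ n * (C * (2 / (1 - ?x)))) * C"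
    proof (intro mult_mono sum_norm_le C)
      fix s assume s: "s \<in> {1..n}"
      have "?x ^ (s * Suc n) \<le> ?x ^ n"
      proof -
        have "n \<le> s * Suc n" using s by (cases s) auto
        then show ?thesis by (rule power_decreasing) (use x in auto)
      qed
      moreover have "1 - ?x \<le> norm (1 + q ^ s)"
      proof -
        have "?x ^ s \<le> ?x" using s x power_decreasing[of 1 s ?x] by simp
        then show ?thesis using norm_diff_ineq[of 1 "q ^ s"] by (simp add: norm_power)
      qed
      then have "2 / norm (1 + q ^ s) \<le> 2 / (1 - ?x)"
        using x by (intro divide_left_mono mult_pos_pos) auto
      moreover have "norm (oprod s q / oprod n q) \<le> C"
        unfolding C_def using s by (intro norm_oprod_ratio_le assms) auto
      ultimately have "?x ^ (s * Suc n) * (norm (oprod s q / oprod n q) * (2 / norm (1 + q ^ s))) \<le> ?x ^ n * (C * (2 / (1 - ?x)))"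
        using x C by (intro mult_mono) auto
      then show "norm (theta_term q n s) \<le> ?x ^ n * (C * (2 / (1 - ?x)))"
        unfolding theta_term_def norm_mult norm_power norm_divide by (simp add: mult.assoc)
    qed (use x C in \<open>auto intro!: sum_nonneg mult_nonneg_nonneg less_imp_le\<close>)
    finally show ?thesis by (simp add: mult_ac)
  qed
  have "(\<lambda>n. real n * ?x ^ n) \<longlonglongrightarrow> 0"
    using powser_times_n_limit_0[of ?x] x by simp
  then have "(\<lambda>n. real n * ?x ^ n * (C * (2 / (1 - ?x)) * C)) \<longlonglongrightarrow> 0"
    by (rule tendsto_mult_left_zero)
  then have "(\<lambda>n. theta_partial q n * oprod n q - 1) \<longlonglongrightarrow> 0"
    by (rule Lim_null_comparison[OF always_eventually, rotated]) (use b in blast)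
  then show ?thesis by (simp add: LIM_zero_iff)
qed

text \<open>The limit is kept abstract because it is identified twice: as a power series, for the
  recurrence, and as the Poisson-transformed series, for the behaviour near
  \<open>q = 1\<close>.\<close>

lemma theta_partial_mult_ogf:
  assumes "norm q < 1" "theta_partial q \<longlonglongrightarrow> L"
  shows "L * ogf q = 1"
  using LIMSEQ_unique[OF tendsto_mult[OF assms(2) oprod_tendsto_ogf[OF assms(1)]] theta_partial_tendsto[OF assms(1)]] .

text \<open>Since \<open>s\<close> and \<open>s^2\<close> have the same parity, the sign
  \<open>(-1)^s\<close> can be read off the exponent \<open>n = s^2\<close> itself.\<close>

definition theta_coeff :: "nat \<Rightarrow> int" where
  "theta_coeff n = (if n = 0 then 1 else if \<exists>s. n = s\<^sup>2 then 2 * (-1) ^ n else 0)"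

lemma theta_partial_conv_theta_coeff:
  "(\<Sum>i<Suc (n\<^sup>2). of_int (theta_coeff i) * q ^ i) = theta_partial q n"
proof -
  have "(\<Sum>i<Suc (n\<^sup>2). of_int (theta_coeff i) * q ^ i) =
      (\<Sum>i\<in>insert 0 ((\<lambda>s. s\<^sup>2) ` {1..n}). of_int (theta_coeff i) * q ^ i)"
  proof (rule sum.mono_neutral_right)
    show "\<forall>i\<in>{..<Suc (n\<^sup>2)} - insert 0 ((\<lambda>s. s\<^sup>2) ` {1..n}). of_int (theta_coeff i) * q ^ i = 0"
    proof
      fix i assume i: "i \<in> {..<Suc (n\<^sup>2)} - insert 0 ((\<lambda>s. s\<^sup>2) ` {1..n})"
      have "i \<noteq> s\<^sup>2" for s
      proof
        assume "i = s\<^sup>2"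
        then have "s\<^sup>2 \<le> n\<^sup>2" "s \<noteq> 0" using i by (auto simp: less_Suc_eq_le)
        then have "s \<in> {1..n}" using power2_le_imp_le[of s n] by simp
        then show False using i \<open>i = s\<^sup>2\<close> by blast
      qed
      then show "of_int (theta_coeff i) * q ^ i = 0" using i by (auto simp: theta_coeff_def)
    qed
  qed (auto simp: power2_nat_le_eq_le less_Suc_eq_le)
  also have "\<dots> = 1 + (\<Sum>i\<in>(\<lambda>s. s\<^sup>2) ` {1..n}. of_int (theta_coeff i) * q ^ i)"
    by (subst sum.insert) (auto simp: theta_coeff_def)
  also have "(\<Sum>i\<in>(\<lambda>s. s\<^sup>2) ` {1..n}. of_int (theta_coeff i) * q ^ i) = (\<Sum>s=1..n. of_int (theta_coeff (s\<^sup>2)) * q ^ (s\<^sup>2))"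
    by (subst sum.reindex) (auto simp: inj_on_def)
  also have "\<dots> = (\<Sum>s=1..n. 2 * ((-1) ^ s * q ^ (s\<^sup>2)))"
    by (intro sum.cong) (auto simp: theta_coeff_def uminus_power_if)
  finally show ?thesis by (simp add: theta_partial_def sum_distrib_left)
qed

lemma abs_theta_coeff_le: "\<bar>theta_coeff n\<bar> \<le> 2"
  by (simp add: theta_coeff_def abs_mult power_abs)

lemma summable_theta_coeff:
  assumes "norm q < 1"
  shows "summable (\<lambda>n. norm (of_int (theta_coeff n) * q ^ n :: complex))"
proof (rule summable_comparison_test')
  show "summable (\<lambda>n. 2 * norm q ^ n)" using assms by (intro summable_mult summable_geometric) simp
  fix n
  have "norm (of_int (theta_coeff n) :: complex) \<le> 2"
    using abs_theta_coeff_le[of n] by (metis norm_of_int of_int_abs of_int_le_iff of_int_numeral)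
  then show "norm (norm (of_int (theta_coeff n) * q ^ n :: complex)) \<le> 2 * norm q ^ n"
    by (simp add: norm_mult norm_power mult_right_mono)
qed

lemma theta_coeff_mult_ogf:
  assumes "norm q < 1"
  shows "(\<Sum>n. of_int (theta_coeff n) * q ^ n) * ogf q = 1"
proof (rule theta_partial_mult_ogf[OF assms])
  have "(\<lambda>N. \<Sum>i<N. of_int (theta_coeff i) * q ^ i) \<longlonglongrightarrow> (\<Sum>n. of_int (theta_coeff n) * q ^ n)"
    by (intro summable_LIMSEQ summable_norm_cancel[OF summable_theta_coeff] assms)
  \<comment> \<open>The theta partial sums are the subsequence of the power series partial sums that
    stops just after the exponent \<open>n^2\<close>.\<close>
  moreover have "filterlim (\<lambda>n. Suc (n\<^sup>2)) sequentially sequentially"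
    by (rule filterlim_subseq) (intro strict_monoI Suc_mono power_strict_mono, auto)
  ultimately have "(\<lambda>n. \<Sum>i<Suc (n\<^sup>2). of_int (theta_coeff i) * q ^ i) \<longlonglongrightarrow> (\<Sum>n. of_int (theta_coeff n) * q ^ n)"
    by (rule filterlim_compose)
  then show "theta_partial q \<longlonglongrightarrow> (\<Sum>n. of_int (theta_coeff n) * q ^ n)"
    unfolding theta_partial_conv_theta_coeff by simp
qed

lemma powser_coeff_unique:
  fixes a b :: "nat \<Rightarrow> complex"
  assumes "\<And>q. norm q < 1 \<Longrightarrow> (\<lambda>n. a n * q ^ n) sums f q"
    and "\<And>q. norm q < 1 \<Longrightarrow> (\<lambda>n. b n * q ^ n) sums f q"
  shows "a n = b n"
proof -
  let ?d = "\<lambda>n. a n - b n"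
  have d: "(\<lambda>n. ?d n * q ^ n) sums 0" if "norm q < 1" for q
    using sums_diff[OF assms(1)[OF that] assms(2)[OF that]] by (simp add: left_diff_distrib)
  have "?d n = 0"
  proof (rule ccontr)
    assume "?d n \<noteq> 0"
    moreover have "?d 0 = 0"
      using d[of 0] powser_sums_zero[of ?d] sums_unique2 by fastforce
    ultimately have n: "?d n \<noteq> 0" "0 < n" by (auto intro: gr0I)
    show False
    proof (rule powser_0_nonzero[where a = ?d and f = "\<lambda>_. 0" and \<xi> = 0 and r = 1 and m = n])
      show "(\<lambda>n. ?d n * (q - 0) ^ n) sums 0" if "norm (q - 0) < 1" for q
        using d that by simp
      fix s :: real assume s: "0 < s" "\<And>z. z \<in> cball (0::complex) s - {0} \<Longrightarrow> (0::complex) \<noteq> 0"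
      have "of_real s \<in> cball (0::complex) s - {0}" using s(1) by auto
      from s(2)[OF this] show False by simp
    qed (simp, simp, rule n(1), rule n(2))
  qed
  then show ?thesis by simp
qed

lemma overpartition_count_recurrence:
  "(\<Sum>k\<le>n. theta_coeff k * int (overpartition_count (n - k))) = (if n = 0 then 1 else 0)"
proof -
  let ?c = "\<lambda>n. \<Sum>k\<le>n. of_int (theta_coeff k) * (of_nat (overpartition_count (n - k)) :: complex)"
  have "?c n = (if n = 0 then 1 else 0)"
  proof (rule powser_coeff_unique[where f = "\<lambda>_. 1" and a = ?c and b = "\<lambda>n. if n = 0 then 1 else 0"])
    fix q :: complex assume q: "norm q < 1"
    have "(\<lambda>n. \<Sum>k\<le>n. (of_int (theta_coeff k) * q ^ k) * (of_nat (overpartition_count (n - k)) * q ^ (n - k)))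
        sums ((\<Sum>n. of_int (theta_coeff n) * q ^ n) * (\<Sum>n. of_nat (overpartition_count n) * q ^ n))"
      by (intro Cauchy_product_sums summable_theta_coeff summable_overpartition_count q)
    also have "(\<lambda>n. \<Sum>k\<le>n. (of_int (theta_coeff k) * q ^ k) * (of_nat (overpartition_count (n - k)) * q ^ (n - k)))
        = (\<lambda>n. ?c n * q ^ n)"
      unfolding sum_distrib_right
    proof (intro ext sum.cong refl)
      fix n k :: nat assume "k \<in> {..n}"
      then have "q ^ n = q ^ k * q ^ (n - k)" by (simp flip: power_add)
      then show "(of_int (theta_coeff k) * q ^ k) * (of_nat (overpartition_count (n - k)) * q ^ (n - k)) =
        of_int (theta_coeff k) * of_nat (overpartition_count (n - k)) * q ^ n" by simp
    qed
    finally show "(\<lambda>n. ?c n * q ^ n) sums 1"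
      using theta_coeff_mult_ogf[OF q] by (simp add: ogf_def)
    have "(\<lambda>n. (if n = 0 then 1 else 0) * q ^ n) = (\<lambda>n. if n = 0 then 1 else 0)" by auto
    then show "(\<lambda>n. (if n = 0 then 1 else 0) * q ^ n) sums 1"
      using sums_If_finite_set[of "{0::nat}" "\<lambda>_. 1::complex"] by simp
  qed
  moreover have "?c n = of_int (\<Sum>k\<le>n. theta_coeff k * int (overpartition_count (n - k)))" by simp
  ultimately show ?thesis by (metis of_int_0 of_int_1 of_int_eq_iff)
qed

section \<open>The theta transformation\<close>

text \<open>By the product formula, multiplication by \<open>cos (2 pi x)\<close> turns a cosine
  into the mean of its two neighbours. So the vanishing of all cosine coefficients survives
  multiplication by any power of \<open>cos (2 pi x)\<close>.\<close>

lemma cos_moments_zero: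
  fixes g :: "real \<Rightarrow> real"
  assumes cont: "continuous_on {0..1} g"
    and zero: "\<And>k::nat. integral {0..1} (\<lambda>x. g x * cos (2 * pi * real k * x)) = 0"
  shows "integral {0..1} (\<lambda>x. g x * cos (2 * pi * x) ^ j * cos (2 * pi * real k * x)) = 0"
proof (induction j arbitrary: k)
  case 0
  then show ?case using zero[of k] by simp
next
  case (Suc j)
  have int: "(\<lambda>x. g x * cos (2 * pi * x) ^ j * cos (2 * pi * real m * x)) integrable_on {0..1}" for m
    by (intro integrable_continuous_real continuous_intros cont)
  let ?c = "\<lambda>x m. g x * cos (2 * pi * x) ^ j * cos (2 * pi * real m * x)"
  have split: "\<exists>m m'. \<forall>x. cos (2 * pi * x) * cos (2 * pi * real k * x) =
      (cos (2 * pi * real m * x) + cos (2 * pi * real m' * x)) / 2"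
  proof (cases k)
    case 0
    then show ?thesis by (intro exI[of _ 1] exI[of _ 1]) simp
  next
    case (Suc i)
    have "cos (2 * pi * x) * cos (2 * pi * real k * x) =
      (cos (2 * pi * real i * x) + cos (2 * pi * real (Suc k) * x)) / 2" for x
    proof -
      have "cos (2 * pi * x - 2 * pi * real k * x) = cos (2 * pi * real i * x)"
      proof -
        have "2 * pi * x - 2 * pi * real k * x = - (2 * pi * real i * x)" by (simp add: Suc algebra_simps)
        then show ?thesis by (metis cos_minus)
      qed
      moreover have "2 * pi * x + 2 * pi * real k * x = 2 * pi * real (Suc k) * x" by (simp add: algebra_simps)
      ultimately show ?thesis by (simp only: cos_times_cos)
    qed
    then show ?thesis by blast
  qed
  then obtain m m' where mm: "\<And>x. cos (2 * pi * x) * cos (2 * pi * real k * x) =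
      (cos (2 * pi * real m * x) + cos (2 * pi * real m' * x)) / 2" by blast
  have "(\<lambda>x. g x * cos (2 * pi * x) ^ Suc j * cos (2 * pi * real k * x)) = (\<lambda>x. (?c x m + ?c x m') / 2)"
  proof
    fix x
    have "g x * cos (2 * pi * x) ^ Suc j * cos (2 * pi * real k * x)
      = g x * cos (2 * pi * x) ^ j * (cos (2 * pi * x) * cos (2 * pi * real k * x))" by simp
    also have "\<dots> = (?c x m + ?c x m') / 2" unfolding mm by (simp add: algebra_simps)
    finally show "g x * cos (2 * pi * x) ^ Suc j * cos (2 * pi * real k * x) = (?c x m + ?c x m') / 2" .
  qed
  moreover have "integral {0..1} (\<lambda>x. (?c x m + ?c x m') / 2) = 0"
    using Suc.IH[of m] Suc.IH[of m'] by (simp add: integral_add int)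
  ultimately show ?case by simp
qed

text \<open>The symmetry makes \<open>g\<close> a continuous function of
  \<open>cos (2 pi x)\<close>, so it is uniformly within \<open>e\<close> of a polynomial
  \<open>p\<close> in that cosine. As \<open>g\<close> is orthogonal to \<open>p\<close>, the
  integral of \<open>g^2\<close> is at most \<open>e\<close> times that of \<open>|g|\<close>, for
  every \<open>e > 0\<close>.\<close>

lemma cos_coeffs_zero_imp_zero:
  fixes g :: "real \<Rightarrow> real"
  assumes cont: "continuous_on {0..1} g"
    and sym: "\<And>x. x \<in> {0..1} \<Longrightarrow> g (1 - x) = g x"
    and zero: "\<And>k::nat. integral {0..1} (\<lambda>x. g x * cos (2 * pi * real k * x)) = 0"
    and x: "x \<in> {0..1}"
  shows "g x = 0"
proof -
  define h where "h y = g (arccos y / (2 * pi))" for y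
  have arc: "arccos y / (2 * pi) \<in> {0..1}" if "y \<in> {-1..1}" for y
    using that arccos_bounded[of y] by (auto simp: field_simps)
  have conth: "continuous_on {-1..1} h"
    unfolding h_def
    by (rule continuous_on_compose2[OF cont]) (use arc in \<open>auto intro!: continuous_intros\<close>)
  have gh: "g x = h (cos (2 * pi * x))" if "x \<in> {0..1}" for x
  proof (cases "x \<le> 1/2")
    case True
    then have "arccos (cos (2 * pi * x)) = 2 * pi * x"
      using that by (intro arccos_cos) (auto simp: field_simps)
    then show ?thesis by (simp add: h_def)
  next
    case False
    have "cos (2 * pi * x) = cos (2 * pi * (1 - x))"
    proof -
      have "2 * pi * (1 - x) = 2 * pi - 2 * pi * x" by (simp add: algebra_simps)
      then show ?thesis by (simp add: cos_diff)
    qed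
    moreover have "arccos (cos (2 * pi * (1 - x))) = 2 * pi * (1 - x)"
      using that False by (intro arccos_cos) (auto simp: field_simps)
    ultimately show ?thesis using sym[OF that] by (simp add: h_def)
  qed
  have intg: "(\<lambda>x. \<bar>g x\<bar>) integrable_on {0..1}"
    by (intro integrable_continuous_real continuous_intros cont)
  have le: "integral {0..1} (\<lambda>x. g x * g x) \<le> e * integral {0..1} (\<lambda>x. \<bar>g x\<bar>)" if e: "e > 0" for e
  proof -
    obtain p where p: "real_polynomial_function p" "\<And>y. y \<in> {-1..1} \<Longrightarrow> \<bar>h y - p y\<bar> < e"
      using Stone_Weierstrass_real_polynomial_function[OF compact_Icc conth e] by blast
    obtain a N where pa: "p = (\<lambda>y. \<Sum>i\<le>N. a i * y ^ i)"
      using p(1) real_polynomial_function_iff_sum[of p] by blast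
    have contp: "continuous_on {0..1} (\<lambda>x. p (cos (2 * pi * x)))"
      unfolding pa by (intro continuous_intros)
    have int: "(\<lambda>x. g x * cos (2 * pi * x) ^ i) integrable_on {0..1}" for i
      by (intro integrable_continuous_real continuous_intros cont)
    have "integral {0..1} (\<lambda>x. g x * p (cos (2 * pi * x))) =
        integral {0..1} (\<lambda>x. \<Sum>i\<le>N. a i * (g x * cos (2 * pi * x) ^ i))"
      unfolding pa by (intro arg_cong[where f="integral _"] ext) (simp add: sum_distrib_left mult_ac)
    also have "\<dots> = (\<Sum>i\<le>N. integral {0..1} (\<lambda>x. a i * (g x * cos (2 * pi * x) ^ i)))"
      by (intro integral_sum integrable_continuous_real continuous_intros cont) auto
    also have "\<dots> = 0"
      using cos_moments_zero[OF cont zero, of _ 0] by simp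
    finally have p0: "integral {0..1} (\<lambda>x. g x * p (cos (2 * pi * x))) = 0" .
    have "integral {0..1} (\<lambda>x. g x * g x) = integral {0..1} (\<lambda>x. g x * g x) - integral {0..1} (\<lambda>x. g x * p (cos (2 * pi * x)))"
      using p0 by simp
    also have "\<dots> = integral {0..1} (\<lambda>x. g x * (g x - p (cos (2 * pi * x))))"
      unfolding right_diff_distrib
      by (rule integral_diff[symmetric]) (intro integrable_continuous_real continuous_intros cont contp)+
    also have "\<dots> \<le> integral {0..1} (\<lambda>x. e * \<bar>g x\<bar>)"
    proof (rule integral_le)
      fix x :: real assume x: "x \<in> {0..1}"
      have "\<bar>g x - p (cos (2 * pi * x))\<bar> \<le> e"
        using p(2)[of "cos (2 * pi * x)"] gh[OF x] by simp
      then have "\<bar>g x\<bar> * \<bar>g x - p (cos (2 * pi * x))\<bar> \<le> \<bar>g x\<bar> * e"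
        by (intro mult_left_mono) auto
      then have "\<bar>g x * (g x - p (cos (2 * pi * x)))\<bar> \<le> e * \<bar>g x\<bar>" by (simp add: abs_mult mult.commute)
      then show "g x * (g x - p (cos (2 * pi * x))) \<le> e * \<bar>g x\<bar>" by linarith
    qed (intro integrable_continuous_real continuous_intros cont contp)+
    finally show ?thesis by simp
  qed
  have "integral {0..1} (\<lambda>x. g x * g x) \<le> 0"
  proof (rule field_le_epsilon)
    fix e :: real assume e: "e > 0"
    define K where "K = integral {0..1} (\<lambda>x. \<bar>g x\<bar>)"
    have K: "K \<ge> 0" unfolding K_def by (intro integral_nonneg intg) auto
    have "integral {0..1} (\<lambda>x. g x * g x) \<le> e / (K + 1) * K"
      using le[of "e / (K + 1)"] e K by (simp add: K_def)
    also have "\<dots> \<le> e" using e K by (simp add: field_simps)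
    finally show "integral {0..1} (\<lambda>x. g x * g x) \<le> 0 + e" by simp
  qed
  moreover have "integral {0..1} (\<lambda>x. g x * g x) \<ge> 0"
    by (intro integral_nonneg integrable_continuous_real continuous_intros cont) auto
  ultimately have "integral {0..1} (\<lambda>x. g x * g x) = 0" by linarith
  then have "\<forall>x\<in>{0..1}. g x * g x = 0"
    by (subst (asm) integral_eq_0_iff) (auto intro!: continuous_intros cont)
  then show ?thesis using x by auto
qed

lemma integral_cos_orthogonal:
  "integral {0..1} (\<lambda>x. cos (2 * pi * real j * x) * cos (2 * pi * real k * x)) =
     (if j = k then (if k = 0 then 1 else 1/2) else 0)"
proof -
  have I: "((\<lambda>x. cos (2 * pi * of_int m * x)) has_integral (if m = 0 then 1 else 0)) {0..1}" for m :: int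
  proof (cases "m = 0")
    case True
    then show ?thesis using has_integral_const_real[of "1::real" 0 1] by simp
  next
    case False
    have "((\<lambda>x. cos (2 * pi * of_int m * x)) has_integral
        (sin (2 * pi * of_int m * 1) / (2 * pi * of_int m) - sin (2 * pi * of_int m * 0) / (2 * pi * of_int m))) {0..1}"
      by (rule fundamental_theorem_of_calculus)
         (use False in \<open>auto intro!: derivative_eq_intros simp: has_real_derivative_iff_has_vector_derivative[symmetric]\<close>)
    moreover have "sin (2 * pi * of_int m) = 0"
      using sin_integer_2pi[of "of_int m"] by (simp add: mult_ac)
    ultimately show ?thesis using False by simp
  qed
  have eq: "cos (2 * pi * real j * x) * cos (2 * pi * real k * x) =
     (cos (2 * pi * of_int (int j - int k) * x) + cos (2 * pi * of_int (int j + int k) * x)) / 2" for x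
    unfolding cos_times_cos by (simp add: algebra_simps)
  have "((\<lambda>x. cos (2 * pi * real j * x) * cos (2 * pi * real k * x)) has_integral
     ((if int j - int k = 0 then 1 else 0) + (if int j + int k = 0 then 1 else 0)) / 2) {0..1}"
    unfolding eq by (intro has_integral_divide has_integral_add I)
  then show ?thesis by (auto dest: integral_unique)
qed

lemma cos_series_coeff:
  fixes c :: "nat \<Rightarrow> real"
  assumes c: "summable (\<lambda>n. \<bar>c n\<bar>)"
  defines "G \<equiv> (\<lambda>x. \<Sum>n. c n * cos (2 * pi * real n * x))"
  shows "continuous_on {0..1} G"
    and "integral {0..1} (\<lambda>x. G x * cos (2 * pi * real k * x)) = c k * (if k = 0 then 1 else 1/2)"
proof -
  have bd: "norm (c n * cos (2 * pi * real n * x)) \<le> \<bar>c n\<bar>" for n x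
    by (simp add: abs_mult mult_left_le)
  have ul: "uniform_limit {0..1} (\<lambda>N x. \<Sum>n<N. c n * cos (2 * pi * real n * x)) G sequentially"
    unfolding G_def by (rule Weierstrass_m_test[OF bd c])
  show contG: "continuous_on {0..1} G"
    by (rule uniform_limit_theorem[OF _ ul]) (auto intro!: always_eventually continuous_intros)
  have ul2: "uniform_limit {0..1} (\<lambda>N x. (\<Sum>n<N. c n * cos (2 * pi * real n * x)) * cos (2 * pi * real k * x))
      (\<lambda>x. G x * cos (2 * pi * real k * x)) sequentially"
  proof (rule uniform_lim_mult[OF ul uniform_limit_const])
    show "bounded (G ` {0..1})"
      by (intro compact_imp_bounded compact_continuous_image contG) auto
    show "bounded ((\<lambda>x. cos (2 * pi * real k * x)) ` {0..1})"
      by (intro compact_imp_bounded compact_continuous_image continuous_intros) auto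
  qed
  obtain I J where I: "\<And>N. ((\<lambda>x. (\<Sum>n<N. c n * cos (2 * pi * real n * x)) * cos (2 * pi * real k * x)) has_integral I N) {0..1}"
    and J: "((\<lambda>x. G x * cos (2 * pi * real k * x)) has_integral J) {0..1}" and IJ: "I \<longlonglongrightarrow> J"
    by (rule uniform_limit_integral[OF ul2]) (auto intro!: continuous_intros)
  have "I N = c k * (if k = 0 then 1 else 1/2)" if "N > k" for N
  proof -
    have "I N = integral {0..1} (\<lambda>x. \<Sum>n<N. c n * (cos (2 * pi * real n * x) * cos (2 * pi * real k * x)))"
      using I[of N] by (simp add: integral_unique[symmetric] sum_distrib_right mult.assoc)
    also have "\<dots> = (\<Sum>n<N. integral {0..1} (\<lambda>x. c n * (cos (2 * pi * real n * x) * cos (2 * pi * real k * x))))"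
      by (intro integral_sum) (auto intro!: integrable_continuous_real continuous_intros)
    also have "\<dots> = (\<Sum>n<N. if n = k then c k * (if k = 0 then 1 else 1/2) else 0)"
      by (intro sum.cong refl) (auto simp: integral_cos_orthogonal)
    also have "\<dots> = c k * (if k = 0 then 1 else 1/2)" using that by simp
    finally show ?thesis .
  qed
  then have "I \<longlonglongrightarrow> c k * (if k = 0 then 1 else 1/2)"
    by (intro tendsto_eventually eventually_sequentiallyI[of "Suc k"]) auto
  then have "J = c k * (if k = 0 then 1 else 1/2)" using IJ LIMSEQ_unique by blast
  then show "integral {0..1} (\<lambda>x. G x * cos (2 * pi * real k * x)) = c k * (if k = 0 then 1 else 1/2)"
    using J by (simp add: integral_unique)
qed

section \<open>Poisson summation for the Gaussian\<close>

text \<open>This is the characteristic function of the standard normal distribution in disguise: the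
  substitution \<open>x = s x'\<close> with \<open>s^2 = t / (2 pi)\<close> gives the Gaussian unit
  variance.\<close>

lemma gaussian_cos_integral:
  fixes t b :: real
  assumes "t > 0"
  shows "integrable lborel (\<lambda>x. exp (- pi * x\<^sup>2 / t) * cos (2 * pi * b * x))"
    and "(LINT x|lborel. exp (- pi * x\<^sup>2 / t) * cos (2 * pi * b * x)) = sqrt t * exp (- pi * b\<^sup>2 * t)"
proof -
  define s where "s = sqrt (t / (2 * pi))"
  have s: "s > 0" "s\<^sup>2 = t / (2 * pi)" using assms by (auto simp: s_def)
  let ?f = "\<lambda>x. exp (- pi * x\<^sup>2 / t) * cos (2 * pi * b * x)"
  define u where "u = 2 * pi * b * s"
  have f: "?f (0 + s * x) = sqrt (2 * pi) * (std_normal_density x * cos (u * x))" for x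
  proof -
    have "- pi * (s * x)\<^sup>2 / t = - x\<^sup>2 / 2" using s assms by (simp add: power_mult_distrib field_simps)
    then show ?thesis by (simp add: std_normal_density_def u_def mult_ac)
  qed
  have int0: "integrable lborel (\<lambda>x. std_normal_density x * cos (u * x))"
  proof (rule Bochner_Integration.integrable_bound)
    show "integrable lborel std_normal_density" by (rule integrable_normal_density) simp
  qed (auto simp: abs_mult mult_left_le)
  have "char std_normal_distribution u = (LINT x|lborel. std_normal_density x *\<^sub>R iexp (u * x))"
    unfolding char_def by (subst integral_density) (auto simp: normal_density_nonneg)
  moreover have "integrable lborel (\<lambda>x. std_normal_density x *\<^sub>R iexp (u * x))"
  proof (rule Bochner_Integration.integrable_bound)
    show "integrable lborel std_normal_density" by (rule integrable_normal_density) simp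
  qed (auto simp: )
  ultimately have "Re (char std_normal_distribution u) = (LINT x|lborel. Re (std_normal_density x *\<^sub>R iexp (u * x)))"
    by (metis integral_Re)
  also have "(\<lambda>x. Re (std_normal_density x *\<^sub>R iexp (u * x))) = (\<lambda>x. std_normal_density x * cos (u * x))"
    by (auto simp: Re_exp)
  finally have val0: "(LINT x|lborel. std_normal_density x * cos (u * x)) = exp (- (u\<^sup>2) / 2)"
    by (simp add: char_std_normal_distribution)
  have "integrable lborel (\<lambda>x. ?f (0 + s * x))"
    unfolding f using int0 by (intro integrable_mult_right) auto
  then show "integrable lborel ?f"
    using lborel_integrable_real_affine_iff[of s ?f 0] s by simp
  have "(LINT x|lborel. ?f x) = \<bar>s\<bar> *\<^sub>R (LINT x|lborel. ?f (0 + s * x))"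
    by (rule lborel_integral_real_affine) (use s in simp)
  also have "\<dots> = s * sqrt (2 * pi) * exp (- (u\<^sup>2) / 2)"
    unfolding f using s by (simp add: val0)
  also have "s * sqrt (2 * pi) = sqrt t"
    by (simp add: s_def flip: real_sqrt_mult)
  also have "- (u\<^sup>2) / 2 = - pi * b\<^sup>2 * t"
    unfolding u_def power_mult_distrib s(2) by (simp add: power2_eq_square)
  finally show "(LINT x|lborel. ?f x) = sqrt t * exp (- pi * b\<^sup>2 * t)" .
qed

lemma gaussian_cos_integral_tendsto:
  fixes t b :: real
  assumes "t > 0"
  shows "(\<lambda>N::nat. integral {-real N..real N} (\<lambda>x. exp (- pi * x\<^sup>2 / t) * cos (2 * pi * b * x)))
      \<longlonglongrightarrow> sqrt t * exp (- pi * b\<^sup>2 * t)"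
proof -
  let ?f = "\<lambda>x. exp (- pi * x\<^sup>2 / t) * cos (2 * pi * b * x)"
  have un: "(\<Union>N::nat. {-real N..real N}) = UNIV"
  proof -
    have "\<exists>N::nat. x \<in> {-real N..real N}" for x
    proof -
      obtain N :: nat where "\<bar>x\<bar> \<le> real N" using real_arch_simple by blast
      then show ?thesis by (intro exI[of _ N]) auto
    qed
    then show ?thesis by blast
  qed
  have "(\<lambda>N::nat. LINT x:{-real N..real N}|lborel. ?f x) \<longlonglongrightarrow> (LINT x:(\<Union>N::nat. {-real N..real N})|lborel. ?f x)"
  proof (rule set_integral_cont_up)
    show "incseq (\<lambda>N::nat. {-real N..real N})" by (auto simp: incseq_def)
    show "set_integrable lborel (\<Union>N::nat. {-real N..real N}) ?f"
      unfolding un set_integrable_def using gaussian_cos_integral(1)[OF assms] by simp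
  qed auto
  moreover have "(LINT x:(\<Union>N::nat. {-real N..real N})|lborel. ?f x) = sqrt t * exp (- pi * b\<^sup>2 * t)"
    unfolding un set_lebesgue_integral_def using gaussian_cos_integral(2)[OF assms] by simp
  moreover have "(LINT x:{-real N..real N}|lborel. ?f x) = integral {-real N..real N} ?f" for N :: nat
  proof (rule set_borel_integral_eq_integral(2))
    show "set_integrable lborel {-real N..real N} ?f"
      by (rule set_integrable_subset[where A=UNIV])
         (use gaussian_cos_integral(1)[OF assms] in \<open>auto simp: set_integrable_def\<close>)
  qed
  ultimately show ?thesis by simp
qed

text \<open>The translates by \<open>n\<close> and by \<open>-(n + 1)\<close> are exchanged by
  \<open>x -> 1 - x\<close>. Pairing them makes every partial sum symmetric, and the first
  \<open>N\<close> pairs cover exactly the interval from \<open>-N\<close> to \<open>N\<close> when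
  unfolded.\<close>

definition gauss_pair :: "real \<Rightarrow> nat \<Rightarrow> real \<Rightarrow> real" where
  "gauss_pair t n x = exp (- pi * (x + real n)\<^sup>2 / t) + exp (- pi * (x - real n - 1)\<^sup>2 / t)"

text \<open>The usual unfolding: the cosine has period 1, so integrating the translates over the
  unit interval is integrating one Gaussian over \<open>N\<close> unit intervals on each side of
  0.\<close>

lemma gauss_pair_coeff:
  fixes t :: real and k :: nat
  assumes "t > 0"
  shows "integral {0..1} (\<lambda>x. (\<Sum>n<N. gauss_pair t n x) * cos (2 * pi * real k * x)) =
    integral {-real N..real N} (\<lambda>x. exp (- pi * x\<^sup>2 / t) * cos (2 * pi * real k * x))"
proof (induction N)
  case 0
  then show ?case by simp
next
  case (Suc N)
  let ?f = "\<lambda>x. exp (- pi * x\<^sup>2 / t) * cos (2 * pi * real k * x)"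
  have cf: "continuous_on S ?f" for S by (intro continuous_intros) (use assms in auto)
  have int: "?f integrable_on {a..b}" for a b
    by (rule integrable_continuous_real[OF cf])
  have cosN: "cos (2 * pi * real k * (m + x)) = cos (2 * pi * real k * x)" if "m \<in> \<int>" for x m
  proof -
    obtain i where "m = of_int i" using \<open>m \<in> \<int>\<close> by (auto elim: Ints_cases)
    then have "2 * pi * real k * (m + x) = 2 * pi * real k * x + of_int (int k * i) * (2 * pi)"
      by (simp add: algebra_simps)
    then show ?thesis
      using cos_integer_2pi[of "of_int (int k * i)"] sin_integer_2pi[of "of_int (int k * i)"]
      by (simp add: cos_add mult_ac)
  qed
  have g1: "integral {0..1} (\<lambda>x. exp (- pi * (x + real N)\<^sup>2 / t) * cos (2 * pi * real k * x)) = integral {real N..real N + 1} ?f"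
    using integral_shift_Icc_real[of 0 1 ?f "real N"] cosN[of "real N"] by (simp add: o_def add_ac)
  have g2: "integral {0..1} (\<lambda>x. exp (- pi * (x - real N - 1)\<^sup>2 / t) * cos (2 * pi * real k * x)) = integral {- real N - 1..- real N} ?f"
    using integral_shift_Icc_real[of 0 1 ?f "- real N - 1"] cosN[of "- real N - 1"] by (simp add: o_def algebra_simps)
  have "integral {0..1} (\<lambda>x. (\<Sum>n<Suc N. gauss_pair t n x) * cos (2 * pi * real k * x)) =
      integral {0..1} (\<lambda>x. (\<Sum>n<N. gauss_pair t n x) * cos (2 * pi * real k * x) +
        (exp (- pi * (x + real N)\<^sup>2 / t) * cos (2 * pi * real k * x) + exp (- pi * (x - real N - 1)\<^sup>2 / t) * cos (2 * pi * real k * x)))"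
    by (simp add: gauss_pair_def algebra_simps)
  also have "\<dots> = integral {-real N..real N} ?f + (integral {real N..real N + 1} ?f + integral {- real N - 1..- real N} ?f)"
  proof -
    have "(\<lambda>x. (\<Sum>n<N. gauss_pair t n x) * cos (2 * pi * real k * x)) integrable_on {0..1}"
      "(\<lambda>x. exp (- pi * (x + real N)\<^sup>2 / t) * cos (2 * pi * real k * x)) integrable_on {0..1}"
      "(\<lambda>x. exp (- pi * (x - real N - 1)\<^sup>2 / t) * cos (2 * pi * real k * x)) integrable_on {0..1}"
      unfolding gauss_pair_def using assms
      by (auto intro!: integrable_continuous_real continuous_intros)
    then show ?thesis by (simp only: integral_add integrable_add g1 g2 Suc.IH)
  qed
  also have "\<dots> = integral {-real (Suc N)..real (Suc N)} ?f"
  proof -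
    have "integral {-real N - 1..-real N} ?f + integral {-real N..real N} ?f = integral {-real N - 1..real N} ?f"
      by (rule Henstock_Kurzweil_Integration.integral_combine[OF _ _ int]) auto
    moreover have "integral {-real N - 1..real N} ?f + integral {real N..real N + 1} ?f = integral {-real N - 1..real N + 1} ?f"
      by (rule Henstock_Kurzweil_Integration.integral_combine[OF _ _ int]) auto
    moreover have "- real (Suc N) = - real N - 1" "real (Suc N) = real N + 1" by simp_all
    ultimately show ?thesis by (simp only:)
  qed
  finally show ?case .
qed

lemma gauss_pair_bound:
  assumes "t > 0" "x \<in> {0..1}"
  shows "norm (gauss_pair t n x) \<le> 2 * exp (- pi / t) ^ n"
proof -
  have "exp (- pi * y\<^sup>2 / t) \<le> exp (- pi / t) ^ n" if "real n \<le> \<bar>y\<bar>" for y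
  proof -
    have "real n \<le> (real n)\<^sup>2" using le_square of_nat_mono by (fastforce simp: power2_eq_square simp flip: of_nat_mult)
    also have "\<dots> \<le> y\<^sup>2" using that by (metis abs_of_nat power2_abs power_mono of_nat_0_le_iff)
    finally have "pi * real n / t \<le> pi * y\<^sup>2 / t" using assms by (intro divide_right_mono mult_left_mono) auto
    then show ?thesis by (simp flip: exp_of_nat_mult add: mult_ac)
  qed
  from this[of "x + real n"] this[of "x - real n - 1"] show ?thesis
    using assms(2) by (auto simp: gauss_pair_def)
qed

text \<open>Both sides are continuous, symmetric under \<open>x -> 1 - x\<close>, and have the same
  cosine coefficients, hence they coincide.\<close>

lemma gauss_pair_sum_eq:
  assumes t: "t > 0" and x: "x \<in> {0..1}"
  defines "c \<equiv> (\<lambda>k::nat. (if k = 0 then 1 else 2) * sqrt t * exp (- pi * (real k)\<^sup>2 * t))"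
  shows "(\<Sum>n. gauss_pair t n x) = (\<Sum>k. c k * cos (2 * pi * real k * x))"
    and "summable (\<lambda>k. \<bar>c k\<bar>)"
proof -
  define F where "F = (\<lambda>x. \<Sum>n. gauss_pair t n x)"
  define G where "G = (\<lambda>x. \<Sum>k. c k * cos (2 * pi * real k * x))"
  have q: "norm (exp (- pi / t)) < 1" "norm (exp (- pi * t)) < 1" using t by auto
  have ul: "uniform_limit {0..1} (\<lambda>N x. \<Sum>n<N. gauss_pair t n x) F sequentially"
    unfolding F_def
    by (rule Weierstrass_m_test[OF gauss_pair_bound[OF t]]) (use q in \<open>auto intro!: summable_mult summable_geometric\<close>)
  have cp: "continuous_on {0..1} (gauss_pair t n)" for n
    unfolding gauss_pair_def using t by (intro continuous_intros) auto
  have contF: "continuous_on {0..1} F"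
    by (rule uniform_limit_theorem[OF _ ul]) (auto intro!: always_eventually continuous_intros cp)
  show sc: "summable (\<lambda>k. \<bar>c k\<bar>)"
  proof (rule summable_comparison_test')
    show "summable (\<lambda>k. 2 * sqrt t * exp (- pi * t) ^ k)" using q by (intro summable_mult summable_geometric) auto
    fix k :: nat
    have "real k \<le> (real k)\<^sup>2" using le_square of_nat_mono by (fastforce simp: power2_eq_square simp flip: of_nat_mult)
    then have "pi * (real k * t) \<le> pi * ((real k)\<^sup>2 * t)" using t by (intro mult_left_mono mult_right_mono) auto
    then have "exp (- pi * (real k)\<^sup>2 * t) \<le> exp (- pi * t) ^ k"
      by (simp flip: exp_of_nat_mult add: mult_ac)
    then have "sqrt t * exp (- pi * (real k)\<^sup>2 * t) \<le> sqrt t * exp (- pi * t) ^ k" using t by (intro mult_left_mono) auto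
    moreover have "0 \<le> sqrt t * exp (- pi * t) ^ k" using t by simp
    ultimately show "norm \<bar>c k\<bar> \<le> 2 * sqrt t * exp (- pi * t) ^ k"
      using t by (simp add: c_def abs_mult)
  qed
  have contG: "continuous_on {0..1} G"
    unfolding G_def by (rule cos_series_coeff(1)[OF sc])
  have coeffG: "integral {0..1} (\<lambda>x. G x * cos (2 * pi * real k * x)) = c k * (if k = 0 then 1 else 1/2)" for k
    unfolding G_def by (rule cos_series_coeff(2)[OF sc])
  have coeffF: "integral {0..1} (\<lambda>x. F x * cos (2 * pi * real k * x)) = sqrt t * exp (- pi * (real k)\<^sup>2 * t)" for k
  proof -
    have ul2: "uniform_limit {0..1} (\<lambda>N x. (\<Sum>n<N. gauss_pair t n x) * cos (2 * pi * real k * x))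
        (\<lambda>x. F x * cos (2 * pi * real k * x)) sequentially"
    proof (rule uniform_lim_mult[OF ul uniform_limit_const])
      show "bounded (F ` {0..1})"
        by (intro compact_imp_bounded compact_continuous_image contF) auto
      show "bounded ((\<lambda>x. cos (2 * pi * real k * x)) ` {0..1})"
        by (intro compact_imp_bounded compact_continuous_image continuous_intros) auto
    qed
    obtain I J where I: "\<And>N. ((\<lambda>x. (\<Sum>n<N. gauss_pair t n x) * cos (2 * pi * real k * x)) has_integral I N) {0..1}"
      and J: "((\<lambda>x. F x * cos (2 * pi * real k * x)) has_integral J) {0..1}" and IJ: "I \<longlonglongrightarrow> J"
      by (rule uniform_limit_integral[OF ul2]) (auto intro!: continuous_intros cp)
    have "I = (\<lambda>N. integral {-real N..real N} (\<lambda>x. exp (- pi * x\<^sup>2 / t) * cos (2 * pi * real k * x)))"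
      using integral_unique[OF I] gauss_pair_coeff[OF t, of _ k] by metis
    then have "J = sqrt t * exp (- pi * (real k)\<^sup>2 * t)"
      using IJ gaussian_cos_integral_tendsto[OF t, of "real k"] LIMSEQ_unique by metis
    then show ?thesis using J by (simp add: integral_unique)
  qed
  have "F x - G x = 0"
  proof (rule cos_coeffs_zero_imp_zero[of "\<lambda>x. F x - G x"])
    show "continuous_on {0..1} (\<lambda>x. F x - G x)" by (intro continuous_intros contF contG)
    fix y :: real assume "y \<in> {0..1}"
    have "gauss_pair t n (1 - y) = gauss_pair t n y" for n
    proof -
      have "(1 - y + real n)\<^sup>2 = (y - real n - 1)\<^sup>2" "(1 - y - real n - 1)\<^sup>2 = (y + real n)\<^sup>2"
        by (simp_all add: power2_eq_square algebra_simps)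
      then show ?thesis by (simp add: gauss_pair_def)
    qed
    moreover have "cos (2 * pi * real k * (1 - y)) = cos (2 * pi * real k * y)" for k :: nat
    proof -
      have "2 * pi * real k * (1 - y) = real k * (2 * pi) - 2 * pi * real k * y" by (simp add: algebra_simps)
      then show ?thesis
        using cos_integer_2pi[of "real k"] sin_integer_2pi[of "real k"] by (simp add: cos_diff mult_ac)
    qed
    ultimately show "F (1 - y) - G (1 - y) = F y - G y" by (simp add: F_def G_def)
  next
    fix k :: nat
    have "integral {0..1} (\<lambda>x. (F x - G x) * cos (2 * pi * real k * x)) =
      integral {0..1} (\<lambda>x. F x * cos (2 * pi * real k * x)) - integral {0..1} (\<lambda>x. G x * cos (2 * pi * real k * x))"
      unfolding left_diff_distrib
      by (rule integral_diff) (intro integrable_continuous_real continuous_intros contF contG)+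
    then show "integral {0..1} (\<lambda>x. (F x - G x) * cos (2 * pi * real k * x)) = 0"
      unfolding coeffF coeffG by (simp add: c_def)
  qed (rule x)
  then show "(\<Sum>n. gauss_pair t n x) = (\<Sum>k. c k * cos (2 * pi * real k * x))"
    by (simp add: F_def G_def)
qed

text \<open>Poisson summation at \<open>x = 1/2\<close>, where the cosines become the signs
  \<open>(-1)^k\<close> and the translates sit at half-integers. There
  \<open>(n + 1/2)^2 = n (n + 1) + 1/4\<close>, which splits off the factor
  \<open>exp (- pi / (4 t))\<close>.\<close>

lemma theta_transformation_real:
  assumes t: "t > 0"
  shows "(\<lambda>k::nat. (if k = 0 then 1 else 2) * sqrt t * ((-1) ^ k * exp (- pi * t) ^ (k\<^sup>2)))
           sums (2 * exp (- pi / (4 * t)) * (\<Sum>n. exp (- pi / t) ^ (n * (n + 1))))"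
proof -
  let ?c = "\<lambda>k::nat. (if k = 0 then 1 else 2) * sqrt t * exp (- pi * (real k)\<^sup>2 * t)"
  have "gauss_pair t n (1/2) = 2 * exp (- pi / (4 * t)) * exp (- pi / t) ^ (n * (n + 1))" for n
  proof -
    have e: "- pi * (real n + 1/2)\<^sup>2 / t = - pi / (4 * t) + real (n * (n + 1)) * (- pi / t)"
      using t by (simp add: field_simps power2_eq_square)
    have "(1/2 + real n)\<^sup>2 = (real n + 1/2)\<^sup>2" "(1/2 - real n - 1)\<^sup>2 = (real n + 1/2)\<^sup>2"
      by (simp_all add: power2_eq_square algebra_simps)
    then have "gauss_pair t n (1/2) = 2 * exp (- pi * (real n + 1/2)\<^sup>2 / t)" by (simp add: gauss_pair_def)
    also have "\<dots> = 2 * exp (- pi / (4 * t)) * exp (- pi / t) ^ (n * (n + 1))"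
      unfolding e exp_add exp_of_nat_mult by simp
    finally show ?thesis .
  qed
  moreover have "summable (\<lambda>n. gauss_pair t n (1/2))"
  proof (rule summable_comparison_test')
    show "summable (\<lambda>n. 2 * exp (- pi / t) ^ n)" using t by (intro summable_mult summable_geometric) auto
    show "norm (gauss_pair t n (1/2)) \<le> 2 * exp (- pi / t) ^ n" for n by (rule gauss_pair_bound[OF t]) auto
  qed
  moreover have "summable (\<lambda>n. exp (- pi / t) ^ (n * (n + 1)))"
  proof (rule summable_comparison_test')
    show "summable (\<lambda>n. exp (- pi / t) ^ n)" using t by (intro summable_geometric) auto
    show "norm (exp (- pi / t) ^ (n * (n + 1))) \<le> exp (- pi / t) ^ n" for n
      using t power_decreasing[of n "n * (n + 1)" "exp (- pi / t)"] by simp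
  qed
  ultimately have lhs: "(\<Sum>n. gauss_pair t n (1/2)) = 2 * exp (- pi / (4 * t)) * (\<Sum>n. exp (- pi / t) ^ (n * (n + 1)))"
    by (simp add: suminf_mult)
  have rhs: "?c k * cos (2 * pi * real k * (1/2)) = (if k = 0 then 1 else 2) * sqrt t * ((-1) ^ k * exp (- pi * t) ^ (k\<^sup>2))" for k
  proof -
    have "- pi * (real k)\<^sup>2 * t = real (k\<^sup>2) * (- pi * t)" by simp
    then have "exp (- pi * (real k)\<^sup>2 * t) = exp (- pi * t) ^ (k\<^sup>2)" by (metis exp_of_nat_mult)
    moreover have "cos (2 * pi * real k * (1/2)) = (-1) ^ k" using cos_npi[of k] by (simp add: mult_ac)
    ultimately show ?thesis by simp
  qed
  have "summable (\<lambda>k. ?c k * cos (2 * pi * real k * (1/2)))"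
  proof (rule summable_comparison_test'[OF gauss_pair_sum_eq(2)[OF t, of 0]])
    show "norm (?c k * cos (2 * pi * real k * (1/2))) \<le> \<bar>?c k\<bar>" for k
      by (simp add: abs_mult mult_left_le)
  qed auto
  then have "(\<lambda>k. ?c k * cos (2 * pi * real k * (1/2))) sums (\<Sum>n. gauss_pair t n (1/2))"
    unfolding sums_iff using gauss_pair_sum_eq(1)[OF t, of "1/2"] by simp
  then show ?thesis unfolding lhs rhs .
qed

section \<open>Estimates for the generating function on a circle\<close>

lemma ogf_holomorphic: "ogf holomorphic_on ball 0 1"
proof (rule power_series_holomorphic)
  fix w :: complex assume "w \<in> ball 0 1"
  then show "(\<lambda>n. of_nat (overpartition_count n) * (w - 0) ^ n) sums ogf w"
    unfolding ogf_def using summable_overpartition_count(1)[of w] by (simp add: summable_sums)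
qed

section \<open>The modular transformation in the right half-plane\<close>

text \<open>Jacobi's theta function \<open>theta_2\<close>, freed from its prefactor
  \<open>2 q^(1/4)\<close>.\<close>

definition psi :: "complex \<Rightarrow> complex" where
  "psi q = (\<Sum>n. q ^ (n * (n + 1)))"

lemma pronic_power_le: "0 \<le> x \<Longrightarrow> x \<le> 1 \<Longrightarrow> x ^ (n * (n + 1)) \<le> (x\<^sup>2) ^ n" for x :: real
proof (cases n)
  case (Suc m)
  assume "0 \<le> x" "x \<le> 1"
  then have "x ^ (n * (n + 1)) \<le> x ^ (2 * n)" by (intro power_decreasing) (auto simp: Suc)
  then show ?thesis by (simp add: power_mult)
qed simp

lemma psi_sums:
  assumes "norm q < 1"
  shows "(\<lambda>n. q ^ (n * (n + 1))) sums psi q"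
proof -
  have "summable (\<lambda>n. q ^ (n * (n + 1)))"
  proof (rule summable_comparison_test')
    show "summable (\<lambda>n. ((norm q)\<^sup>2) ^ n)"
      using assms by (intro summable_geometric) (simp add: power_less_one_iff)
    show "norm (q ^ (n * (n + 1))) \<le> ((norm q)\<^sup>2) ^ n" for n
      unfolding norm_power using pronic_power_le[of "norm q" n] assms by simp
  qed
  then show ?thesis unfolding psi_def by (rule summable_sums)
qed

lemma psi_holomorphic: "psi holomorphic_on ball 0 1"
proof (rule power_series_holomorphic)
  fix w :: complex assume w: "w \<in> ball 0 1"
  let ?g = "\<lambda>n::nat. n * (n + 1)"
  let ?a = "\<lambda>m. if m \<in> range ?g then 1 else 0"
  have "(\<lambda>n. ?a (?g n) * w ^ ?g n) sums psi w \<longleftrightarrow> (\<lambda>m. ?a m * w ^ m) sums psi w"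
    by (rule sums_mono_reindex) (auto intro!: strict_monoI add_strict_mono mult_strict_mono)
  moreover have "(\<lambda>n. ?a (?g n) * w ^ ?g n) sums psi w"
    using psi_sums[of w] w by simp
  ultimately show "(\<lambda>m. ?a m * (w - 0) ^ m) sums psi w" by simp
qed

lemma norm_psi_minus_one_le:
  assumes "norm q < 1"
  shows "norm (psi q - 1) \<le> (norm q)\<^sup>2 / (1 - (norm q)\<^sup>2)"
proof -
  let ?x = "norm q"
  have x: "?x\<^sup>2 < 1" using assms by (simp add: power_less_one_iff)
  have 1: "(\<lambda>n. q ^ (Suc n * (Suc n + 1))) sums (psi q - 1)"
    using sums_Suc_iff[of "\<lambda>n. q ^ (n * (n + 1))" "psi q - 1"] psi_sums[OF assms] by simp
  have 2: "(\<lambda>n. ?x\<^sup>2 * (?x\<^sup>2) ^ n) sums (?x\<^sup>2 * (1 / (1 - ?x\<^sup>2)))"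
    using x by (intro sums_mult geometric_sums) simp
  have "norm (\<Sum>n. q ^ (Suc n * (Suc n + 1))) \<le> (\<Sum>n. ?x\<^sup>2 * (?x\<^sup>2) ^ n)"
  proof (rule norm_suminf_le)
    show "norm (q ^ (Suc n * (Suc n + 1))) \<le> ?x\<^sup>2 * (?x\<^sup>2) ^ n" for n
      using pronic_power_le[of ?x "Suc n"] assms unfolding norm_power by (simp only: power_Suc) simp
    show "summable (\<lambda>n. ?x\<^sup>2 * (?x\<^sup>2) ^ n)" using 2 by (rule sums_summable)
  qed
  then show ?thesis using 1 2 by (simp add: sums_iff)
qed

lemma ogf_psi_real:
  assumes "t > 0"
  shows "ogf (exp (- of_real pi * of_real t)) * (2 * exp (- of_real pi / (4 * of_real t)) * psi (exp (- of_real pi / of_real t)))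
    = of_real (sqrt t)"
proof -
  let ?q = "exp (- pi * t)" and ?r = "exp (- pi / t)"
  define R where "R = 2 * exp (- pi / (4 * t)) * (\<Sum>n. ?r ^ (n * (n + 1)))"
  have lt: "norm (of_real ?q :: complex) < 1" "norm (of_real ?r :: complex) < 1" using assms by simp_all
  have "(\<lambda>N. \<Sum>k<Suc N. (if k = 0 then 1 else 2) * sqrt t * ((-1) ^ k * ?q ^ (k\<^sup>2))) \<longlonglongrightarrow> R"
    using theta_transformation_real[OF assms] unfolding R_def sums_def by (rule LIMSEQ_Suc)
  then have "(\<lambda>N. of_real (\<Sum>k<Suc N. (if k = 0 then 1 else 2) * sqrt t * ((-1) ^ k * ?q ^ (k\<^sup>2))) / of_real (sqrt t) :: complex)
      \<longlonglongrightarrow> of_real R / of_real (sqrt t)"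
    using assms by (intro tendsto_divide tendsto_of_real tendsto_const) auto
  moreover have "of_real (\<Sum>k<Suc N. (if k = 0 then 1 else 2) * sqrt t * ((-1) ^ k * ?q ^ (k\<^sup>2))) / of_real (sqrt t)
      = theta_partial (of_real ?q) N" for N
  proof -
    have "(\<Sum>k<Suc N. (if k = 0 then 1 else 2) * sqrt t * ((-1) ^ k * ?q ^ (k\<^sup>2)))
        = sqrt t * (1 + 2 * (\<Sum>s=1..N. (-1) ^ s * ?q ^ (s\<^sup>2)))"
    proof -
      have "{..<Suc N} = insert 0 {1..N}" by auto
      then show ?thesis by (simp add: sum_distrib_left algebra_simps)
    qed
    also have "(of_real \<dots> :: complex) / of_real (sqrt t) = theta_partial (of_real ?q) N"
      using assms by (simp add: theta_partial_def)
    finally show ?thesis .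
  qed
  ultimately have "theta_partial (of_real ?q) \<longlonglongrightarrow> of_real R / of_real (sqrt t)" by simp
  from theta_partial_mult_ogf[OF lt(1) this] have "of_real R / of_real (sqrt t) * ogf (of_real ?q) = 1" .
  then have "ogf (of_real ?q) * of_real R = of_real (sqrt t)" using assms by (simp add: field_simps)
  moreover have "of_real (\<Sum>n. ?r ^ (n * (n + 1))) = psi (of_real ?r)"
  proof -
    have "summable (\<lambda>n. ?r ^ (n * (n + 1)))"
      using psi_sums[OF lt(2), THEN sums_summable] by (simp flip: of_real_power add: summable_complex_of_real)
    then show ?thesis unfolding psi_def by (simp flip: of_real_power add: suminf_of_real)
  qed
  ultimately show ?thesis by (simp add: R_def exp_of_real[symmetric])
qed

text \<open>Poisson summation was carried out for real \<open>t\<close> only. Both sides are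
  holomorphic in the right half-plane and agree on the positive axis, so the identity theorem
  extends the formula.\<close>

lemma ogf_psi:
  assumes "Re z > 0"
  shows "ogf (exp (- of_real pi * z)) * (2 * exp (- of_real pi / (4 * z)) * psi (exp (- of_real pi / z))) = csqrt z"
proof -
  define S where "S = {z. Re z > 0}"
  let ?f = "\<lambda>z. ogf (exp (- of_real pi * z)) * (2 * exp (- of_real pi / (4 * z)) * psi (exp (- of_real pi / z))) - csqrt z"
  have S: "open S" "connected S"
    unfolding S_def by (auto intro: open_halfspace_Re_gt convex_connected convex_halfspace_Re_gt)
  have im1: "exp (- of_real pi * z) \<in> ball 0 1" if "z \<in> S" for z
    using that by (simp add: S_def)
  have im2: "exp (- of_real pi / z) \<in> ball 0 1" if "z \<in> S" for z
  proof -
    have "Re (of_real pi / z) > 0" using that by (auto simp: S_def Re_divide power2_eq_square intro!: divide_pos_pos add_pos_nonneg)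
    then show ?thesis by simp
  qed
  have "?f holomorphic_on S"
  proof -
    have nz: "z \<noteq> 0" if "z \<in> S" for z using that by (auto simp: S_def)
    have 1: "(\<lambda>z. ogf (exp (- of_real pi * z))) holomorphic_on S"
    proof (rule holomorphic_on_compose_gen[OF _ ogf_holomorphic, unfolded o_def])
      show "(\<lambda>z. exp (- of_real pi * z)) holomorphic_on S" by (intro holomorphic_intros)
      show "(\<lambda>z. exp (- of_real pi * z)) ` S \<subseteq> ball 0 1" using im1 by blast
    qed
    have 2: "(\<lambda>z. psi (exp (- of_real pi / z))) holomorphic_on S"
    proof (rule holomorphic_on_compose_gen[OF _ psi_holomorphic, unfolded o_def])
      show "(\<lambda>z. exp (- of_real pi / z)) holomorphic_on S" by (intro holomorphic_intros nz)
      show "(\<lambda>z. exp (- of_real pi / z)) ` S \<subseteq> ball 0 1" using im2 by blast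
    qed
    have 3: "csqrt holomorphic_on S"
      by (rule holomorphic_on_subset[OF holomorphic_on_csqrt]) (auto simp: S_def complex_nonpos_Reals_iff)
    have 4: "(\<lambda>z. exp (- of_real pi / (4 * z))) holomorphic_on S"
      by (intro holomorphic_intros) (use nz in simp)
    show ?thesis
      by (intro holomorphic_on_diff holomorphic_on_mult 1 2 3 4 holomorphic_on_const)
  qed
  moreover have "?f w = 0" if w: "w \<in> of_real ` {0<..}" for w
  proof -
    obtain t where t: "w = of_real t" "t > 0" using w by auto
    then show ?thesis using ogf_psi_real[OF t(2)] csqrt_of_real_nonneg[of "of_real t"] by simp
  qed
  moreover have "1 islimpt (of_real ` {0<..} :: complex set)"
  proof -
    have "\<exists>w\<in>(of_real ` {0<..} :: complex set). w \<noteq> 1 \<and> dist w 1 < e" if "e > 0" for e :: real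
    proof (intro bexI[of _ "of_real (1 + e / 2) :: complex"] conjI)
      have "of_real (1 + e / 2) - 1 = (of_real (e / 2) :: complex)" by simp
      then show "dist (of_real (1 + e / 2)) (1 :: complex) < e"
        unfolding dist_norm using that by (simp only: norm_of_real)
      show "(of_real (1 + e / 2) :: complex) \<in> of_real ` {0<..}"
        using that by (intro imageI) simp
    qed (use that in simp)
    then show ?thesis unfolding islimpt_approachable by blast
  qed
  moreover have "of_real ` {0<..} \<subseteq> S" "1 \<in> S" by (auto simp: S_def)
  ultimately have "?f z = 0"
    using analytic_continuation[of ?f S "of_real ` {0<..}" 1 z] S assms by (auto simp: S_def)
  then show ?thesis by simp
qed

text \<open>By the transformation the generating function is the subtracted term divided by
  \<open>psi r\<close>, with \<open>norm r = exp (- pi R)\<close> and \<open>R = Re (1 / z)\<close>.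
  The deviation of \<open>psi r\<close> from 1 has order \<open>exp (- 2 pi R)\<close>, which more
  than absorbs the growth \<open>exp (pi R / 4)\<close>. The threshold 3/2 ensures
  \<open>norm r ^ 2 <= 1/4\<close>, so that \<open>psi r\<close> stays away from 0.\<close>

lemma ogf_major_arc:
  assumes z: "Re z > 0" and R: "2 * pi * Re (1 / z) \<ge> 3 / 2"
  shows "norm (ogf (exp (- of_real pi * z)) - csqrt z / 2 * exp (of_real pi / (4 * z))) \<le> sqrt (norm z)"
proof -
  define r where "r = exp (- of_real pi / z)"
  define R where "R = Re (1 / z)"
  have nr: "norm r = exp (- pi * R)"
    unfolding r_def R_def by (simp add: Re_divide)
  have r2: "(norm r)\<^sup>2 = exp (- 2 * pi * R)"
    unfolding nr by (simp add: power2_eq_square flip: exp_add)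
  have "exp (3/2 :: real) \<ge> 4"
    using exp_ge_one_plus_x_over_n_power_n[of 12 "3/2"] by (simp add: power_divide)
  moreover have "exp (2 * pi * R) \<ge> exp (3/2)" using R by (simp add: R_def)
  ultimately have "exp (2 * pi * R) \<ge> 4" by linarith
  then have q4: "(norm r)\<^sup>2 \<le> 1/4" unfolding r2 by (simp add: exp_minus field_simps)
  have "norm r < 1"
  proof (rule power2_less_imp_less[where y = 1])
    show "(norm r)\<^sup>2 < 1\<^sup>2" using q4 by simp
  qed simp
  define \<delta> where "\<delta> = norm (psi r - 1)"
  have "\<delta> \<le> (norm r)\<^sup>2 / (1 - (norm r)\<^sup>2)"
    unfolding \<delta>_def by (rule norm_psi_minus_one_le) fact
  also have "\<dots> \<le> (norm r)\<^sup>2 * (4/3)"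
    using q4 mult_left_mono[of "1 / (1 - (norm r)\<^sup>2)" "4/3" "(norm r)\<^sup>2"] by (simp add: field_simps)
  finally have d1: "\<delta> \<le> (norm r)\<^sup>2 * (4/3)" .
  then have d2: "\<delta> \<le> 1/3" using q4 by linarith
  have np: "norm (psi r) \<ge> 2/3"
    using norm_triangle_ineq3[of "psi r" 1] d2 by (simp add: \<delta>_def)
  then have "psi r \<noteq> 0" by auto
  have E: "exp (- of_real pi / (4 * z)) * exp (of_real pi / (4 * z)) = 1"
    by (simp flip: exp_add)
  have "ogf (exp (- of_real pi * z)) * psi r = csqrt z / 2 * exp (of_real pi / (4 * z))"
  proof -
    have "ogf (exp (- of_real pi * z)) * psi r * 2 * (exp (- of_real pi / (4 * z)) * exp (of_real pi / (4 * z)))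
        = csqrt z * exp (of_real pi / (4 * z))"
    proof -
      have "A * P * 2 * (e1 * e2) = (A * (2 * e1 * P)) * e2" for A P e1 e2 :: complex by (simp only: mult_ac)
      from this[of "ogf (exp (- of_real pi * z))" "psi r" "exp (- of_real pi / (4 * z))" "exp (of_real pi / (4 * z))"]
      show ?thesis by (simp only: ogf_psi[OF z, folded r_def])
    qed
    then show ?thesis unfolding E by (simp add: field_simps)
  qed
  then have "(ogf (exp (- of_real pi * z)) - csqrt z / 2 * exp (of_real pi / (4 * z))) * psi r
      = csqrt z / 2 * exp (of_real pi / (4 * z)) * (1 - psi r)"
    by (simp add: algebra_simps)
  from arg_cong[OF this, of norm]
  have "norm (ogf (exp (- of_real pi * z)) - csqrt z / 2 * exp (of_real pi / (4 * z))) * norm (psi r)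
      = norm (csqrt z) / 2 * norm (exp (of_real pi / (4 * z))) * \<delta>"
    unfolding \<delta>_def norm_minus_commute[of "psi r" 1] by (simp only: norm_mult norm_divide norm_numeral)
  also have "norm (exp (of_real pi / (4 * z))) = exp (pi / 4 * R)"
  proof -
    have "of_real pi / (4 * z) = of_real (pi / 4) * (1 / z)" by simp
    then have "Re (of_real pi / (4 * z)) = pi / 4 * R" unfolding R_def by (simp only: times_complex.sel Re_complex_of_real Im_complex_of_real mult_zero_left diff_zero)
    then show ?thesis by simp
  qed
  also have "norm (csqrt z) / 2 * exp (pi / 4 * R) * \<delta> \<le> norm (csqrt z) / 2 * (exp (pi / 4 * R) * ((norm r)\<^sup>2 * (4/3)))"
    unfolding mult.assoc using d1 by (intro mult_left_mono) auto
  also have "exp (pi / 4 * R) * ((norm r)\<^sup>2 * (4/3)) \<le> 4/3"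
  proof -
    have "R \<ge> 0" using R unfolding R_def by (metis (no_types) order_trans[of 0 "3/2"] pi_gt_zero zero_le_divide_iff zero_le_mult_iff zero_le_numeral zero_less_mult_iff zero_less_numeral not_less)
    then have "exp (pi / 4 * R) * (norm r)\<^sup>2 \<le> 1" unfolding r2 by (simp flip: exp_add add: algebra_simps)
    then show ?thesis by (simp add: mult.commute)
  qed
  then have "norm (csqrt z) / 2 * (exp (pi / 4 * R) * ((norm r)\<^sup>2 * (4/3))) \<le> norm (csqrt z) / 2 * (4/3)"
    by (intro mult_left_mono) auto
  finally have "norm (ogf (exp (- of_real pi * z)) - csqrt z / 2 * exp (of_real pi / (4 * z))) * norm (psi r) \<le> norm (csqrt z) * (2/3)" by simp
  moreover have "norm (ogf (exp (- of_real pi * z)) - csqrt z / 2 * exp (of_real pi / (4 * z))) * (2/3)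
     \<le> norm (ogf (exp (- of_real pi * z)) - csqrt z / 2 * exp (of_real pi / (4 * z))) * norm (psi r)"
    using np by (intro mult_left_mono) auto
  moreover have "norm (csqrt z) = sqrt (norm z)"
    by (simp add: norm_csqrt)
  ultimately show ?thesis by simp
qed

text \<open>At positive arguments \<open>psi\<close> is at least its first term 1, so the main term
  is itself an upper bound.\<close>

lemma ogf_real_le:
  assumes y: "y > 0"
  shows "(\<Sum>n. real (overpartition_count n) * exp (- pi * y) ^ n) \<le> sqrt y / 2 * exp (pi / (4 * y))"
proof -
  define F where "F = (\<Sum>n. real (overpartition_count n) * exp (- pi * y) ^ n)"
  define P where "P = (\<Sum>n. exp (- pi / y) ^ (n * (n + 1)))"
  have lt: "exp (- pi * y) < 1" "norm (of_real (exp (- pi / y)) :: complex) < 1" using y by simp_all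
  have sF: "summable (\<lambda>n. real (overpartition_count n) * exp (- pi * y) ^ n)"
    by (rule summable_overpartition_count_real) (use lt in auto)
  have sP: "summable (\<lambda>n. exp (- pi / y) ^ (n * (n + 1)))"
    using psi_sums[OF lt(2), THEN sums_summable] by (simp flip: of_real_power add: summable_complex_of_real)
  have F: "ogf (of_real (exp (- pi * y))) = of_real F"
    unfolding ogf_def F_def using suminf_of_real[OF sF, where 'a = complex] by simp
  have P: "psi (of_real (exp (- pi / y))) = of_real P"
    unfolding psi_def P_def using suminf_of_real[OF sP, where 'a = complex] by simp
  have "of_real (F * (2 * exp (- pi / (4 * y)) * P)) = (of_real (sqrt y) :: complex)"
    using ogf_psi_real[OF y] F P by (simp flip: exp_of_real)
  then have eq: "F * (2 * exp (- pi / (4 * y)) * P) = sqrt y" using of_real_eq_iff by blast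
  have "P \<ge> 1"
    unfolding P_def using sum_le_suminf[OF sP, of "{0}"] by simp
  moreover have "F \<ge> 0" unfolding F_def by (intro suminf_nonneg sF) auto
  ultimately have "F * (2 * exp (- pi / (4 * y))) * 1 \<le> F * (2 * exp (- pi / (4 * y))) * P"
    by (intro mult_left_mono) auto
  moreover have "F * (2 * exp (- pi / (4 * y))) * P = sqrt y" using eq by (simp only: mult.assoc)
  ultimately have "F * (2 * exp (- pi / (4 * y))) \<le> sqrt y" by (simp only: mult_1_right)
  then show ?thesis unfolding F_def[symmetric] by (simp add: exp_minus field_simps)
qed

section \<open>The saving away from \<open>q = 1\<close>\<close>

text \<open>The logarithm of \<open>(1 + w) / (1 - w)\<close> is
  \<open>2 (w + w^3/3 + w^5/5 + ...)\<close> with nonnegative coefficients. Passing from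
  \<open>w\<close> to \<open>norm w\<close> increases the real part of every term; the gain of the
  linear term is kept exactly and the others are discarded.\<close>

lemma norm_factor_le:
  fixes w :: complex
  assumes w: "norm w < 1"
  shows "norm ((1 + w) / (1 - w)) \<le> (1 + norm w) / (1 - norm w) * exp (- 2 * (norm w - Re w))"
proof -
  define b :: "nat \<Rightarrow> real" where "b n = (if odd n \<and> n \<noteq> 1 then 2 / real n else 0)" for n
  have ser: "(\<lambda>n. of_real (b n) * v ^ n) sums (Ln (1 + v) - Ln (1 - v) - 2 * v)" if v: "norm v < 1" for v
  proof -
    have 1: "(\<lambda>n. (-1) ^ Suc n / of_nat n * v ^ n) sums Ln (1 + v)" by (rule Ln_series[OF v])
    have 2: "(\<lambda>n. (-1) ^ Suc n / of_nat n * (- v) ^ n) sums Ln (1 - v)"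
      using Ln_series[of "- v"] v by simp
    have 3: "(\<lambda>n. if n = 1 then 2 * v else 0) sums (2 * v)"
      using sums_single[of 1 "\<lambda>_. 2 * v"] by simp
    have "(\<lambda>n. of_real (b n) * v ^ n) = (\<lambda>n. (-1) ^ Suc n / of_nat n * v ^ n - (-1) ^ Suc n / of_nat n * (- v) ^ n - (if n = 1 then 2 * v else 0))"
      by (auto simp: b_def power_minus_odd fun_eq_iff)
    then show ?thesis using sums_diff[OF sums_diff[OF 1 2] 3] by simp
  qed
  let ?r = "norm w"
  have L: "Ln (1 + of_real ?r) - Ln (1 - of_real ?r) - 2 * of_real ?r = of_real (ln (1 + ?r) - ln (1 - ?r) - 2 * ?r)"
  proof -
    have "Ln (of_real (1 + ?r)) = of_real (ln (1 + ?r))" "Ln (of_real (1 - ?r)) = of_real (ln (1 - ?r))"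
      by (rule Ln_of_real; use w norm_ge_zero[of w] in linarith)+
    then show ?thesis by simp
  qed
  have s1: "(\<lambda>n. Re (of_real (b n) * w ^ n)) sums Re (Ln (1 + w) - Ln (1 - w) - 2 * w)"
    by (rule sums_Re[OF ser[OF w]])
  have s2: "(\<lambda>n. Re (of_real (b n) * of_real ?r ^ n)) sums (ln (1 + ?r) - ln (1 - ?r) - 2 * ?r)"
    using sums_Re[OF ser[of "of_real ?r"]] w unfolding L by simp
  have "Re (of_real (b n) * w ^ n) \<le> Re (of_real (b n) * of_real ?r ^ n)" for n
  proof -
    have "b n \<ge> 0" by (simp add: b_def)
    moreover have "Re (w ^ n) \<le> ?r ^ n" using complex_Re_le_cmod[of "w ^ n"] by (simp add: norm_power)
    ultimately show ?thesis by (simp add: mult_left_mono flip: of_real_power)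
  qed
  then have "Re (Ln (1 + w) - Ln (1 - w) - 2 * w) \<le> ln (1 + ?r) - ln (1 - ?r) - 2 * ?r"
    using sums_le[OF _ s1 s2] by blast
  then have le: "Re (Ln (1 + w) - Ln (1 - w)) \<le> ln (1 + ?r) - ln (1 - ?r) - 2 * (?r - Re w)" by simp
  have nz: "1 + w \<noteq> 0" "1 - w \<noteq> 0" using power_Suc_neq[OF w, of 0] by auto
  have "norm ((1 + w) / (1 - w)) = exp (Re (Ln (1 + w) - Ln (1 - w)))"
    using nz by (simp add: norm_divide exp_diff Re_Ln)
  also have "\<dots> \<le> exp (ln (1 + ?r) - ln (1 - ?r) - 2 * (?r - Re w))" using le by simp
  also have "\<dots> = (1 + ?r) / (1 - ?r) * exp (- 2 * (?r - Re w))"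
  proof -
    have "ln (1 + ?r) - ln (1 - ?r) - 2 * (?r - Re w) = ln ((1 + ?r) / (1 - ?r)) + (- 2 * (?r - Re w))"
      using w ln_divide_pos[of "1 + ?r" "1 - ?r"] add_pos_nonneg[of 1 ?r] by simp
    moreover have "(1 + ?r) / (1 - ?r) > 0" using w by (simp add: add_pos_nonneg)
    ultimately show ?thesis by (simp only: exp_add exp_ln)
  qed
  finally show ?thesis .
qed

text \<open>The linear gains of all factors \<open>w = q^i\<close> form two geometric series. Away
  from \<open>q = 1\<close> the second stays bounded while the first blows up near the unit circle,
  which yields an exponential saving.\<close>

lemma norm_ogf_le:
  assumes q: "norm q < 1"
  shows "norm (ogf q) \<le> (\<Sum>n. real (overpartition_count n) * norm q ^ n) *
           exp (- 2 * (norm q / (1 - norm q) - norm q / norm (1 - q)))"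
proof -
  let ?x = "norm q"
  define F where "F = (\<Sum>n. real (overpartition_count n) * ?x ^ n)"
  have sF: "summable (\<lambda>n. real (overpartition_count n) * ?x ^ n)"
    by (rule summable_overpartition_count_real) (use q in auto)
  have F: "oprod k ?x \<le> F" for k
  proof -
    have "bcount k n \<le> overpartition_count n" for n by (rule bcount_le_overpartition_count)
    then have "(\<Sum>n. real (bcount k n) * ?x ^ n) \<le> F"
      unfolding F_def using bcount_sums_real[of ?x k] q
      by (intro suminf_le sF) (auto simp: sums_iff mult_right_mono)
    then show ?thesis using bcount_sums_real[of ?x k] q by (simp add: sums_iff)
  qed
  have b: "norm (oprod k q) \<le> F * exp (- 2 * (\<Sum>i=1..k. ?x ^ i - Re (q ^ i)))" for k
  proof -
    have "norm (oprod k q) \<le> (\<Prod>i=1..k. (1 + ?x ^ i) / (1 - ?x ^ i) * exp (- 2 * (?x ^ i - Re (q ^ i))))"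
      unfolding oprod_def prod_norm[symmetric]
    proof (intro prod_mono conjI)
      fix i assume i: "i \<in> {1..k}"
      then have "norm (q ^ i) < 1" using q by (simp add: norm_power power_less_one_iff)
      from norm_factor_le[OF this]
      show "norm ((1 + q ^ i) / (1 - q ^ i)) \<le> (1 + ?x ^ i) / (1 - ?x ^ i) * exp (- 2 * (?x ^ i - Re (q ^ i)))"
        by (simp add: norm_power)
    qed auto
    also have "\<dots> = oprod k ?x * exp (- 2 * (\<Sum>i=1..k. ?x ^ i - Re (q ^ i)))"
      unfolding oprod_def prod.distrib by (simp add: sum_distrib_left flip: exp_sum)
    also have "\<dots> \<le> F * exp (- 2 * (\<Sum>i=1..k. ?x ^ i - Re (q ^ i)))"
      by (intro mult_right_mono F) auto
    finally show ?thesis .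
  qed
  have geo: "(\<lambda>k. \<Sum>i=1..k. v ^ i) \<longlonglongrightarrow> v / (1 - v)" if v: "norm v < 1" for v :: "'c::{real_normed_field,banach}"
  proof -
    have "(\<lambda>n. v * v ^ n) sums (v * (1 / (1 - v)))" by (intro sums_mult geometric_sums v)
    then have "(\<lambda>k. \<Sum>i<k. v ^ Suc i) \<longlonglongrightarrow> v / (1 - v)" by (simp add: sums_def)
    moreover have "(\<Sum>i<k. v ^ Suc i) = (\<Sum>i=1..k. v ^ i)" for k
      by (rule sum.reindex_bij_witness[of _ "\<lambda>i. i - 1" Suc]) auto
    ultimately show ?thesis by simp
  qed
  have "(\<lambda>k. \<Sum>i=1..k. ?x ^ i - Re (q ^ i)) \<longlonglongrightarrow> ?x / (1 - ?x) - Re (q / (1 - q))"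
    unfolding sum_subtractf Re_sum[symmetric]
    by (intro tendsto_diff tendsto_Re geo) (use q in auto)
  then have "(\<lambda>k. F * exp (- 2 * (\<Sum>i=1..k. ?x ^ i - Re (q ^ i)))) \<longlonglongrightarrow> F * exp (- 2 * (?x / (1 - ?x) - Re (q / (1 - q))))"
    by (intro tendsto_intros)
  moreover have "(\<lambda>k. norm (oprod k q)) \<longlonglongrightarrow> norm (ogf q)"
    by (intro tendsto_norm oprod_tendsto_ogf q)
  ultimately have "norm (ogf q) \<le> F * exp (- 2 * (?x / (1 - ?x) - Re (q / (1 - q))))"
    using b by (intro LIMSEQ_le) auto
  also have "\<dots> \<le> F * exp (- 2 * (?x / (1 - ?x) - ?x / norm (1 - q)))"
  proof -
    have "Re (q / (1 - q)) \<le> ?x / norm (1 - q)"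
      using complex_Re_le_cmod[of "q / (1 - q)"] by (simp add: norm_divide)
    moreover have "F \<ge> 0" unfolding F_def by (intro suminf_nonneg sF) auto
    ultimately show ?thesis by (intro mult_left_mono) auto
  qed
  finally show ?thesis by (simp add: F_def)
qed

text \<open>For \<open>|x| <= 1/2\<close> the distance from 1 to the ray through \<open>q\<close> is
  \<open>|sin (pi x)|\<close>. With \<open>a = pi |x| <= 8/5\<close>, the bound
  \<open>sin a >= a - a^3/6 >= 43/75 a\<close> and \<open>pi >= 3.14\<close> yield the factor 9/5.
  For larger \<open>|x|\<close> the cosine is nonpositive, so the distance is at least 1, and
  \<open>c <= 1/2\<close> suffices.\<close>

lemma norm_one_minus_exp_ge:
  fixes y x c :: real
  assumes y: "y > 0" and x: "c \<le> \<bar>x\<bar>" "\<bar>x\<bar> \<le> 1" and c: "0 \<le> c" "c \<le> 1/2"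
  shows "norm (1 - exp (- of_real pi * Complex y x)) \<ge> 9/5 * c"
proof -
  define \<rho> where "\<rho> = exp (- pi * y)"
  define \<theta> where "\<theta> = pi * x"
  have e: "exp (- of_real pi * Complex y x) = Complex (\<rho> * cos \<theta>) (- \<rho> * sin \<theta>)"
    by (auto simp: complex_eq_iff Re_exp Im_exp \<rho>_def \<theta>_def)
  have n2: "(norm (1 - exp (- of_real pi * Complex y x)))\<^sup>2 = 1 - 2 * \<rho> * cos \<theta> + \<rho>\<^sup>2"
  proof -
    have "(norm (1 - exp (- of_real pi * Complex y x)))\<^sup>2 = (1 - \<rho> * cos \<theta>)\<^sup>2 + (\<rho> * sin \<theta>)\<^sup>2"
      unfolding e by (simp add: cmod_power2)
    also have "\<dots> = 1 - 2 * \<rho> * cos \<theta> + \<rho>\<^sup>2 * ((sin \<theta>)\<^sup>2 + (cos \<theta>)\<^sup>2)"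
      by algebra
    finally show ?thesis by simp
  qed
  have "(9/5 * c)\<^sup>2 \<le> (norm (1 - exp (- of_real pi * Complex y x)))\<^sup>2"
  proof (cases "\<bar>x\<bar> \<le> 1/2")
    case True
    define a where "a = \<bar>\<theta>\<bar>"
    have pi32: "pi < 16/5" using pi_approx(2) by simp
    have a: "a = pi * \<bar>x\<bar>" "0 \<le> a" "a \<le> 8/5"
      using mult_mono[of pi "16/5" "\<bar>x\<bar>" "1/2"] True pi32 by (auto simp: a_def \<theta>_def abs_mult)
    have "\<bar>sin a - (\<Sum>m<3. sin_coeff m * a ^ m)\<bar> \<le> inverse (fact 3) * \<bar>a\<bar> ^ 3"
      by (rule Maclaurin_sin_bound)
    moreover have "(\<Sum>m<3. sin_coeff m * a ^ m) = a" by (simp add: sin_coeff_def eval_nat_numeral)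
    moreover have "inverse (fact 3) * \<bar>a\<bar> ^ 3 = a ^ 3 / 6" using a(2) by (simp add: fact_numeral)
    ultimately have "sin a \<ge> a - a ^ 3 / 6" by linarith
    moreover have "a ^ 3 / 6 \<le> a * (32 / 75)"
    proof -
      have "a\<^sup>2 \<le> (8/5)\<^sup>2" using a by (intro power_mono) auto
      then have "a * a\<^sup>2 \<le> a * (64/25)" using a by (intro mult_left_mono) (auto simp: power2_eq_square)
      then show ?thesis by (simp add: eval_nat_numeral)
    qed
    moreover have "a \<ge> 157/50 * \<bar>x\<bar>"
      unfolding a(1) using pi_approx(1) by (intro mult_right_mono) auto
    ultimately have "sin a \<ge> 9/5 * c" using x by linarith
    then have "(9/5 * c)\<^sup>2 \<le> (sin a)\<^sup>2" using c by (intro power_mono) auto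
    also have "(sin a)\<^sup>2 = (sin \<theta>)\<^sup>2" by (auto simp: a_def abs_if)
    also have "\<dots> = 1 - (cos \<theta>)\<^sup>2" by (simp add: sin_squared_eq)
    also have "\<dots> \<le> 1 - 2 * \<rho> * cos \<theta> + \<rho>\<^sup>2"
      using zero_le_power2[of "\<rho> - cos \<theta>"] by (simp add: power2_eq_square algebra_simps)
    finally show ?thesis unfolding n2 .
  next
    case False
    have "cos \<theta> = cos \<bar>\<theta>\<bar>" by (simp add: abs_if)
    also have "\<dots> \<le> 0"
    proof -
      have "pi / 2 \<le> \<bar>\<theta>\<bar>" "\<bar>\<theta>\<bar> \<le> pi" using False x by (auto simp: \<theta>_def abs_mult field_simps)
      then show ?thesis using cos_monotone_0_pi_le[of "pi / 2" "\<bar>\<theta>\<bar>"] by simp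
    qed
    finally have "\<rho> * cos \<theta> \<le> 0" by (simp add: \<rho>_def mult_nonneg_nonpos)
    then have "1 - 2 * \<rho> * cos \<theta> + \<rho>\<^sup>2 \<ge> 1" by (simp add: zero_le_power2 add_increasing2)
    moreover have "(9/5 * c)\<^sup>2 \<le> 1" using c by (simp add: abs_square_le_1)
    ultimately show ?thesis unfolding n2 by linarith
  qed
  then show ?thesis by (rule power2_le_imp_le) simp
qed

text \<open>The exponent \<open>pi / (4 y)\<close> of the bound at real arguments is lowered by
  \<open>2 / (pi y)\<close>, up to the bounded loss 2 and the loss \<open>10 / (9 c)\<close> due to
  the nearness of \<open>q = 1\<close>.\<close>

lemma ogf_minor_arc:
  fixes y x c :: real
  assumes y: "y > 0" and x: "c \<le> \<bar>x\<bar>" "\<bar>x\<bar> \<le> 1" and c: "0 < c" "c \<le> 1/2"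
  shows "norm (ogf (exp (- of_real pi * Complex y x))) \<le>
           sqrt y / 2 * exp ((pi / 4 - 2 / pi) / y + 2 + 10 / (9 * c))"
proof -
  let ?q = "exp (- of_real pi * Complex y x)"
  define u where "u = pi * y"
  have u: "u > 0" using y by (simp add: u_def)
  have nq: "norm ?q = exp (- u)" by (simp add: u_def)
  have q: "norm ?q < 1" using u nq by simp
  have "norm (ogf ?q) \<le> (\<Sum>n. real (overpartition_count n) * norm ?q ^ n) *
           exp (- 2 * (norm ?q / (1 - norm ?q) - norm ?q / norm (1 - ?q)))"
    by (rule norm_ogf_le[OF q])
  also have "\<dots> \<le> (sqrt y / 2 * exp (pi / (4 * y))) * exp (- 2 * (1 / u - 1) + 10 / (9 * c))"
  proof (intro mult_mono)
    show "(\<Sum>n. real (overpartition_count n) * norm ?q ^ n) \<le> sqrt y / 2 * exp (pi / (4 * y))"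
      using ogf_real_le[OF y] by (simp add: nq u_def)
    have "1 / u - 1 \<le> norm ?q / (1 - norm ?q)"
    proof -
      have "(1 - u) * 1 \<le> exp (- u) * 1" using exp_ge_add_one_self[of "- u"] by simp
      then have "(1 - u) * (1 - exp (- u)) \<le> exp (- u) * u" by (simp add: algebra_simps)
      then show ?thesis unfolding nq using u by (simp add: field_simps)
    qed
    moreover have "norm ?q / norm (1 - ?q) \<le> 5 / (9 * c)"
    proof -
      have "norm ?q / norm (1 - ?q) \<le> 1 / (9/5 * c)"
        using norm_one_minus_exp_ge[OF y x] c q by (intro frac_le) auto
      then show ?thesis by simp
    qed
    ultimately show "exp (- 2 * (norm ?q / (1 - norm ?q) - norm ?q / norm (1 - ?q))) \<le> exp (- 2 * (1 / u - 1) + 10 / (9 * c))"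
      by (simp add: algebra_simps)
  qed (use y in auto)
  also have "\<dots> = sqrt y / 2 * exp (pi / (4 * y) + (- 2 * (1 / u - 1) + 10 / (9 * c)))"
    by (simp only: exp_add mult.assoc)
  also have "pi / (4 * y) + (- 2 * (1 / u - 1) + 10 / (9 * c)) = (pi / 4 - 2 / pi) / y + 2 + 10 / (9 * c)"
    using y by (simp add: u_def field_simps)
  finally show ?thesis .
qed

section \<open>The main integral\<close>

lemma has_integral_vertical_line:
  fixes k K :: "complex \<Rightarrow> complex"
  assumes "a \<le> b"
    and "\<And>\<tau>. \<tau> \<in> {a..b} \<Longrightarrow> (K has_field_derivative k (u + \<i> * of_real \<tau>)) (at (u + \<i> * of_real \<tau>))"
  shows "((\<lambda>\<tau>. k (u + \<i> * of_real \<tau>)) has_integral (K (u + \<i> * of_real b) - K (u + \<i> * of_real a)) / \<i>) {a..b}"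
proof -
  have "((\<lambda>\<tau>. \<i> * k (u + \<i> * of_real \<tau>)) has_integral (K (u + \<i> * of_real b) - K (u + \<i> * of_real a))) {a..b}"
  proof (rule fundamental_theorem_of_calculus[OF assms(1)])
    fix \<tau> assume \<tau>: "\<tau> \<in> {a..b}"
    have "((\<lambda>\<tau>. u + \<i> * of_real \<tau>) has_vector_derivative \<i>) (at \<tau>)"
      by (auto intro!: derivative_eq_intros)
    from field_vector_diff_chain_at[OF this assms(2)[OF \<tau>]]
    show "((\<lambda>\<tau>. K (u + \<i> * of_real \<tau>)) has_vector_derivative \<i> * k (u + \<i> * of_real \<tau>)) (at \<tau> within {a..b})"
      by (auto simp: o_def intro: has_vector_derivative_at_within)
  qed
  from has_integral_mult_right[OF this, of "1 / \<i>"] show ?thesis by simp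
qed

section \<open>The imaginary error function\<close>

text \<open>This is \<open>sqrt pi / 2\<close> times the entire function erfi.\<close>

definition erfi_prim :: "complex \<Rightarrow> complex" where
  "erfi_prim = (SOME E. E 0 = 0 \<and> (\<forall>u. (E has_field_derivative exp (u\<^sup>2)) (at u)))"

lemma erfi_prim: "erfi_prim 0 = 0" "(erfi_prim has_field_derivative exp (u\<^sup>2)) (at u)"
proof -
  have "(\<lambda>u::complex. exp (u\<^sup>2)) holomorphic_on UNIV" by (intro holomorphic_intros)
  from holomorphic_convex_primitive'[OF convex_UNIV open_UNIV this]
  obtain g where "\<And>x::complex. x \<in> UNIV \<Longrightarrow> (g has_field_derivative exp (x\<^sup>2)) (at x within UNIV)" by blast
  then have g: "(g has_field_derivative exp (x\<^sup>2)) (at x)" for x by simp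
  have "\<exists>E. E 0 = 0 \<and> (\<forall>u::complex. (E has_field_derivative exp (u\<^sup>2)) (at u))"
    by (rule exI[of _ "\<lambda>u. g u - g 0"]) (auto intro!: derivative_eq_intros g)
  from someI_ex[OF this, folded erfi_prim_def]
  show "erfi_prim 0 = 0" "(erfi_prim has_field_derivative exp (u\<^sup>2)) (at u)" by blast+
qed

lemma erfi_prim_minus: "erfi_prim (- u) = - erfi_prim u"
proof -
  have "\<exists>c. \<forall>u\<in>UNIV. erfi_prim u + erfi_prim (- u) = c"
  proof (rule has_field_derivative_zero_constant)
    fix x :: complex
    have "((\<lambda>u. erfi_prim (- u)) has_field_derivative exp ((- x)\<^sup>2) * (- 1)) (at x)"
      by (rule DERIV_chain2[OF erfi_prim(2)]) (auto intro!: derivative_eq_intros)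
    from DERIV_add[OF erfi_prim(2) this]
    show "((\<lambda>u. erfi_prim u + erfi_prim (- u)) has_field_derivative 0) (at x within UNIV)" by simp
  qed simp
  then have "erfi_prim u + erfi_prim (- u) = erfi_prim 0 + erfi_prim (- 0)"
    by (metis UNIV_I)
  then show ?thesis by (simp add: erfi_prim(1) add_eq_0_iff)
qed

lemma gauss_half_integral:
  shows "(\<lambda>x::real. exp (- x\<^sup>2)) integrable_on {0..T}"
    and "integral {0..T} (\<lambda>x::real. exp (- x\<^sup>2)) \<le> sqrt pi / 2"
    and "(\<lambda>N::nat. integral {0..real N} (\<lambda>x. exp (- x\<^sup>2))) \<longlonglongrightarrow> sqrt pi / 2"
proof -
  let ?f = "\<lambda>x::real. exp (- x\<^sup>2)"
  have si: "set_integrable lborel {0..} ?f" and v: "(LINT x:{0..}|lborel. ?f x) = sqrt pi / 2"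
    using gaussian_moment_0 by (auto simp: set_integrable_def set_lebesgue_integral_def has_bochner_integral_iff)
  have i0: "?f integrable_on {0..}" "integral {0..} ?f = sqrt pi / 2"
    using set_borel_integral_eq_integral[OF si] v by auto
  show iT: "?f integrable_on {0..T}" for T
    by (intro integrable_continuous_real continuous_intros)
  show "integral {0..T} ?f \<le> sqrt pi / 2"
    using integral_subset_le[of "{0..T}" "{0..}" ?f] i0 iT by auto
  have un: "(\<Union>N::nat. {0..real N}) = {0..}"
    using real_arch_simple by auto
  have "(\<lambda>N::nat. LINT x:{0..real N}|lborel. ?f x) \<longlonglongrightarrow> (LINT x:(\<Union>N::nat. {0..real N})|lborel. ?f x)"
    by (rule set_integral_cont_up) (use si un in \<open>auto simp: incseq_def\<close>)
  moreover have "(LINT x:{0..real N}|lborel. ?f x) = integral {0..real N} ?f" for N :: nat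
    by (rule set_borel_integral_eq_integral(2)) (rule set_integrable_subset[OF si], auto)
  ultimately show "(\<lambda>N::nat. integral {0..real N} ?f) \<longlonglongrightarrow> sqrt pi / 2"
    unfolding un v by simp
qed

lemma erfi_prim_vertical:
  "((\<lambda>\<tau>. exp ((u + \<i> * of_real \<tau>)\<^sup>2)) has_integral
     (erfi_prim (u + \<i> * of_real T) - erfi_prim u) / \<i>) {0..T}" if "0 \<le> T"
  using has_integral_vertical_line[OF that, of erfi_prim "\<lambda>u. exp (u\<^sup>2)" u] erfi_prim(2) by simp

text \<open>On the imaginary axis the function is \<open>\<i>\<close> times a Gaussian integral.
  Moving sideways from the axis at height \<open>N\<close> costs at most a factor
  \<open>exp (- N^2)\<close> times a constant, so the limit is the same on every vertical
  line.\<close>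

lemma erfi_prim_tendsto:
  assumes u: "Im u \<ge> 0"
  shows "(\<lambda>N::nat. erfi_prim (u + \<i> * of_nat N)) \<longlonglongrightarrow> \<i> * of_real (sqrt pi / 2)"
proof -
  have iN: "erfi_prim (\<i> * of_nat N) = \<i> * of_real (integral {0..real N} (\<lambda>x. exp (- x\<^sup>2)))" for N
  proof -
    have "exp ((0 + \<i> * of_real \<tau>)\<^sup>2) = of_real (exp (- \<tau>\<^sup>2))" for \<tau>
      by (simp add: power_mult_distrib exp_of_real[symmetric])
    then have 1: "((\<lambda>\<tau>. of_real (exp (- \<tau>\<^sup>2)) :: complex) has_integral (erfi_prim (\<i> * of_nat N) - erfi_prim 0) / \<i>) {0..real N}"
      using erfi_prim_vertical[of "real N" 0] by simp
    have 2: "((\<lambda>\<tau>. of_real (exp (- \<tau>\<^sup>2)) :: complex) has_integral of_real (integral {0..real N} (\<lambda>x. exp (- x\<^sup>2)))) {0..real N}"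
      by (intro has_integral_of_real integrable_integral gauss_half_integral)
    have "erfi_prim (\<i> * of_nat N) = \<i> * ((erfi_prim (\<i> * of_nat N) - erfi_prim 0) / \<i>)"
      by (simp add: erfi_prim(1))
    then show ?thesis unfolding has_integral_unique[OF 1 2] .
  qed
  have 1: "(\<lambda>N::nat. erfi_prim (\<i> * of_nat N)) \<longlonglongrightarrow> \<i> * of_real (sqrt pi / 2)"
    unfolding iN by (intro tendsto_intros gauss_half_integral)
  have b: "norm (erfi_prim (u + \<i> * of_nat N) - erfi_prim (\<i> * of_nat N)) \<le> exp ((norm u)\<^sup>2 - (real N)\<^sup>2) * norm u" for N
  proof -
    have "norm (erfi_prim (u + \<i> * of_nat N) - erfi_prim (\<i> * of_nat N))
        \<le> exp ((norm u)\<^sup>2 - (real N)\<^sup>2) * norm (u + \<i> * of_nat N - \<i> * of_nat N)"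
    proof (rule field_differentiable_bound[where S = "closed_segment (\<i> * of_nat N) (u + \<i> * of_nat N)" and f' = "\<lambda>u. exp (u\<^sup>2)"])
      fix z assume "z \<in> closed_segment (\<i> * of_nat N) (u + \<i> * of_nat N)"
      then obtain s where s: "0 \<le> s" "s \<le> 1" "z = (1 - s) *\<^sub>R (\<i> * of_nat N) + s *\<^sub>R (u + \<i> * of_nat N)"
        by (auto simp: in_segment)
      then have z: "Re z = s * Re u" "Im z = s * Im u + real N" by (auto simp: algebra_simps)
      have "Re (z\<^sup>2) = s\<^sup>2 * (Re u)\<^sup>2 - (s * Im u + real N)\<^sup>2"
        by (simp add: power2_eq_square z algebra_simps)
      also have "\<dots> \<le> (norm u)\<^sup>2 - (real N)\<^sup>2"
      proof (intro diff_mono power_mono)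
        have "s\<^sup>2 * (Re u)\<^sup>2 \<le> 1 * (Re u)\<^sup>2" using s by (intro mult_right_mono) (auto simp: power_le_one)
        also have "\<dots> \<le> (norm u)\<^sup>2" by (simp add: cmod_power2)
        finally show "s\<^sup>2 * (Re u)\<^sup>2 \<le> (norm u)\<^sup>2" .
      qed (use s u in auto)
      finally show "norm (exp (z\<^sup>2)) \<le> exp ((norm u)\<^sup>2 - (real N)\<^sup>2)" by simp
      show "(erfi_prim has_field_derivative exp (z\<^sup>2)) (at z within closed_segment (\<i> * of_nat N) (u + \<i> * of_nat N))"
        by (rule has_field_derivative_at_within[OF erfi_prim(2)])
    qed auto
    then show ?thesis by simp
  qed
  have "(\<lambda>N::nat. exp ((norm u)\<^sup>2 - (real N)\<^sup>2) * norm u) \<longlonglongrightarrow> 0"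
    by real_asymp
  then have "(\<lambda>N::nat. erfi_prim (u + \<i> * of_nat N) - erfi_prim (\<i> * of_nat N)) \<longlonglongrightarrow> 0"
    by (rule Lim_null_comparison[OF always_eventually, rotated]) (use b in blast)
  from tendsto_add[OF this 1] show ?thesis by simp
qed

text \<open>Integrate upwards from \<open>u\<close> to infinity: on that ray
  \<open>norm (exp ((u + \<i> \<tau>)^2))\<close> equals
  \<open>norm (exp (u^2)) * exp (- \<tau>^2 - 2 \<tau> Im u)\<close>, and the last term only helps
  when \<open>Im u >= 0\<close>.\<close>

lemma erfi_prim_bound:
  assumes u: "Im u \<ge> 0"
  shows "norm (erfi_prim u - \<i> * of_real (sqrt pi / 2)) \<le> sqrt pi / 2 * norm (exp (u\<^sup>2))"
proof -
  have b: "norm (erfi_prim u - erfi_prim (u + \<i> * of_nat N)) \<le> sqrt pi / 2 * norm (exp (u\<^sup>2))" for N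
  proof -
    note I = erfi_prim_vertical[of "real N" u]
    have "norm ((erfi_prim (u + \<i> * of_real (real N)) - erfi_prim u) / \<i>) \<le> integral {0..real N} (\<lambda>\<tau>. norm (exp (u\<^sup>2)) * exp (- \<tau>\<^sup>2))"
    proof (subst integral_unique[OF I, symmetric], simp, rule integral_norm_bound_integral)
      show "(\<lambda>\<tau>. exp ((u + \<i> * of_real \<tau>)\<^sup>2)) integrable_on {0..real N}" using I by auto
      show "(\<lambda>\<tau>. norm (exp (u\<^sup>2)) * exp (- \<tau>\<^sup>2)) integrable_on {0..real N}"
        by (intro integrable_continuous_real continuous_intros)
      fix \<tau> :: real assume \<tau>: "\<tau> \<in> {0..real N}"
      have "Re ((u + \<i> * of_real \<tau>)\<^sup>2) = Re (u\<^sup>2) - \<tau>\<^sup>2 - 2 * \<tau> * Im u"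
        by (simp add: power2_eq_square algebra_simps)
      also have "\<dots> \<le> Re (u\<^sup>2) - \<tau>\<^sup>2" using u \<tau> by simp
      finally show "norm (exp ((u + \<i> * of_real \<tau>)\<^sup>2)) \<le> norm (exp (u\<^sup>2)) * exp (- \<tau>\<^sup>2)"
        by (simp flip: exp_add)
    qed
    also have "\<dots> = norm (exp (u\<^sup>2)) * integral {0..real N} (\<lambda>\<tau>. exp (- \<tau>\<^sup>2))" by simp
    also have "\<dots> \<le> norm (exp (u\<^sup>2)) * (sqrt pi / 2)"
      by (intro mult_left_mono gauss_half_integral) auto
    finally show ?thesis by (simp add: norm_mult norm_divide norm_minus_commute mult.commute)
  qed
  have "(\<lambda>N::nat. norm (erfi_prim u - erfi_prim (u + \<i> * of_nat N))) \<longlonglongrightarrow> norm (erfi_prim u - \<i> * of_real (sqrt pi / 2))"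
    by (intro tendsto_intros erfi_prim_tendsto u)
  then show ?thesis by (rule LIMSEQ_le_const2) (use b in blast)
qed

text \<open>Endpoints in opposite half-planes contribute the full jump \<open>\<i> sqrt pi\<close>;
  oddness reduces the lower one to the upper half-plane. This jump is the source of the main term of
  the integral.\<close>

lemma erfi_prim_diff_bound:
  assumes u: "Im u \<ge> 0" and v: "Im v \<le> 0" and e: "norm (exp (u\<^sup>2)) \<le> C" "norm (exp (v\<^sup>2)) \<le> C"
  shows "norm (erfi_prim u - erfi_prim v - \<i> * of_real (sqrt pi)) \<le> sqrt pi * C"
proof -
  let ?h = "\<i> * of_real (sqrt pi / 2) :: complex"
  have 1: "norm (erfi_prim u - ?h) \<le> sqrt pi / 2 * C"
    by (rule order_trans[OF erfi_prim_bound[OF u] mult_left_mono[OF e(1)]]) simp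
  have "norm (erfi_prim (- v) - ?h) \<le> sqrt pi / 2 * norm (exp ((- v)\<^sup>2))"
    by (rule erfi_prim_bound) (use v in simp)
  also have "\<dots> \<le> sqrt pi / 2 * C"
    by (rule mult_left_mono) (use e(2) in simp_all)
  finally have 2: "norm (erfi_prim (- v) - ?h) \<le> sqrt pi / 2 * C" .
  have eq: "erfi_prim u - erfi_prim v - \<i> * of_real (sqrt pi) = (erfi_prim u - ?h) + (erfi_prim (- v) - ?h)"
    by (simp add: erfi_prim_minus)
  have "norm (erfi_prim u - erfi_prim v - \<i> * of_real (sqrt pi)) \<le> sqrt pi / 2 * C + sqrt pi / 2 * C"
    unfolding eq by (rule norm_triangle_mono[OF 1 2])
  then show ?thesis by (simp add: mult.commute)
qed

text \<open>In the variable \<open>w = sqrt z\<close> the exponent \<open>b w\<^sup>2 + a / w\<^sup>2\<close> is both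
  \<open>(B w - A / w)\<^sup>2 + 2 A B\<close> and \<open>(B w + A / w)\<^sup>2 - 2 A B\<close> with \<open>A = sqrt a\<close> and \<open>B = sqrt b\<close>. So the
  Bessel integral has a primitive in terms of the primitive of \<open>exp (u\<^sup>2)\<close>.\<close>
definition bessel_prim :: "real \<Rightarrow> real \<Rightarrow> complex \<Rightarrow> complex" where
  "bessel_prim A B w = (w * exp (of_real (B\<^sup>2) * w\<^sup>2 + of_real (A\<^sup>2) / w\<^sup>2)
      + of_real (A - 1 / (2 * B)) * exp (of_real (2 * A * B)) * erfi_prim (of_real B * w - of_real A / w)
      - of_real (A + 1 / (2 * B)) * exp (- of_real (2 * A * B)) * erfi_prim (of_real B * w + of_real A / w)) / of_real (B\<^sup>2)"

text \<open>The target is \<open>sqrt z exp (b z + a / z) dz\<close> written in \<open>w\<close>,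
  where \<open>dz = 2 w dw\<close>. With coefficients \<open>\<alpha>\<close> and
  \<open>\<beta>\<close> the two erfi terms contribute
  \<open>B (\<alpha> - \<beta>) + A (\<alpha> + \<beta>) / w^2\<close> times the exponential.
  Cancelling the unwanted part \<open>1 - 2 A^2 / w^2\<close> from the product rule forces
  \<open>\<alpha> - \<beta> = - 1 / B\<close> and \<open>\<alpha> + \<beta> = 2 A\<close>.\<close>

lemma bessel_prim_deriv:
  assumes "w \<noteq> 0" "B \<noteq> 0"
  shows "(bessel_prim A B has_field_derivative
    2 * w\<^sup>2 * exp (of_real (B\<^sup>2) * w\<^sup>2 + of_real (A\<^sup>2) / w\<^sup>2)) (at w)"
proof -
  let ?\<phi> = "of_real (B\<^sup>2) * w\<^sup>2 + of_real (A\<^sup>2) / w\<^sup>2"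
  let ?\<alpha> = "of_real (A - 1 / (2 * B)) :: complex" and ?\<beta> = "of_real (A + 1 / (2 * B)) :: complex"
  have e1: "exp (of_real (2 * A * B)) * exp ((of_real B * w - of_real A / w)\<^sup>2) = exp ?\<phi>"
    unfolding exp_add[symmetric] using assms by (intro arg_cong[of _ _ exp]) (simp add: field_simps power2_eq_square)
  have e2: "exp (- of_real (2 * A * B)) * exp ((of_real B * w + of_real A / w)\<^sup>2) = exp ?\<phi>"
    unfolding exp_add[symmetric] using assms by (intro arg_cong[of _ _ exp]) (simp add: field_simps power2_eq_square)
  have d0: "((\<lambda>w. w * exp (of_real (B\<^sup>2) * w\<^sup>2 + of_real (A\<^sup>2) / w\<^sup>2)) has_field_derivative
      exp ?\<phi> * (1 + 2 * of_real (B\<^sup>2) * w\<^sup>2 - 2 * of_real (A\<^sup>2) / w\<^sup>2)) (at w)"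
    using assms by (auto intro!: derivative_eq_intros simp: field_simps power2_eq_square)
  have d1: "((\<lambda>w. ?\<alpha> * exp (of_real (2 * A * B)) * erfi_prim (of_real B * w - of_real A / w)) has_field_derivative
      ?\<alpha> * exp (of_real (2 * A * B)) * (exp ((of_real B * w - of_real A / w)\<^sup>2) * (of_real B + of_real A / w\<^sup>2))) (at w)"
    by (intro DERIV_cmult DERIV_chain2[of erfi_prim, OF erfi_prim(2)])
       (use assms in \<open>auto intro!: derivative_eq_intros simp: power2_eq_square\<close>)
  have d2: "((\<lambda>w. ?\<beta> * exp (- of_real (2 * A * B)) * erfi_prim (of_real B * w + of_real A / w)) has_field_derivative
      ?\<beta> * exp (- of_real (2 * A * B)) * (exp ((of_real B * w + of_real A / w)\<^sup>2) * (of_real B - of_real A / w\<^sup>2))) (at w)"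
    by (intro DERIV_cmult DERIV_chain2[of erfi_prim, OF erfi_prim(2)])
       (use assms in \<open>auto intro!: derivative_eq_intros simp: power2_eq_square\<close>)
  have "(bessel_prim A B has_field_derivative
     (exp ?\<phi> * (1 + 2 * of_real (B\<^sup>2) * w\<^sup>2 - 2 * of_real (A\<^sup>2) / w\<^sup>2)
      + ?\<alpha> * exp (of_real (2 * A * B)) * (exp ((of_real B * w - of_real A / w)\<^sup>2) * (of_real B + of_real A / w\<^sup>2))
      - ?\<beta> * exp (- of_real (2 * A * B)) * (exp ((of_real B * w + of_real A / w)\<^sup>2) * (of_real B - of_real A / w\<^sup>2))) / of_real (B\<^sup>2)) (at w)"
    unfolding bessel_prim_def[abs_def] by (intro DERIV_cdivide DERIV_add DERIV_diff d0 d1 d2)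
  moreover have "(exp ?\<phi> * (1 + 2 * of_real (B\<^sup>2) * w\<^sup>2 - 2 * of_real (A\<^sup>2) / w\<^sup>2)
      + ?\<alpha> * exp (of_real (2 * A * B)) * (exp ((of_real B * w - of_real A / w)\<^sup>2) * (of_real B + of_real A / w\<^sup>2))
      - ?\<beta> * exp (- of_real (2 * A * B)) * (exp ((of_real B * w + of_real A / w)\<^sup>2) * (of_real B - of_real A / w\<^sup>2))) / of_real (B\<^sup>2)
     = 2 * w\<^sup>2 * exp ?\<phi>"
  proof -
    have asc: "a * x * (y * d) = (x * y) * (a * d)" for a x y d :: complex by (simp only: mult_ac)
    have "?\<alpha> * exp (of_real (2 * A * B)) * (exp ((of_real B * w - of_real A / w)\<^sup>2) * (of_real B + of_real A / w\<^sup>2))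
        = exp ?\<phi> * (?\<alpha> * (of_real B + of_real A / w\<^sup>2))"
      "?\<beta> * exp (- of_real (2 * A * B)) * (exp ((of_real B * w + of_real A / w)\<^sup>2) * (of_real B - of_real A / w\<^sup>2))
        = exp ?\<phi> * (?\<beta> * (of_real B - of_real A / w\<^sup>2))"
      using asc[of ?\<alpha>] asc[of ?\<beta>] by (simp_all only: e1 e2)
    then have "(exp ?\<phi> * (1 + 2 * of_real (B\<^sup>2) * w\<^sup>2 - 2 * of_real (A\<^sup>2) / w\<^sup>2)
      + ?\<alpha> * exp (of_real (2 * A * B)) * (exp ((of_real B * w - of_real A / w)\<^sup>2) * (of_real B + of_real A / w\<^sup>2))
      - ?\<beta> * exp (- of_real (2 * A * B)) * (exp ((of_real B * w + of_real A / w)\<^sup>2) * (of_real B - of_real A / w\<^sup>2)))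
      = exp ?\<phi> * ((1 + 2 * of_real (B\<^sup>2) * w\<^sup>2 - 2 * of_real (A\<^sup>2) / w\<^sup>2) + ?\<alpha> * (of_real B + of_real A / w\<^sup>2) - ?\<beta> * (of_real B - of_real A / w\<^sup>2))"
      by (simp only: distrib_left right_diff_distrib)
    also have "(1 + 2 * of_real (B\<^sup>2) * w\<^sup>2 - 2 * of_real (A\<^sup>2) / w\<^sup>2) + ?\<alpha> * (of_real B + of_real A / w\<^sup>2) - ?\<beta> * (of_real B - of_real A / w\<^sup>2)
       = 2 * of_real (B\<^sup>2) * w\<^sup>2"
      using assms by (simp add: field_simps power2_eq_square)
    finally show ?thesis using assms by simp
  qed
  ultimately show ?thesis by simp
qed

text \<open>The subtracted value is, up to elementary factors, the modified Bessel function of order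
  -3/2 at \<open>2 A B\<close>. It stems from the two jumps \<open>\<i> sqrt pi\<close> of the erfi
  terms. All the rest is evaluated at the endpoints, where the exponential has norm
  \<open>C\<close>; the hypotheses \<open>z1\<close> and \<open>AB\<close> keep the prefactors there
  under control.\<close>

lemma bessel_integral:
  fixes A B y c :: real
  assumes A: "A > 0" and B: "B > 0" and y: "y > 0" and c: "c > 0" and AB: "1 \<le> 2 * A * B"
    and z1: "y\<^sup>2 + c\<^sup>2 \<le> 1" and big: "A / B \<le> sqrt (y\<^sup>2 + c\<^sup>2)"
  shows "norm (integral {-c..c} (\<lambda>x. csqrt (Complex y x) * exp (of_real (A\<^sup>2) / Complex y x + of_real (B\<^sup>2) * Complex y x))
           - of_real (sqrt pi / B\<^sup>2 * ((A - 1 / (2 * B)) * exp (2 * A * B) - (A + 1 / (2 * B)) * exp (- (2 * A * B)))))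
         \<le> (2 + 2 * sqrt pi * A) / B\<^sup>2 * exp (A\<^sup>2 * y / (y\<^sup>2 + c\<^sup>2) + B\<^sup>2 * y)"
    and "continuous_on {-c..c} (\<lambda>x. csqrt (Complex y x) * exp (of_real (A\<^sup>2) / Complex y x + of_real (B\<^sup>2) * Complex y x))"
proof -
  define C where "C = exp (A\<^sup>2 * y / (y\<^sup>2 + c\<^sup>2) + B\<^sup>2 * y)"
  let ?K = "\<lambda>z. bessel_prim A B (csqrt z)"
  let ?k = "\<lambda>z. csqrt z * exp (of_real (A\<^sup>2) / z + of_real (B\<^sup>2) * z)"
  have npos: "z \<notin> \<real>\<^sub>\<le>\<^sub>0" "csqrt z \<noteq> 0" if "Re z > 0" for z
    using that by (auto simp: complex_nonpos_Reals_iff)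
  have dK: "(?K has_field_derivative ?k z) (at z)" if z: "Re z > 0" for z
  proof -
    have "(?K has_field_derivative (2 * (csqrt z)\<^sup>2 * exp (of_real (B\<^sup>2) * (csqrt z)\<^sup>2 + of_real (A\<^sup>2) / (csqrt z)\<^sup>2)) * inverse (2 * csqrt z)) (at z)"
      by (rule DERIV_chain2[OF bessel_prim_deriv has_field_derivative_csqrt]) (use npos[OF z] B in auto)
    also have "(2 * (csqrt z)\<^sup>2 * exp (of_real (B\<^sup>2) * (csqrt z)\<^sup>2 + of_real (A\<^sup>2) / (csqrt z)\<^sup>2)) * inverse (2 * csqrt z)
       = csqrt z * exp (of_real (B\<^sup>2) * (csqrt z)\<^sup>2 + of_real (A\<^sup>2) / (csqrt z)\<^sup>2)"
    proof -
      have "2 * s\<^sup>2 * e * inverse (2 * s) = s * e" if "s \<noteq> 0" for s e :: complex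
        using that by (simp add: field_simps power2_eq_square)
      then show ?thesis using npos(2)[OF z] by blast
    qed
    also have "\<dots> = ?k z" by (simp add: add.commute)
    finally show ?thesis .
  qed
  have I: "((\<lambda>x. ?k (of_real y + \<i> * of_real x)) has_integral (?K (Complex y c) - ?K (Complex y (-c))) / \<i>) {-c..c}"
    using has_integral_vertical_line[of "-c" c ?K ?k "of_real y"] dK y c by (simp add: Complex_eq)
  then have int: "integral {-c..c} (\<lambda>x. ?k (Complex y x)) = (?K (Complex y c) - ?K (Complex y (-c))) / \<i>"
    by (simp add: Complex_eq integral_unique)
  have "continuous_on {z. Re z > 0} ?k"
    by (intro continuous_intros continuous_on_subset[OF continuous_on_csqrt]) (auto simp: complex_nonpos_Reals_iff)
  then show "continuous_on {-c..c} (\<lambda>x. ?k (Complex y x))"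
    by (rule continuous_on_compose2) (use y in \<open>auto simp: Complex_eq intro!: continuous_intros\<close>)
  define p where "p = csqrt (Complex y c)"
  define m where "m = csqrt (Complex y (-c))"
  have p2: "p\<^sup>2 = Complex y c" "m\<^sup>2 = Complex y (-c)" by (simp_all add: p_def m_def)
  have nz: "norm (Complex y c) = sqrt (y\<^sup>2 + c\<^sup>2)" "norm (Complex y (-c)) = sqrt (y\<^sup>2 + c\<^sup>2)" by (simp_all add: complex_norm)
  have np: "(norm p)\<^sup>2 = sqrt (y\<^sup>2 + c\<^sup>2)" "(norm m)\<^sup>2 = sqrt (y\<^sup>2 + c\<^sup>2)"
    using p2 nz by (metis norm_power)+
  have pm0: "p \<noteq> 0" "m \<noteq> 0" using npos(2) y by (auto simp: p_def m_def)
  have np1: "norm p \<le> 1" "norm m \<le> 1"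
  proof -
    have "(norm p)\<^sup>2 \<le> 1\<^sup>2" "(norm m)\<^sup>2 \<le> 1\<^sup>2" unfolding np using z1 by simp_all
    then show "norm p \<le> 1" "norm m \<le> 1"
      using power2_le_imp_le[of "norm p" 1] power2_le_imp_le[of "norm m" 1] by auto
  qed
  have Re_pos: "Re w > 0" if "w = csqrt z" "Re z > 0" for w z
  proof -
    have "0 < Re w \<or> Re w = 0 \<and> 0 \<le> Im w" using csqrt_principal[of z] that by simp
    moreover have "(Re w)\<^sup>2 - (Im w)\<^sup>2 = Re z"
      using that power2_csqrt[of z] by (metis Re_power2)
    ultimately show ?thesis using that(2) by (smt (verit) zero_le_power2 zero_power2)
  qed
  have Rep: "Re p > 0" "Re m > 0" by (rule Re_pos[OF p_def], use y in simp, rule Re_pos[OF m_def], use y in simp)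
  have Imp: "Im p > 0" "Im m < 0"
  proof -
    have "Im (p\<^sup>2) = 2 * Re p * Im p" "Im (m\<^sup>2) = 2 * Re m * Im m" by (simp_all add: power2_eq_square)
    then have "2 * Re p * Im p = c" "2 * Re m * Im m = - c" using p2 by simp_all
    then have "0 < 2 * Re p * Im p" "2 * Re m * Im m < 0" using c by simp_all
    then show "Im p > 0" "Im m < 0" using Rep by (auto simp: zero_less_mult_iff mult_less_0_iff)
  qed
  have Iminv: "Im (of_real A / w) = - A * Im w / (norm w)\<^sup>2" for w
    by (simp add: Im_divide cmod_power2)
  have e: "norm (exp (of_real (B\<^sup>2) * w\<^sup>2 + of_real (A\<^sup>2) / w\<^sup>2)) = C" if "w = p \<or> w = m" for w
  proof -
    have "Re (of_real (B\<^sup>2) * Complex y x + of_real (A\<^sup>2) / Complex y x) = A\<^sup>2 * y / (y\<^sup>2 + x\<^sup>2) + B\<^sup>2 * y" for x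
      by (simp add: Re_divide power2_eq_square)
    from this[of c] this[of "-c"] show ?thesis using that p2 by (auto simp: C_def)
  qed
  have E1: "norm (exp ((of_real B * w - of_real A / w)\<^sup>2)) = exp (- (2 * A * B)) * C" if "w = p \<or> w = m" for w
  proof -
    have "(of_real B * w - of_real A / w)\<^sup>2 = - of_real (2 * A * B) + (of_real (B\<^sup>2) * w\<^sup>2 + of_real (A\<^sup>2) / w\<^sup>2)"
      using that pm0 by (auto simp: field_simps power2_eq_square)
    then have "norm (exp ((of_real B * w - of_real A / w)\<^sup>2)) = norm (exp (- of_real (2 * A * B) :: complex)) * norm (exp (of_real (B\<^sup>2) * w\<^sup>2 + of_real (A\<^sup>2) / w\<^sup>2))"
      by (simp only: exp_add norm_mult)
    then show ?thesis unfolding e[OF that] by simp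
  qed
  have E2: "norm (exp ((of_real B * w + of_real A / w)\<^sup>2)) = exp (2 * A * B) * C" if "w = p \<or> w = m" for w
  proof -
    have "(of_real B * w + of_real A / w)\<^sup>2 = of_real (2 * A * B) + (of_real (B\<^sup>2) * w\<^sup>2 + of_real (A\<^sup>2) / w\<^sup>2)"
      using that pm0 by (auto simp: field_simps power2_eq_square)
    then have "norm (exp ((of_real B * w + of_real A / w)\<^sup>2)) = norm (exp (of_real (2 * A * B) :: complex)) * norm (exp (of_real (B\<^sup>2) * w\<^sup>2 + of_real (A\<^sup>2) / w\<^sup>2))"
      by (simp only: exp_add norm_mult)
    then show ?thesis unfolding e[OF that] by simp
  qed
  let ?u1 = "of_real B * p - of_real A / p" and ?v1 = "of_real B * m - of_real A / m"
  let ?u2 = "of_real B * p + of_real A / p" and ?v2 = "of_real B * m + of_real A / m"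
  \<comment> \<open>Here \<open>big\<close> enters: with \<open>B - A / (norm w)^2 >= 0\<close> the
    imaginary part of \<open>B w + A / w\<close> has the sign of \<open>Im w\<close> or vanishes, so
    the endpoints lie in opposite closed half-planes. For \<open>B w - A / w\<close> this is
    automatic.\<close>
  have q: "A / (norm p)\<^sup>2 \<le> B" "A / (norm m)\<^sup>2 \<le> B" "A / (norm p)\<^sup>2 \<ge> 0" "A / (norm m)\<^sup>2 \<ge> 0"
    using np A B y c big by (auto simp: field_simps sum_power2_gt_zero_iff)
  have im: "Im ?u1 = (B + A / (norm p)\<^sup>2) * Im p" "Im ?v1 = (B + A / (norm m)\<^sup>2) * Im m"
    "Im ?u2 = (B - A / (norm p)\<^sup>2) * Im p" "Im ?v2 = (B - A / (norm m)\<^sup>2) * Im m"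
    using Iminv[of p] Iminv[of m] by (simp_all add: algebra_simps)
  have im1: "Im ?u1 \<ge> 0" "Im ?v1 \<le> 0" "Im ?u2 \<ge> 0" "Im ?v2 \<le> 0"
    unfolding im using q Imp B by (auto intro!: mult_nonneg_nonneg mult_nonneg_nonpos)
  define D1 where "D1 = erfi_prim ?u1 - erfi_prim ?v1 - \<i> * of_real (sqrt pi)"
  define D2 where "D2 = erfi_prim ?u2 - erfi_prim ?v2 - \<i> * of_real (sqrt pi)"
  have D1: "norm D1 \<le> sqrt pi * (exp (- (2 * A * B)) * C)"
    unfolding D1_def by (rule erfi_prim_diff_bound) (use im1 E1 in auto)
  have D2: "norm D2 \<le> sqrt pi * (exp (2 * A * B) * C)"
    unfolding D2_def by (rule erfi_prim_diff_bound) (use im1 E2 in auto)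
  let ?\<alpha> = "A - 1 / (2 * B)" and ?\<beta> = "A + 1 / (2 * B)"
  let ?ep = "p * exp (of_real (B\<^sup>2) * p\<^sup>2 + of_real (A\<^sup>2) / p\<^sup>2)" and ?em = "m * exp (of_real (B\<^sup>2) * m\<^sup>2 + of_real (A\<^sup>2) / m\<^sup>2)"
  define R where "R = ?ep - ?em + of_real ?\<alpha> * exp (of_real (2 * A * B)) * D1 - of_real ?\<beta> * exp (- of_real (2 * A * B)) * D2"
  have "(bessel_prim A B p - bessel_prim A B m) * of_real (B\<^sup>2) =
      R + \<i> * of_real (sqrt pi) * (of_real ?\<alpha> * exp (of_real (2 * A * B)) - of_real ?\<beta> * exp (- of_real (2 * A * B)))"
  proof -
    have gen: "((ep + a * e1 * Eu1 - b * e2 * Eu2) / BB - (em + a * e1 * Ev1 - b * e2 * Ev2) / BB) * BB =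
        ep - em + a * e1 * (Eu1 - Ev1 - s) - b * e2 * (Eu2 - Ev2 - s) + s * (a * e1 - b * e2)"
      if "BB \<noteq> 0" for ep a e1 Eu1 b e2 Eu2 BB em Ev1 Ev2 s :: complex
      using that by (simp add: field_simps)
    show ?thesis
      unfolding bessel_prim_def R_def D1_def D2_def by (rule gen) (use B in simp)
  qed
  then have "bessel_prim A B p - bessel_prim A B m =
      (R + \<i> * of_real (sqrt pi) * (of_real ?\<alpha> * exp (of_real (2 * A * B)) - of_real ?\<beta> * exp (- of_real (2 * A * B)))) / of_real (B\<^sup>2)"
    using B by (simp add: eq_divide_eq)
  then have "integral {-c..c} (\<lambda>x. ?k (Complex y x)) =
      R / (\<i> * of_real (B\<^sup>2)) + of_real (sqrt pi / B\<^sup>2 * (?\<alpha> * exp (2 * A * B) - ?\<beta> * exp (- (2 * A * B))))"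
    unfolding int p_def[symmetric] m_def[symmetric]
  proof -
    have gen: "bp - bm = (R + \<i> * S * V) / X \<Longrightarrow> X \<noteq> 0 \<Longrightarrow> (bp - bm) / \<i> = R / (\<i> * X) + S / X * V"
      for bp bm R S V X :: complex by (simp add: field_simps)
    have "(of_real (sqrt pi / B\<^sup>2 * (?\<alpha> * exp (2 * A * B) - ?\<beta> * exp (- (2 * A * B)))) :: complex) =
      of_real (sqrt pi) / of_real (B\<^sup>2) * (of_real ?\<alpha> * exp (of_real (2 * A * B)) - of_real ?\<beta> * exp (- of_real (2 * A * B)))"
      by (simp only: of_real_mult of_real_divide of_real_diff of_real_exp of_real_minus)
    then show "(bessel_prim A B p - bessel_prim A B m) / \<i> = R / (\<i> * of_real (B\<^sup>2)) +
      of_real (sqrt pi / B\<^sup>2 * (?\<alpha> * exp (2 * A * B) - ?\<beta> * exp (- (2 * A * B))))"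
      using gen[OF \<open>bessel_prim A B p - bessel_prim A B m = _\<close>] B by simp
  qed
  then have "norm (integral {-c..c} (\<lambda>x. ?k (Complex y x)) - of_real (sqrt pi / B\<^sup>2 * (?\<alpha> * exp (2 * A * B) - ?\<beta> * exp (- (2 * A * B)))))
      = norm R / B\<^sup>2"
    using B by (simp add: norm_divide norm_mult norm_power)
  also have "norm R \<le> (2 + 2 * sqrt pi * A) * C"
  proof -
    have a0: "?\<alpha> \<ge> 0" "?\<beta> \<ge> 0" using A B AB by (auto simp: field_simps)
    have C0: "C > 0" by (simp add: C_def)
    have "norm ?ep \<le> 1 * C" "norm ?em \<le> 1 * C"
      unfolding norm_mult using e np1 C0 by (auto intro!: mult_mono)
    moreover have "norm (of_real ?\<alpha> * exp (of_real (2 * A * B)) * D1) \<le> ?\<alpha> * (sqrt pi * C)"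
    proof -
      have "norm (of_real ?\<alpha> * exp (of_real (2 * A * B)) * D1) = ?\<alpha> * (exp (2 * A * B) * norm D1)"
        unfolding norm_mult using a0 by (simp only: norm_of_real abs_of_nonneg norm_exp_eq_Re Re_complex_of_real mult.assoc)
      also have "\<dots> \<le> ?\<alpha> * (exp (2 * A * B) * (sqrt pi * (exp (- (2 * A * B)) * C)))"
        using a0 D1 by (intro mult_left_mono) auto
      also have "\<dots> = ?\<alpha> * (sqrt pi * C)" by (simp add: exp_minus field_simps)
      finally show ?thesis .
    qed
    moreover have "norm (of_real ?\<beta> * exp (- of_real (2 * A * B)) * D2) \<le> ?\<beta> * (sqrt pi * C)"
    proof -
      have "norm (of_real ?\<beta> * exp (- of_real (2 * A * B)) * D2) = ?\<beta> * (exp (- (2 * A * B)) * norm D2)"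
        unfolding norm_mult using a0 by (simp only: norm_of_real abs_of_nonneg norm_exp_eq_Re Re_complex_of_real uminus_complex.sel mult.assoc)
      also have "\<dots> \<le> ?\<beta> * (exp (- (2 * A * B)) * (sqrt pi * (exp (2 * A * B) * C)))"
        using a0 D2 by (intro mult_left_mono) auto
      also have "\<dots> = ?\<beta> * (sqrt pi * C)" by (simp add: exp_minus field_simps)
      finally show ?thesis .
    qed
    moreover have "norm R \<le> norm ?ep + norm ?em + norm (of_real ?\<alpha> * exp (of_real (2 * A * B)) * D1) + norm (of_real ?\<beta> * exp (- of_real (2 * A * B)) * D2)"
      unfolding R_def by (intro norm_triangle_le norm_triangle_le_diff add_mono order_refl)
    ultimately have "norm R \<le> 1 * C + 1 * C + ?\<alpha> * (sqrt pi * C) + ?\<beta> * (sqrt pi * C)" by linarith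
    then show ?thesis by (simp add: algebra_simps)
  qed
  finally show "norm (integral {-c..c} (\<lambda>x. ?k (Complex y x)) - of_real (sqrt pi / B\<^sup>2 * (?\<alpha> * exp (2 * A * B) - ?\<beta> * exp (- (2 * A * B)))))
      \<le> (2 + 2 * sqrt pi * A) / B\<^sup>2 * exp (A\<^sup>2 * y / (y\<^sup>2 + c\<^sup>2) + B\<^sup>2 * y)"
    using B by (simp add: C_def divide_right_mono)
qed

section \<open>An asymptotic formula\<close>

lemma integral_exp_vertical:
  fixes y :: real and k :: int
  shows "((\<lambda>x. exp (of_real pi * of_int k * Complex y x)) has_integral (if k = 0 then 2 else 0)) {-1..1}"
proof (cases "k = 0")
  case True
  then show ?thesis using has_integral_const_real[of "1::complex" "-1" 1] by (simp add: scaleR_conv_of_real)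
next
  case False
  let ?c = "of_real pi * of_int k :: complex"
  have c: "?c \<noteq> 0" using False by simp
  have "((\<lambda>x. exp (?c * (of_real y + \<i> * of_real x))) has_integral
     (exp (?c * (of_real y + \<i> * of_real 1)) / ?c - exp (?c * (of_real y + \<i> * of_real (-1))) / ?c) / \<i>) {-1..1}"
    by (rule has_integral_vertical_line[where K = "\<lambda>z. exp (?c * z) / ?c"])
       (use c in \<open>auto intro!: derivative_eq_intros\<close>)
  moreover have "exp (?c * (of_real y + \<i> * of_real 1)) = exp (?c * (of_real y + \<i> * of_real (-1)))"
  proof -
    have "?c * (of_real y + \<i> * of_real 1) = ?c * (of_real y + \<i> * of_real (-1)) + 2 * of_int k * of_real pi * \<i>"
      by (simp add: algebra_simps)
    then show ?thesis by (simp only: exp_add) (simp add: exp_integer_2pi mult_ac)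
  qed
  ultimately show ?thesis using False by (simp add: Complex_eq)
qed

text \<open>Cauchy's coefficient formula with \<open>q = exp (- pi z)\<close>: the circle is
  traversed once while \<open>x\<close> runs over an interval of length 2, which explains the factor
  2.\<close>

lemma overpartition_count_integral:
  fixes y :: real
  assumes y: "y > 0"
  shows "((\<lambda>x. ogf (exp (- of_real pi * Complex y x)) * exp (of_real (pi * real n) * Complex y x))
           has_integral 2 * of_nat (overpartition_count n)) {-1..1}"
    and "continuous_on {-1..1} (\<lambda>x. ogf (exp (- of_real pi * Complex y x)) * exp (of_real (pi * real n) * Complex y x))"
proof -
  let ?t = "\<lambda>m x. of_nat (overpartition_count m) * exp (- of_real pi * Complex y x) ^ m * exp (of_real (pi * real n) * Complex y x)"
  let ?f = "\<lambda>x. ogf (exp (- of_real pi * Complex y x)) * exp (of_real (pi * real n) * Complex y x)"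
  have lt: "norm (exp (- of_real pi * Complex y x)) < 1" for x using y by simp
  have cl: "continuous_on S (\<lambda>x. Complex y x)" for S
    unfolding Complex_eq by (intro continuous_intros)
  have "uniform_limit {-1..1} (\<lambda>N x. \<Sum>m<N. ?t m x) (\<lambda>x. \<Sum>m. ?t m x) sequentially"
  proof (rule Weierstrass_m_test)
    show "norm (?t m x) \<le> real (overpartition_count m) * exp (- pi * y) ^ m * exp (pi * real n * y)" for m x
      by (simp add: norm_mult norm_power)
    show "summable (\<lambda>m. real (overpartition_count m) * exp (- pi * y) ^ m * exp (pi * real n * y))"
      by (intro summable_mult2 summable_overpartition_count_real) (use y in auto)
  qed
  also have "(\<lambda>x. \<Sum>m. ?t m x) = ?f"
    unfolding ogf_def using summable_overpartition_count(1)[OF lt] by (simp add: suminf_mult2)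
  finally have ul: "uniform_limit {-1..1} (\<lambda>N x. \<Sum>m<N. ?t m x) ?f sequentially" .
  have ct: "continuous_on {-1..1} (\<lambda>x. \<Sum>m<N. ?t m x)" for N
    by (intro continuous_intros cl)
  show "continuous_on {-1..1} ?f"
    by (rule uniform_limit_theorem[OF always_eventually[OF allI[OF ct]] ul]) simp
  obtain I J where I: "\<And>N. ((\<lambda>x. \<Sum>m<N. ?t m x) has_integral I N) {-1..1}"
    and J: "(?f has_integral J) {-1..1}" and IJ: "I \<longlonglongrightarrow> J"
    by (rule uniform_limit_integral[OF ul ct]) auto
  have t: "(?t m has_integral of_nat (overpartition_count m) * (if int n - int m = 0 then 2 else 0)) {-1..1}" for m
  proof -
    have "?t m = (\<lambda>x. of_nat (overpartition_count m) * exp (of_real pi * of_int (int n - int m) * Complex y x))"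
      by (rule ext) (simp add: exp_of_nat_mult[symmetric] exp_add[symmetric] algebra_simps)
    then show ?thesis using has_integral_mult_right[OF integral_exp_vertical[of "int n - int m" y]] by simp
  qed
  have "I N = 2 * of_nat (overpartition_count n)" if "N > n" for N
  proof -
    have "((\<lambda>x. \<Sum>m<N. ?t m x) has_integral (\<Sum>m<N. of_nat (overpartition_count m) * (if int n - int m = 0 then 2 else 0))) {-1..1}"
      by (intro has_integral_sum t) auto
    also have "(\<Sum>m<N. of_nat (overpartition_count m) * (if int n - int m = 0 then 2 else 0)) = (\<Sum>m<N. if m = n then 2 * of_nat (overpartition_count n) else 0 :: complex)"
      by (intro sum.cong) auto
    also have "\<dots> = 2 * of_nat (overpartition_count n)" using that by simp
    finally show ?thesis using has_integral_unique[OF I] by blast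
  qed
  then have "I \<longlonglongrightarrow> 2 * of_nat (overpartition_count n)"
    by (intro tendsto_eventually eventually_sequentiallyI[of "Suc n"]) auto
  then show "(?f has_integral 2 * of_nat (overpartition_count n)) {-1..1}"
    using IJ LIMSEQ_unique J by metis
qed

lemma norm_integral_le:
  fixes f :: "real \<Rightarrow> complex"
  assumes "a \<le> b" "continuous_on {a..b} f" "\<And>x. x \<in> {a..b} \<Longrightarrow> norm (f x) \<le> B"
  shows "norm (integral {a..b} f) \<le> B * (b - a)"
  using assms by (rule integral_bound)

lemma norm_add3_diff_le:
  fixes u v w k :: complex
  assumes "norm u \<le> a" "norm (v - k) \<le> b" "norm w \<le> d"
  shows "norm (u + v + w - k) \<le> a + b + d"
  using norm_triangle_mono[OF norm_triangle_mono[OF assms(1,2)] assms(3)] by (simp add: algebra_simps)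

text \<open>The growing exponential part of the leading Hardy-Ramanujan-Rademacher term, which is
  \<open>1 / (2 pi)\<close> times the derivative of
  \<open>sinh (pi sqrt x) / sqrt x\<close>.\<close>

definition opart_approx :: "real \<Rightarrow> real" where
  "opart_approx x = exp (pi * sqrt x) * (1 - 1 / (pi * sqrt x)) / (8 * x)"

text \<open>The linear rate is \<open>5 pi / 4 - 8 / pi < 1.3806\<close>, and
  \<open>sqrt s <= s / 10 + 5 / 2\<close> makes the lower-order term linear. The slack up to 17/10
  absorbs the constants from \<open>s = 22\<close> on.\<close>

lemma minor_arc_exponent:
  fixes s :: real
  assumes s: "s \<ge> 22"
  shows "pi * s / 4 + ((pi / 4 - 2 / pi) * (4 * s) + 2 + 10 / 9 * sqrt s) \<le> 17 / 10 * s + 1 / 2"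
proof -
  have p: "pi \<le> 31416 / 10000" "pi > 0" using pi_approx(2) by simp_all
  have "8 / pi \<ge> 8 / (31416 / 10000)" using p by (intro divide_left_mono) auto
  then have "5 * pi / 4 - 8 / pi \<le> 13806 / 10000" using p by simp
  then have "(5 * pi / 4 - 8 / pi) * s \<le> 13806 / 10000 * s" using s by (intro mult_right_mono) auto
  moreover have "sqrt s \<le> s / 10 + 5 / 2"
  proof (rule real_le_lsqrt)
    show "s \<le> (s / 10 + 5 / 2)\<^sup>2" using zero_le_power2[of "s / 10 - 5 / 2"] by (simp add: power2_eq_square algebra_simps)
  qed (use s in auto)
  moreover have "pi * s / 4 + (pi / 4 - 2 / pi) * (4 * s) = (5 * pi / 4 - 8 / pi) * s" by (simp add: algebra_simps)
  ultimately show ?thesis using s by linarith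
qed

lemma overpartition_count_estimate:
  assumes n: "n \<ge> 484"
  shows "\<bar>real (overpartition_count n) - opart_approx (real n)\<bar> \<le> exp (17 / 10 * sqrt (real n))"
proof -
  define s where "s = sqrt (real n)"
  have s2: "s\<^sup>2 = real n" by (simp add: s_def)
  have s: "s \<ge> 22" unfolding s_def by (rule real_le_rsqrt) (use n in simp)
  \<comment> \<open>For \<open>y = t / s\<close> the minor arc exponent per unit of \<open>s\<close>
    is \<open>(pi / 4 - 2 / pi) / t + pi t\<close>, whose minimum lies near \<open>t = 0.22\<close>.
    The saddle point \<open>t = 1/2\<close> of the main term would give about 1.87, too much for
    17/10.\<close>
  define y where "y = 1 / (4 * s)"
  \<comment> \<open>The scale at which \<open>y / c^2 = 1/4\<close> is constant. At the ends of the
    major arc \<open>Re (1 / z)\<close> is then just below 1/4: large enough for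
    \<open>ogf_major_arc\<close>, yet bounded, so that the endpoint terms of the Bessel integral are
    harmless. The minor arc pays only \<open>10/9 sqrt s\<close>.\<close>
  define c where "c = 1 / sqrt s"
  have y: "y > 0" "y \<le> 1/4" using s by (auto simp: y_def field_simps)
  have sq: "sqrt s \<ge> 4" by (rule real_le_rsqrt) (use s in simp)
  have c: "c > 0" "c \<le> 1/4" using sq s frac_le[of 1 1 4 "sqrt s"] by (auto simp: c_def)
  have c2: "c\<^sup>2 = 1 / s" using s by (simp add: c_def power_divide)
  have "y\<^sup>2 \<le> (1/4)\<^sup>2" "c\<^sup>2 \<le> (1/4)\<^sup>2" using y c by (auto intro!: power_mono)
  then have yc1: "y\<^sup>2 + c\<^sup>2 \<le> 1" by (simp add: power2_eq_square)
  define A where "A = sqrt pi / 2"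
  define B where "B = sqrt pi * s"
  have A2: "A\<^sup>2 = pi / 4" by (simp add: A_def power_divide)
  have B2: "B\<^sup>2 = pi * real n" by (simp add: B_def power_mult_distrib s2)
  have AB: "2 * A * B = pi * s" by (simp add: A_def B_def)
  have pos: "A > 0" "B > 0" using s by (auto simp: A_def B_def)
  have ps: "pi * s \<ge> 1" using s pi_gt3 mult_mono[of 1 pi 1 s] by simp
  define e where "e = exp (pi * s / 4)"
  have ny: "pi * real n * y = pi * s / 4"
    using s by (simp add: y_def s2[symmetric] power2_eq_square field_simps)
  define Bm where "Bm = sqrt y / 2 * exp ((pi / 4 - 2 / pi) / y + 2 + 10 / (9 * c))"
  let ?f = "\<lambda>x. ogf (exp (- of_real pi * Complex y x)) * exp (of_real (pi * real n) * Complex y x)"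
  let ?k = "\<lambda>x. csqrt (Complex y x) * exp (of_real (A\<^sup>2) / Complex y x + of_real (B\<^sup>2) * Complex y x)"
  note F = overpartition_count_integral[OF y(1), of n]
  have contf: "continuous_on {a..b} ?f" if "-1 \<le> a" "b \<le> 1" for a b
    by (rule continuous_on_subset[OF F(2)]) (use that in auto)
  have ne: "norm (exp (of_real (pi * real n) * Complex y x)) = e" for x
    by (simp add: e_def ny)
  have minor: "norm (?f x) \<le> Bm * e" if "c \<le> \<bar>x\<bar>" "\<bar>x\<bar> \<le> 1" for x
    unfolding norm_mult ne Bm_def
    using ogf_minor_arc[OF y(1) that c(1)] c(2) by (intro mult_right_mono) (auto simp: e_def)
  have c0: "y\<^sup>2 + c\<^sup>2 > 0" using y by (simp add: add_pos_nonneg)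
  have major: "norm (?f x - ?k x / 2) \<le> 1 * e" if "x \<in> {-c..c}" for x
  proof -
    let ?z = "Complex y x"
    have x2: "x\<^sup>2 \<le> c\<^sup>2" using that by (metis abs_le_iff abs_le_square_iff abs_of_pos atLeastAtMost_iff c(1) minus_le_iff)
    have "y / (y\<^sup>2 + c\<^sup>2) \<le> y / (y\<^sup>2 + x\<^sup>2)"
      using y x2 by (intro divide_left_mono mult_pos_pos) (auto simp: add_pos_nonneg)
    moreover have "y / (y\<^sup>2 + c\<^sup>2) \<ge> 24 / 100"
    proof -
      have "y\<^sup>2 = y / (4 * s)" by (simp add: y_def power2_eq_square)
      moreover have "1 / s = 4 * y" by (simp add: y_def)
      ultimately have "y\<^sup>2 + c\<^sup>2 = y * (1 / (4 * s) + 4)" using c2 by (simp add: algebra_simps)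
      then have "y / (y\<^sup>2 + c\<^sup>2) = 1 / (1 / (4 * s) + 4)" using y by simp
      moreover have "1 / (4 * s) \<le> 1 / 88" "0 \<le> 1 / (4 * s)" using s by (auto intro!: divide_left_mono)
      then have "1 / (1/88 + 4) \<le> 1 / (1 / (4 * s) + 4)" by (intro frac_le; linarith)
      ultimately show ?thesis by simp
    qed
    moreover have "Re (1 / ?z) = y / (y\<^sup>2 + x\<^sup>2)" by (simp add: Re_divide)
    ultimately have "Re (1 / ?z) \<ge> 24 / 100" by linarith
    then have "2 * pi * Re (1 / ?z) \<ge> 2 * (314/100) * (24 / 100)"
      using pi_approx(1) by (intro mult_mono) auto
    then have R: "2 * pi * Re (1 / ?z) \<ge> 3 / 2" by simp
    have "norm ?z \<le> 1" using x2 yc1 by (simp add: complex_norm)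
    then have z1: "sqrt (norm ?z) \<le> 1" by simp
    have "Re ?z > 0" using y by simp
    from order_trans[OF ogf_major_arc[OF this R] z1]
    have G: "norm (ogf (exp (- of_real pi * ?z)) - csqrt ?z / 2 * exp (of_real pi / (4 * ?z))) \<le> 1" .
    have eq: "?f x - ?k x / 2 = (ogf (exp (- of_real pi * ?z)) - csqrt ?z / 2 * exp (of_real pi / (4 * ?z))) * exp (of_real (pi * real n) * ?z)"
      unfolding A2 B2 by (simp add: exp_add algebra_simps)
    show ?thesis unfolding eq norm_mult ne by (rule mult_right_mono[OF G]) (simp add: e_def)
  qed
  have AB1: "1 \<le> 2 * A * B" unfolding AB by (rule ps)
  have big: "A / B \<le> sqrt (y\<^sup>2 + c\<^sup>2)"
  proof -
    have "A / B = 1 / (2 * s)" by (simp add: A_def B_def)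
    also have "\<dots> \<le> sqrt (c\<^sup>2)"
    proof -
      have "(1 / (2 * s))\<^sup>2 \<le> 1 / s" using s by (simp add: power2_eq_square field_simps)
      then show ?thesis using c2 s by (intro real_le_rsqrt) auto
    qed
    also have "\<dots> \<le> sqrt (y\<^sup>2 + c\<^sup>2)" by simp
    finally show ?thesis .
  qed
  have contk: "continuous_on {-c..c} ?k"
    by (rule bessel_integral(2)[OF pos y(1) c(1) AB1 yc1 big])
  have split: "2 * of_nat (overpartition_count n) = integral {-1..-c} ?f + integral {-c..c} ?f + integral {c..1} ?f"
  proof -
    have int: "?f integrable_on {-1..1}" using F(1) by (rule has_integral_integrable)
    have "integral {-1..-c} ?f + integral {-c..1} ?f = integral {-1..1} ?f"
      by (rule Henstock_Kurzweil_Integration.integral_combine[OF _ _ int]) (use c in auto)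
    moreover have "integral {-c..c} ?f + integral {c..1} ?f = integral {-c..1} ?f"
      by (rule Henstock_Kurzweil_Integration.integral_combine[OF _ _ integrable_subinterval_real[OF int]]) (use c in auto)
    ultimately show ?thesis using integral_unique[OF F(1)] by (simp only: add.assoc)
  qed
  have i1: "norm (integral {-1..-c} ?f) \<le> Bm * e * (- c - (-1))"
    by (rule norm_integral_le[OF _ contf minor]) (use c in auto)
  have i3: "norm (integral {c..1} ?f) \<le> Bm * e * (1 - c)"
    by (rule norm_integral_le[OF _ contf minor]) (use c in auto)
  have i2: "norm (integral {-c..c} ?f - integral {-c..c} ?k / 2) \<le> 1 * e * (c - (- c))"
  proof -
    have "integral {-c..c} ?f - integral {-c..c} ?k / 2 = integral {-c..c} (\<lambda>x. ?f x - ?k x / 2)"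
    proof -
      have "?f integrable_on {-c..c}" "(\<lambda>x. ?k x / 2) integrable_on {-c..c}"
        using c by (intro integrable_continuous_real contf continuous_intros contk; simp)+
      from integral_diff[OF this] show ?thesis by simp
    qed
    also have "norm \<dots> \<le> 1 * e * (c - (- c))"
    proof (rule norm_integral_le[OF _ _ major])
      show "continuous_on {-c..c} (\<lambda>x. ?f x - ?k x / 2)"
        using c by (intro continuous_on_diff continuous_on_divide continuous_on_const contf contk) auto
    qed (use c in auto)
    finally show ?thesis .
  qed
  have Bme: "Bm * e * (1 - c) \<le> Bm * e" "e * c \<le> e / 4"
  proof -
    have "Bm * e \<ge> 0" "e \<ge> 0" using y by (auto simp: Bm_def e_def)
    then show "Bm * e * (1 - c) \<le> Bm * e" "e * c \<le> e / 4"
      using c mult_left_mono[of c "1/4" e] by (auto intro: mult_left_le)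
  qed
  have n1: "norm (2 * of_nat (overpartition_count n) - integral {-c..c} ?k / 2) \<le> 2 * (Bm * e) + e / 2"
  proof -
    have "norm (2 * of_nat (overpartition_count n) - integral {-c..c} ?k / 2)
        \<le> Bm * e * (- c - (-1)) + 1 * e * (c - (- c)) + Bm * e * (1 - c)"
      unfolding split by (rule norm_add3_diff_le[OF i1 i2 i3])
    moreover have "Bm * e * (- c - (-1)) = Bm * e * (1 - c)" "1 * e * (c - (- c)) = 2 * (e * c)" by simp_all
    ultimately show ?thesis using Bme by linarith
  qed
  define Mn where "Mn = sqrt pi / B\<^sup>2 * ((A - 1 / (2 * B)) * exp (2 * A * B) - (A + 1 / (2 * B)) * exp (- (2 * A * B)))"
  have "norm (integral {-c..c} ?k - of_real Mn) \<le> (2 + 2 * sqrt pi * A) / B\<^sup>2 * exp (A\<^sup>2 * y / (y\<^sup>2 + c\<^sup>2) + B\<^sup>2 * y)"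
    unfolding Mn_def
    by (rule bessel_integral(1)[OF pos y(1) c(1) AB1 yc1 big])
  also have "\<dots> \<le> 1 / 2 * e"
  proof -
    have "exp (A\<^sup>2 * y / (y\<^sup>2 + c\<^sup>2) + B\<^sup>2 * y) \<le> exp (1 / 4) * e"
    proof -
      have "y / (y\<^sup>2 + c\<^sup>2) \<le> y / c\<^sup>2" using y c by (intro divide_left_mono) (auto simp: add_nonneg_pos)
      also have "\<dots> = 1 / 4" using s by (simp add: c2 y_def)
      finally have "A\<^sup>2 * (y / (y\<^sup>2 + c\<^sup>2)) \<le> 1 * (1 / 4)" using y c0 pi_less_4 by (intro mult_mono) (auto simp: A2)
      then show ?thesis unfolding e_def exp_add[symmetric] B2 ny by simp
    qed
    also have "\<dots> \<le> 2 * e"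
    proof -
      have "exp (1/4 :: real) \<le> 1 + 1/4 + (1/4)\<^sup>2" by (rule exp_bound) auto
      then show ?thesis by (intro mult_right_mono) (auto simp: power2_eq_square e_def)
    qed
    finally have "(2 + 2 * sqrt pi * A) / B\<^sup>2 * exp (A\<^sup>2 * y / (y\<^sup>2 + c\<^sup>2) + B\<^sup>2 * y) \<le> (2 + 2 * sqrt pi * A) / B\<^sup>2 * (2 * e)"
      using pos by (intro mult_left_mono) auto
    also have "\<dots> \<le> 1 / 4 * (2 * e)"
    proof (rule mult_right_mono)
      have "8 \<le> real n" using n by simp
      then have "pi * 8 \<le> pi * real n" by (intro mult_left_mono) auto
      then have "2 + pi \<le> 1 / 4 * (pi * real n)" using pi_gt3 by linarith
      moreover have "0 < pi * real n" using n by simp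
      moreover have "2 + 2 * sqrt pi * A = 2 + pi" by (simp add: A_def)
      ultimately show "(2 + 2 * sqrt pi * A) / B\<^sup>2 \<le> 1 / 4" by (simp only: B2 pos_divide_le_eq)
    qed (simp add: e_def)
    finally show ?thesis by simp
  qed
  finally have n2: "norm (integral {-c..c} ?k - of_real Mn) \<le> 1 / 2 * e" .
  \<comment> \<open>The factor 1/4 combines the 1/2 in the major arc approximation with the length 2
    of the circle. The decaying exponential is split off and counted as error.\<close>
  have Mn: "Mn / 4 = opart_approx (real n) - (1 + 1 / (pi * s)) / (8 * real n) * exp (- (pi * s))"
  proof -
    have 1: "sqrt pi * A = pi / 2" "sqrt pi * (1 / (2 * B)) = 1 / (2 * s)" by (simp_all add: A_def B_def)
    have "Mn = 1 / B\<^sup>2 * ((sqrt pi * A - sqrt pi * (1 / (2 * B))) * exp (pi * s) - (sqrt pi * A + sqrt pi * (1 / (2 * B))) * exp (- (pi * s)))"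
      unfolding Mn_def AB by (simp add: algebra_simps)
    then have M: "Mn = 1 / (pi * real n) * ((pi / 2 - 1 / (2 * s)) * exp (pi * s) - (pi / 2 + 1 / (2 * s)) * exp (- (pi * s)))"
      unfolding 1 B2 .
    have gen: "1 / (p * N) * ((p / 2 - 1 / (2 * s)) * E - (p / 2 + 1 / (2 * s)) * E') / 4 =
        E * (1 - 1 / (p * s)) / (8 * N) - (1 + 1 / (p * s)) / (8 * N) * E'"
      if "p \<noteq> 0" "N \<noteq> 0" "s \<noteq> 0" for p N s E E' :: real
      using that by (simp add: field_simps)
    show ?thesis unfolding opart_approx_def s_def[symmetric] M
      by (rule gen) (use n s in auto)
  qed
  have small: "\<bar>(1 + 1 / (pi * s)) / (8 * real n) * exp (- (pi * s))\<bar> \<le> e / 4"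
  proof -
    have "1 / (pi * s) \<le> 1" "1 / (pi * s) \<ge> 0" using ps by auto
    moreover have "real n \<ge> 1" using n by simp
    ultimately have "(1 + 1 / (pi * s)) / (8 * real n) \<le> 2 / 8" "0 \<le> (1 + 1 / (pi * s)) / (8 * real n)"
      by (intro frac_le divide_nonneg_nonneg; linarith)+
    then have "(1 + 1 / (pi * s)) / (8 * real n) \<le> 1 / 4" "0 \<le> (1 + 1 / (pi * s)) / (8 * real n)" by simp_all
    moreover have "exp (- (pi * s)) \<le> e" unfolding e_def using s by simp
    ultimately have "(1 + 1 / (pi * s)) / (8 * real n) * exp (- (pi * s)) \<le> 1 / 4 * e"
      by (intro mult_mono) auto
    moreover have "0 \<le> (1 + 1 / (pi * s)) / (8 * real n) * exp (- (pi * s))"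
      using \<open>0 \<le> (1 + 1 / (pi * s)) / (8 * real n)\<close> by (rule mult_nonneg_nonneg) simp
    ultimately show ?thesis by linarith
  qed
  have "\<bar>real (overpartition_count n) - Mn / 4\<bar> \<le> Bm * e + e / 4 + e / 8"
  proof -
    have "norm (of_real (2 * real (overpartition_count n) - Mn / 2) :: complex) =
       norm ((2 * of_nat (overpartition_count n) - integral {-c..c} ?k / 2) + (integral {-c..c} ?k - of_real Mn) / 2)"
      by (intro arg_cong[of _ _ norm]) (simp add: field_simps)
    also have "\<dots> \<le> (2 * (Bm * e) + e / 2) + 1 / 2 * e / 2"
      by (rule norm_triangle_mono[OF n1]) (use n2 in \<open>simp add: norm_divide\<close>)
    finally show ?thesis unfolding norm_of_real by simp
  qed
  then have "\<bar>real (overpartition_count n) - opart_approx (real n)\<bar> \<le> Bm * e + e"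
    using small unfolding Mn by (simp only: abs_le_iff) linarith
  also have "Bm * e \<le> 1 / 8 * exp (17 / 10 * s)"
  proof -
    have "sqrt y \<le> 1 / 8"
      by (rule real_le_lsqrt) (use y s in \<open>auto simp: y_def power2_eq_square field_simps\<close>)
    have "Bm * e = sqrt y / 2 * exp (pi * s / 4 + ((pi / 4 - 2 / pi) * (4 * s) + 2 + 10 / 9 * sqrt s))"
      unfolding Bm_def e_def by (simp add: y_def c_def exp_add mult_ac)
    also have "\<dots> \<le> 1 / 8 / 2 * exp (17 / 10 * s + 1 / 2)"
      using \<open>sqrt y \<le> 1 / 8\<close> y minor_arc_exponent[OF s] by (intro mult_mono) auto
    also have "\<dots> = 1 / 16 * (exp (1 / 2) * exp (17 / 10 * s))" by (simp add: exp_add)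
    also have "\<dots> \<le> 1 / 16 * (2 * exp (17 / 10 * s))"
    proof -
      have "exp (1/2 :: real) \<le> 1 + 1/2 + (1/2)\<^sup>2" by (rule exp_bound) auto
      then show ?thesis by (intro mult_left_mono mult_right_mono) (auto simp: power2_eq_square)
    qed
    finally show ?thesis by simp
  qed
  also have "e \<le> 1 / 2 * exp (17 / 10 * s)"
  proof -
    have "pi * s / 4 \<le> s" using pi_less_4 s mult_right_mono[of pi 4 s] by simp
    then have "e \<le> exp s" by (simp add: e_def)
    moreover have "exp (17 / 10 * s) = exp (7 / 10 * s) * exp s" by (simp flip: exp_add)
    moreover have "exp (7 / 10 * s) \<ge> 2" using exp_ge_add_one_self[of "7 / 10 * s"] s by linarith
    then have "2 * exp s \<le> exp (7 / 10 * s) * exp s" by (intro mult_right_mono) auto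
    ultimately show ?thesis by linarith
  qed
  finally have "\<bar>real (overpartition_count n) - opart_approx (real n)\<bar> \<le> 1 / 8 * exp (17 / 10 * s) + 1 / 2 * exp (17 / 10 * s)"
    by simp
  moreover have "exp (17 / 10 * s) > 0" by simp
  ultimately show ?thesis unfolding s_def by linarith
qed

section \<open>The logarithm of the main term\<close>

text \<open>The auxiliary \<open>g t = f (x + t) + f (x - t) - C t^2\<close> is nonincreasing on
  \<open>[0, 1]\<close>, by the mean value theorem applied to \<open>f'\<close>; then compare
  \<open>g 1\<close> with \<open>g 0\<close>.\<close>

lemma second_diff_le:
  fixes f f' f'' :: "real \<Rightarrow> real"
  assumes f: "\<And>t. t \<in> {x-1..x+1} \<Longrightarrow> (f has_real_derivative f' t) (at t)"
    and f': "\<And>t. t \<in> {x-1..x+1} \<Longrightarrow> (f' has_real_derivative f'' t) (at t)"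
    and le: "\<And>t. t \<in> {x-1..x+1} \<Longrightarrow> f'' t \<le> C"
  shows "f (x + 1) + f (x - 1) - 2 * f x \<le> C"
proof -
  define g where "g t = f (x + t) + f (x - t) - C * t\<^sup>2" for t
  have "g 1 \<le> g 0"
  proof (rule DERIV_nonpos_imp_nonincreasing[where f = g and a = 0 and b = 1])
    fix t :: real assume t: "0 \<le> t" "t \<le> 1"
    have "(g has_real_derivative (f' (x + t) * 1 + f' (x - t) * (- 1) - C * (2 * t))) (at t)"
      unfolding g_def
      by (intro DERIV_diff DERIV_add DERIV_chain2[OF f])
         (use t in \<open>auto intro!: derivative_eq_intros\<close>)
    moreover have "f' (x + t) - f' (x - t) \<le> C * (2 * t)"
    proof (cases "t = 0")
      case False
      then have "x - t < x + t" using t by simp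
      then obtain z where z: "x - t < z" "z < x + t" "f' (x + t) - f' (x - t) = (x + t - (x - t)) * f'' z"
        using MVT2[of "x - t" "x + t" f' f''] f' t by auto
      then have "f'' z \<le> C" using t by (intro le) auto
      then have "(2 * t) * f'' z \<le> (2 * t) * C" using t by (intro mult_left_mono) auto
      then show ?thesis using z(3) by (simp add: algebra_simps)
    qed simp
    ultimately show "\<exists>y. (g has_real_derivative y) (at t) \<and> y \<le> 0" by force
  qed simp
  then show ?thesis by (simp add: g_def)
qed

lemma second_diff_ge:
  fixes f f' f'' :: "real \<Rightarrow> real"
  assumes f: "\<And>t. t \<in> {x-1..x+1} \<Longrightarrow> (f has_real_derivative f' t) (at t)"
    and f': "\<And>t. t \<in> {x-1..x+1} \<Longrightarrow> (f' has_real_derivative f'' t) (at t)"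
    and ge: "\<And>t. t \<in> {x-1..x+1} \<Longrightarrow> C \<le> f'' t"
  shows "C \<le> f (x + 1) + f (x - 1) - 2 * f x"
proof -
  have "- f (x + 1) + - f (x - 1) - 2 * - f x \<le> - C"
  proof (rule second_diff_le)
    fix t assume t: "t \<in> {x-1..x+1}"
    show "((\<lambda>t. - f t) has_real_derivative - f' t) (at t)" by (rule DERIV_minus[OF f[OF t]])
    show "((\<lambda>t. - f' t) has_real_derivative - f'' t) (at t)" by (rule DERIV_minus[OF f'[OF t]])
    show "- f'' t \<le> - C" using ge[OF t] by simp
  qed
  then show ?thesis by simp
qed

text \<open>The combination is the fourth central difference, that is, the second difference applied
  twice. The operator commutes with differentiation, so the second-difference bounds are used first
  for \<open>f2\<close> and then for the second difference of \<open>f\<close>.\<close>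

lemma abs_fourth_diff_le:
  fixes f :: "real \<Rightarrow> real"
  assumes d1: "\<And>t. t \<in> {x-2..x+2} \<Longrightarrow> (f has_real_derivative f1 t) (at t)"
    and d2: "\<And>t. t \<in> {x-2..x+2} \<Longrightarrow> (f1 has_real_derivative f2 t) (at t)"
    and d3: "\<And>t. t \<in> {x-2..x+2} \<Longrightarrow> (f2 has_real_derivative f3 t) (at t)"
    and d4: "\<And>t. t \<in> {x-2..x+2} \<Longrightarrow> (f3 has_real_derivative f4 t) (at t)"
    and le: "\<And>t. t \<in> {x-2..x+2} \<Longrightarrow> \<bar>f4 t\<bar> \<le> C"
  shows "\<bar>(f (x + 2) + f (x - 2) - 2 * f x) - 4 * (f (x + 1) + f (x - 1) - 2 * f x)\<bar> \<le> C"
proof -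
  let ?g = "\<lambda>h t. h (t + 1) + h (t - 1) - 2 * h t"
  have der: "(?g h has_real_derivative ?g h' t) (at t)"
    if "\<And>t. t \<in> {x-2..x+2} \<Longrightarrow> (h has_real_derivative h' t) (at t)" "t \<in> {x-1..x+1}" for h h' t
  proof -
    have "((\<lambda>t. h (t + 1)) has_real_derivative h' (t + 1) * 1) (at t)"
      "((\<lambda>t. h (t - 1)) has_real_derivative h' (t - 1) * 1) (at t)"
      by (rule DERIV_chain2[OF that(1)]; use that(2) in \<open>auto intro!: derivative_eq_intros\<close>)+
    moreover have "(h has_real_derivative h' t) (at t)" by (rule that(1)) (use that(2) in auto)
    ultimately show ?thesis by (auto intro!: derivative_eq_intros)
  qed
  have b: "\<bar>?g f2 t\<bar> \<le> C" if "t \<in> {x-1..x+1}" for t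
  proof -
    have sub: "u \<in> {x-2..x+2}" if "u \<in> {t-1..t+1}" for u
      using that \<open>t \<in> {x-1..x+1}\<close> by auto
    have f4: "f4 u \<le> C" "- C \<le> f4 u" if "u \<in> {t-1..t+1}" for u
      using le[OF sub[OF that]] by (simp_all add: abs_le_iff)
    have "?g f2 t \<le> C" by (rule second_diff_le[OF d3[OF sub] d4[OF sub] f4(1)])
    moreover have "- C \<le> ?g f2 t" by (rule second_diff_ge[OF d3[OF sub] d4[OF sub] f4(2)])
    ultimately show ?thesis by (simp add: abs_le_iff)
  qed
  have b': "?g f2 t \<le> C" "- C \<le> ?g f2 t" if "t \<in> {x-1..x+1}" for t
    using b[OF that] by (simp_all add: abs_le_iff)
  have "?g (?g f) x \<le> C"
    by (rule second_diff_le[OF der[OF d1] der[OF d2] b'(1)])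
  moreover have "- C \<le> ?g (?g f) x"
    by (rule second_diff_ge[OF der[OF d1] der[OF d2] b'(2)])
  moreover have "x + 1 + 1 = x + 2" "x - 1 - 1 = x - 2" by simp_all
  ultimately show ?thesis by (simp add: algebra_simps)
qed

text \<open>Logarithm of \<open>8 * opart_approx x\<close>, with
  \<open>(1 - 1 / (pi sqrt x)) / x\<close> rewritten as
  \<open>(sqrt x - 1 / pi) / x^(3/2)\<close>.\<close>

definition lga :: "real \<Rightarrow> real" where
  "lga x = pi * sqrt x - 3 / 2 * ln x + ln (sqrt x - 1 / pi)"

lemma opart_approx_eq_exp:
  assumes "x \<ge> 1"
  shows "opart_approx x = exp (lga x) / 8"
proof -
  have "1 / pi < 1" using pi_gt3 by simp
  then have pos: "sqrt x - 1 / pi > 0" using real_sqrt_ge_1_iff[of x] assms by linarith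
  have "exp (3 / 2 * ln x) = x * sqrt x"
  proof -
    have "ln (sqrt x) = ln x / 2" using assms by (simp add: ln_sqrt)
    then have "3 / 2 * ln x = ln x + ln (sqrt x)" by linarith
    then have "exp (3 / 2 * ln x) = exp (ln x) * exp (ln (sqrt x))" by (simp only: exp_add)
    then show ?thesis using assms by simp
  qed
  then have "exp (lga x) = exp (pi * sqrt x) / (x * sqrt x) * (sqrt x - 1 / pi)"
    unfolding lga_def exp_add exp_diff using pos by simp
  also have "\<dots> / 8 = opart_approx x"
  proof -
    have "sqrt x > 0" "x > 0" using assms by auto
    then show ?thesis by (simp add: opart_approx_def field_simps)
  qed
  finally show ?thesis by simp
qed

lemma DERIV_const_divide_power:
  fixes f :: "real \<Rightarrow> real"
  assumes "(f has_real_derivative f') (at x)" "f x \<noteq> 0"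
  shows "((\<lambda>x. c / f x ^ k) has_real_derivative - real k * c * f' / f x ^ Suc k) (at x)"
proof (cases k)
  case (Suc m)
  have "((\<lambda>x. c / f x ^ Suc m) has_real_derivative - (c * (real (Suc m) * (f x ^ m * f'))) / (f x ^ Suc m)\<^sup>2) (at x)"
    using assms by (auto intro!: derivative_eq_intros simp: power2_eq_square simp del: power_Suc)
  also have "- (c * (real (Suc m) * (f x ^ m * f'))) / (f x ^ Suc m)\<^sup>2 = - real (Suc m) * c * f' / f x ^ Suc (Suc m)"
    using assms(2) by (simp add: field_simps power2_eq_square)
  finally show ?thesis unfolding Suc .
qed simp

lemma DERIV_const_divide_sqrt_power:
  fixes x :: real
  assumes "x > 0" "m = k + 2"
  shows "((\<lambda>x. c / sqrt x ^ k) has_real_derivative - real k * c / (2 * sqrt x ^ m)) (at x)"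
proof -
  have e: "inverse (sqrt x) / 2 = 1 / (2 * sqrt x)" by (simp add: inverse_eq_divide)
  have s: "sqrt x \<noteq> 0" using assms(1) by simp
  have "- real k * c * (1 / (2 * sqrt x)) / sqrt x ^ Suc k = - real k * c / (2 * sqrt x ^ m)"
    unfolding assms(2) by (simp add: mult.assoc)
  with DERIV_const_divide_power[OF DERIV_real_sqrt[OF assms(1), unfolded e] s, of c k]
  show ?thesis by (simp only:)
qed

text \<open>Equal to \<open>sqrt x * (sqrt x - 1 / pi)\<close>, so that
  \<open>ln (sqrt x - 1 / pi)\<close> has derivative \<open>1 / (2 * lv x)\<close>. The functions
  \<open>lv1\<close> to \<open>lv3\<close> are its successive derivatives.\<close>

definition "lv x = x - sqrt x / pi" for x :: real
definition "lv1 x = 1 - 1 / (2 * pi * sqrt x)" for x :: real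
definition "lv2 x = 1 / (4 * pi * sqrt x ^ 3)" for x :: real
definition "lv3 x = - 3 / (8 * pi * sqrt x ^ 5)" for x :: real

lemma lv_deriv:
  assumes "x > 0"
  shows "(lv has_real_derivative lv1 x) (at x)"
    and "(lv1 has_real_derivative lv2 x) (at x)"
    and "(lv2 has_real_derivative lv3 x) (at x)"
proof -
  have s: "sqrt x > 0" "sqrt x \<noteq> 0" using assms by auto
  show "(lv has_real_derivative lv1 x) (at x)"
    unfolding lv_def[abs_def] lv1_def using assms s by (auto intro!: derivative_eq_intros simp: field_simps)
  have "((\<lambda>x. 1 - (1 / (2 * pi)) / sqrt x ^ 1) has_real_derivative 0 - - real 1 * (1 / (2 * pi)) / (2 * sqrt x ^ 3)) (at x)"
    by (intro DERIV_diff DERIV_const DERIV_const_divide_sqrt_power assms) simp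
  then show "(lv1 has_real_derivative lv2 x) (at x)"
    unfolding lv1_def[abs_def] lv2_def by (simp add: mult.assoc)
  have "((\<lambda>x. (1 / (4 * pi)) / sqrt x ^ 3) has_real_derivative - real 3 * (1 / (4 * pi)) / (2 * sqrt x ^ 5)) (at x)"
    by (rule DERIV_const_divide_sqrt_power[OF assms]) simp
  then show "(lv2 has_real_derivative lv3 x) (at x)"
    unfolding lv2_def[abs_def] lv3_def by (simp add: mult.assoc)
qed

definition "lga1 x = pi / (2 * sqrt x) - 3 / (2 * x) + 1 / (2 * lv x)" for x :: real
definition "lga2 x = - pi / (4 * sqrt x ^ 3) + 3 / (2 * x\<^sup>2) - lv1 x / (2 * (lv x)\<^sup>2)" for x :: real
definition "lga3 x = 3 * pi / (8 * sqrt x ^ 5) - 3 / x ^ 3 - lv2 x / (2 * (lv x)\<^sup>2) + (lv1 x)\<^sup>2 / lv x ^ 3" for x :: real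
definition "lga4 x = - 15 * pi / (16 * sqrt x ^ 7) + 9 / x ^ 4 - lv3 x / (2 * (lv x)\<^sup>2)
    + 3 * lv1 x * lv2 x / lv x ^ 3 - 3 * lv1 x ^ 3 / lv x ^ 4" for x :: real

lemma lv_bounds:
  assumes "x \<ge> 484"
  shows "sqrt x \<ge> 22" "lv x \<ge> 98 / 100 * x" "0 \<le> lv1 x" "lv1 x \<le> 1"
    "0 \<le> lv2 x" "lv2 x \<le> 1 / (12 * sqrt x ^ 3)" "\<bar>lv3 x\<bar> \<le> 1 / (8 * sqrt x ^ 5)"
proof -
  show s: "sqrt x \<ge> 22" by (rule real_le_rsqrt) (use assms in simp)
  have "sqrt x * 22 \<le> sqrt x * sqrt x" using s assms by (intro mult_left_mono) auto
  then have "sqrt x \<le> x / 22" using assms by simp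
  moreover have "sqrt x / pi \<le> sqrt x / 3" using pi_gt3 s assms by (intro divide_left_mono) auto
  ultimately show "lv x \<ge> 98 / 100 * x" unfolding lv_def using assms by linarith
  have "1 * 1 \<le> 2 * pi * sqrt x" using s pi_gt3 assms by (intro mult_mono) auto
  then show "0 \<le> lv1 x" "lv1 x \<le> 1" unfolding lv1_def using s by (auto simp: divide_le_eq)
  have pw: "sqrt x ^ 3 > 0" "sqrt x ^ 5 > 0" using assms by simp_all
  show "0 \<le> lv2 x" unfolding lv2_def using pw pi_gt_zero by (intro divide_nonneg_nonneg mult_nonneg_nonneg) linarith+
  have "12 * sqrt x ^ 3 \<le> 4 * pi * sqrt x ^ 3" using pw pi_gt3 by (intro mult_right_mono) linarith+
  then show "lv2 x \<le> 1 / (12 * sqrt x ^ 3)"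
    unfolding lv2_def using pw by (intro frac_le; linarith)
  have "24 * sqrt x ^ 5 \<le> 8 * pi * sqrt x ^ 5" using pw pi_gt3 by (intro mult_right_mono) linarith+
  then have "3 / (8 * pi * sqrt x ^ 5) \<le> 3 / (24 * sqrt x ^ 5)" using pw by (intro frac_le; linarith)
  moreover have "\<bar>lv3 x\<bar> = 3 / (8 * pi * sqrt x ^ 5)"
    unfolding lv3_def abs_divide using pw by (simp add: abs_mult)
  ultimately show "\<bar>lv3 x\<bar> \<le> 1 / (8 * sqrt x ^ 5)" by simp
qed

lemma lga_deriv:
  assumes x: "x \<ge> 484"
  shows "(lga has_real_derivative lga1 x) (at x)"
    and "(lga1 has_real_derivative lga2 x) (at x)"
    and "(lga2 has_real_derivative lga3 x) (at x)"
    and "(lga3 has_real_derivative lga4 x) (at x)"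
proof -
  note b = lv_bounds[OF x]
  have x0: "x > 0" "x \<noteq> 0" using x by auto
  have s: "sqrt x > 0" "sqrt x \<noteq> 0" using x0 by auto
  have v: "lv x > 0" "lv x \<noteq> 0" using b(2) x by auto
  note d = lv_deriv[OF x0(1)]
  have p: "1 / pi < 1" using pi_gt3 by simp
  have sp: "1 / pi < sqrt x" using p b(1) by linarith
  have "((\<lambda>x. ln (sqrt x - 1 / pi)) has_real_derivative (inverse (sqrt x) / 2) / (sqrt x - 1 / pi)) (at x)"
    using sp x0 by (auto intro!: derivative_eq_intros)
  also have "(inverse (sqrt x) / 2) / (sqrt x - 1 / pi) = 1 / (2 * lv x)"
  proof -
    have lv: "lv x = sqrt x * (sqrt x - 1 / pi)" using x0 by (simp add: lv_def right_diff_distrib)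
    have "inverse u / 2 / w = 1 / (2 * (u * w))" for u w :: real by (simp add: field_simps)
    then show ?thesis unfolding lv .
  qed
  finally have dln: "((\<lambda>x. ln (sqrt x - 1 / pi)) has_real_derivative 1 / (2 * lv x)) (at x)" .
  have "((\<lambda>x. pi * sqrt x - 3 / 2 * ln x) has_real_derivative (pi / (2 * sqrt x) - 3 / (2 * x))) (at x)"
    using DERIV_diff[OF DERIV_cmult[OF DERIV_real_sqrt[OF x0(1)], of pi] DERIV_cmult[OF DERIV_ln_divide[OF x0(1)], of "3 / 2"]]
    by (simp add: inverse_eq_divide mult.commute)
  from DERIV_add[OF this dln] show "(lga has_real_derivative lga1 x) (at x)"
    unfolding lga_def[abs_def] lga1_def .
  note ds = DERIV_const_divide_sqrt_power[OF x0(1)]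
  note dx = DERIV_const_divide_power[OF DERIV_ident x0(2)]
  note dv = DERIV_const_divide_power[OF d(1) v(2)]
  let ?D2 = "- real 1 * (pi / 2) / (2 * sqrt x ^ 3) - (- real 1 * (3 / 2) * 1 / x ^ Suc 1)
      + (- real 1 * (1 / 2) * lv1 x / lv x ^ Suc 1)"
  have "(lga1 has_real_derivative ?D2) (at x)"
    using DERIV_add[OF DERIV_diff[OF ds[of 3 1 "pi / 2"] dx[of "3 / 2" 1]] dv[of "1 / 2" 1]]
    by (simp add: lga1_def[abs_def])
  moreover have "?D2 = lga2 x" by (simp add: lga2_def power2_eq_square)
  ultimately show "(lga1 has_real_derivative lga2 x) (at x)" by (simp only:)
  let ?D3 = "- real 3 * (- pi / 4) / (2 * sqrt x ^ 5) + (- real 2 * (3 / 2) * 1 / x ^ Suc 2)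
      - (lv1 x * (- real 2 * (1 / 2) * lv1 x / lv x ^ Suc 2) + lv2 x * ((1 / 2) / lv x ^ 2))"
  have "((\<lambda>x. (- pi / 4) / sqrt x ^ 3 + (3 / 2) / x ^ 2 - lv1 x * ((1 / 2) / lv x ^ 2)) has_real_derivative ?D3) (at x)"
    by (intro DERIV_diff DERIV_add DERIV_mult' ds[of 5 3 "- pi / 4"] dx[of "3 / 2" 2] d(2) dv[of "1 / 2" 2]) simp
  moreover have "(\<lambda>x. (- pi / 4) / sqrt x ^ 3 + (3 / 2) / x ^ 2 - lv1 x * ((1 / 2) / lv x ^ 2)) = lga2"
    by (simp add: lga2_def fun_eq_iff)
  moreover have "?D3 = lga3 x" by (simp add: lga3_def power2_eq_square power3_eq_cube)
  ultimately show "(lga2 has_real_derivative lga3 x) (at x)" by (simp only:)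
  let ?D4 = "- real 5 * (3 * pi / 8) / (2 * sqrt x ^ 7) - (- real 3 * 3 * 1 / x ^ Suc 3)
      - (lv2 x * (- real 2 * (1 / 2) * lv1 x / lv x ^ Suc 2) + lv3 x * ((1 / 2) / lv x ^ 2))
      + ((lv1 x * lv1 x) * (- real 3 * 1 * lv1 x / lv x ^ Suc 3) + (lv1 x * lv2 x + lv2 x * lv1 x) * (1 / lv x ^ 3))"
  have "((\<lambda>x. (3 * pi / 8) / sqrt x ^ 5 - 3 / x ^ 3 - lv2 x * ((1 / 2) / lv x ^ 2) + (lv1 x * lv1 x) * (1 / lv x ^ 3))
      has_real_derivative ?D4) (at x)"
    by (intro DERIV_diff DERIV_add DERIV_mult' ds[of 7 5 "3 * pi / 8"] dx[of 3 3] d(2,3) dv[of "1 / 2" 2] dv[of 1 3]) simp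
  moreover have "(\<lambda>x. (3 * pi / 8) / sqrt x ^ 5 - 3 / x ^ 3 - lv2 x * ((1 / 2) / lv x ^ 2) + (lv1 x * lv1 x) * (1 / lv x ^ 3)) = lga3"
    by (simp add: lga3_def fun_eq_iff power2_eq_square)
  moreover have "?D4 = lga4 x"
  proof -
    have "- real 5 * (3 * pi / 8) / (2 * S7) - (- real 3 * 3 * 1 / X4)
      - (b * (- real 2 * (1 / 2) * a / v ^ Suc 2) + c * ((1 / 2) / v ^ 2))
      + ((a * a) * (- real 3 * 1 * a / v ^ Suc 3) + (a * b + b * a) * (1 / v ^ 3)) =
      - 15 * pi / (16 * S7) + 9 / X4 - c / (2 * v\<^sup>2) + 3 * a * b / v ^ 3 - 3 * a ^ 3 / v ^ 4"
      if "v \<noteq> 0" for S7 X4 a b c v :: real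
      using that by (simp add: divide_simps eval_nat_numeral) (simp add: algebra_simps)?
    from this[OF v(2), of "sqrt x ^ 7" "x ^ Suc 3" "lv2 x" "lv1 x" "lv3 x"]
    have D4: "?D4 = - 15 * pi / (16 * sqrt x ^ 7) + 9 / x ^ Suc 3 - lv3 x / (2 * (lv x)\<^sup>2)
      + 3 * lv1 x * lv2 x / lv x ^ 3 - 3 * lv1 x ^ 3 / lv x ^ 4" .
    have p4: "x ^ 4 = x ^ Suc 3" by simp
    show ?thesis unfolding lga4_def p4 by (rule D4)
  qed
  ultimately show "(lga3 has_real_derivative lga4 x) (at x)" by (simp only:)
qed

text \<open>The leading coefficient is \<open>- pi / 4\<close>. The term with \<open>lv\<close> has
  the favourable sign and is dropped, and the positive term costs at most 3/44 relative to the
  leading order.\<close>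

lemma lga2_le:
  assumes x: "x \<ge> 484"
  shows "lga2 x \<le> - (7 / 10) / sqrt x ^ 3"
proof -
  note b = lv_bounds[OF x]
  define r where "r = sqrt x"
  have r: "r \<ge> 22" "x = r\<^sup>2" using b(1) x by (auto simp: r_def)
  have "lga2 x \<le> - pi / (4 * r ^ 3) + 3 / (2 * x\<^sup>2)"
    unfolding lga2_def r_def using b(3) by simp
  also have "3 / (2 * x\<^sup>2) = (3 / (2 * r)) / r ^ 3" by (simp add: r(2) eval_nat_numeral)
  also have "- pi / (4 * r ^ 3) = (- pi / 4) / r ^ 3" by simp
  also have "(- pi / 4) / r ^ 3 + (3 / (2 * r)) / r ^ 3 = (- pi / 4 + 3 / (2 * r)) / r ^ 3"
    using r by (simp add: field_simps)
  also have "\<dots> \<le> (- (7 / 10)) / r ^ 3"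
  proof (rule divide_right_mono)
    have "3 / (2 * r) \<le> 3 / (2 * 22)" using r by (intro divide_left_mono) auto
    then show "- pi / 4 + 3 / (2 * r) \<le> - (7 / 10)" using pi_approx(1) by simp
  qed (use r in simp)
  finally show ?thesis unfolding r_def by simp
qed

text \<open>The leading coefficient is \<open>15 pi / 16\<close>, about 2.95. All other terms are
  smaller by at least one power of \<open>sqrt x >= 22\<close> and fit into the slack up to
  4.\<close>

lemma abs_lga4_le:
  assumes x: "x \<ge> 484"
  shows "\<bar>lga4 x\<bar> \<le> 4 / sqrt x ^ 7"
proof -
  note b = lv_bounds[OF x]
  define r where "r = sqrt x"
  have r: "r \<ge> 22" "x = r\<^sup>2" using b(1) x by (auto simp: r_def)
  define w where "w = 98 / 100 * r\<^sup>2"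
  have w: "w > 0" "w \<le> lv x" using r b(2) by (auto simp: w_def)
  have vp: "w ^ k \<le> lv x ^ k" "w ^ k > 0" for k using w by (auto intro: power_mono)
  have r3: "r ^ 3 > 0" "r ^ 5 > 0" using r by simp_all
  have t1: "\<bar>lv3 x / (2 * (lv x)\<^sup>2)\<bar> \<le> (1 / (8 * r ^ 5)) / (2 * w\<^sup>2)"
  proof -
    have "\<bar>lv3 x\<bar> / (2 * (lv x)\<^sup>2) \<le> (1 / (8 * r ^ 5)) / (2 * w\<^sup>2)"
    proof (rule frac_le)
      show "\<bar>lv3 x\<bar> \<le> 1 / (8 * r ^ 5)" using b(7) by (simp only: r_def)
    qed (use vp[of 2] r3 in simp_all)
    then show ?thesis by (simp add: abs_divide abs_mult)
  qed
  have v0: "lv x > 0" using w by linarith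
  have t2: "\<bar>3 * lv1 x * lv2 x / lv x ^ 3\<bar> \<le> (3 * 1 * (1 / (12 * r ^ 3))) / w ^ 3"
  proof -
    have "lv2 x \<le> 1 / (12 * r ^ 3)" using b(6) by (simp only: r_def)
    then have "3 * lv1 x * lv2 x \<le> 3 * 1 * (1 / (12 * r ^ 3))"
      by (intro mult_mono) (use b(3-5) in simp_all)
    then have "3 * lv1 x * lv2 x / lv x ^ 3 \<le> (3 * 1 * (1 / (12 * r ^ 3))) / w ^ 3"
      by (rule frac_le[rotated]) (use vp[of 3] r3 in simp_all)
    moreover have "0 \<le> 3 * lv1 x * lv2 x / lv x ^ 3" using b(3,5) v0 by simp
    ultimately show ?thesis by (simp only: abs_of_nonneg)
  qed
  have t3: "\<bar>3 * lv1 x ^ 3 / lv x ^ 4\<bar> \<le> 3 * 1 / w ^ 4"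
  proof -
    have "3 * lv1 x ^ 3 \<le> 3 * 1" using power_le_one[OF b(3,4), of 3] by simp
    then have "3 * lv1 x ^ 3 / lv x ^ 4 \<le> 3 * 1 / w ^ 4"
      by (rule frac_le[rotated]) (use vp[of 4] in simp_all)
    moreover have "0 \<le> 3 * lv1 x ^ 3 / lv x ^ 4" using b(3) v0 by simp
    ultimately show ?thesis by (simp only: abs_of_nonneg)
  qed
  have "\<bar>lga4 x\<bar> \<le> 15 * pi / (16 * r ^ 7) + 9 / x ^ 4 + (1 / (8 * r ^ 5)) / (2 * w\<^sup>2)
      + (3 * 1 * (1 / (12 * r ^ 3))) / w ^ 3 + 3 * 1 / w ^ 4"
  proof -
    have "\<bar>15 * pi / (16 * r ^ 7)\<bar> = 15 * pi / (16 * r ^ 7)" "\<bar>9 / x ^ 4\<bar> = 9 / x ^ 4"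
      using r by simp_all
    moreover have "lga4 x = - (15 * pi / (16 * r ^ 7)) + 9 / x ^ 4 - lv3 x / (2 * (lv x)\<^sup>2)
      + 3 * lv1 x * lv2 x / lv x ^ 3 - 3 * lv1 x ^ 3 / lv x ^ 4"
      by (simp add: lga4_def r_def)
    ultimately show ?thesis using t1 t2 t3 by linarith
  qed
  also have "\<dots> = (15 * pi / 16 + (9 + 3 / (98/100) ^ 4) / r + (1 / (16 * (98/100)\<^sup>2) + 1 / (4 * (98/100) ^ 3)) / r\<^sup>2) / r ^ 7"
    using r by (simp add: w_def field_simps eval_nat_numeral)
  also have "\<dots> \<le> 4 / r ^ 7"
  proof (rule divide_right_mono)
    have "(9 + 3 / (98/100) ^ 4) / r \<le> (9 + 3 / (98/100) ^ 4) / 22" using r by (intro divide_left_mono) auto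
    moreover have "22 * 22 \<le> r * r" using r by (intro mult_mono) auto
    then have "(1 / (16 * (98/100)\<^sup>2) + 1 / (4 * (98/100) ^ 3)) / r\<^sup>2 \<le> (1 / (16 * (98/100)\<^sup>2) + 1 / (4 * (98/100) ^ 3)) / 484"
      by (intro divide_left_mono) (auto simp: power2_eq_square)
    moreover have "15 * pi / 16 \<le> 15 * (3142 / 1000) / 16" using pi_approx(2) by simp
    moreover have "15 * (3142 / 1000) / 16 + (9 + 3 / (98/100) ^ 4) / 22 + (1 / (16 * (98/100)\<^sup>2) + 1 / (4 * (98/100) ^ 3)) / 484 \<le> (4 :: real)"
      by (simp add: eval_nat_numeral)
    ultimately show "15 * pi / 16 + (9 + 3 / (98/100) ^ 4) / r + (1 / (16 * (98/100)\<^sup>2) + 1 / (4 * (98/100) ^ 3)) / r\<^sup>2 \<le> 4"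
      by linarith
  qed (use r in simp)
  finally show ?thesis unfolding r_def .
qed

section \<open>From approximate entries to a positive determinant\<close>

text \<open>After the AM-GM step only the products of entries symmetric about the centre matter, so
  first differences drop out and \<open>h1\<close>, \<open>h2\<close> carry all information.
  \<open>C1\<close> and \<open>C2\<close> are the positivity of the two factors divided by
  \<open>a0^2\<close> and \<open>a0\<close>; the multiples \<open>5 e\<close>, \<open>3 e\<close>
  and \<open>2 e\<close> account for replacing the entries by the approximations.\<close>

lemma toeplitz_det_pos:
  fixes a0 p1 p2 q1 q2 m0 u1 u2 v1 v2 e h1 h2 :: real
  assumes e: "0 \<le> e" "e \<le> 1 / 100"
    and m: "m0 > 0" "u1 > 0" "v1 > 0" "u2 > 0" "v2 > 0"
    and h1: "u1 * v1 = m0\<^sup>2 * exp h1" and h2: "u2 * v2 = m0\<^sup>2 * exp h2"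
    and a0: "(1 - e) * m0 \<le> a0" "a0 \<le> (1 + e) * m0"
    and p1: "(1 - e) * u1 \<le> p1" "p1 \<le> (1 + e) * u1"
    and q1: "(1 - e) * v1 \<le> q1" "q1 \<le> (1 + e) * v1"
    and p2: "(1 - e) * u2 \<le> p2" "p2 \<le> (1 + e) * u2"
    and q2: "(1 - e) * v2 \<le> q2" "q2 \<le> (1 + e) * v2"
    and C1: "2 * ((1 + 5 * e) * exp h1) < 1 + (1 - 2 * e) * exp (h2 / 2)"
    and C2: "(1 + 3 * e) * exp (h2 / 2) < 1"
  shows "a0 ^ 3 - 2 * a0 * p1 * q1 + p1\<^sup>2 * q2 + p2 * q1\<^sup>2 - a0 * p2 * q2 > 0"
proof -
  have e1: "1 - e > 0" "1 + e > 0" using e by auto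
  have mp: "(1 - e) * m0 > 0" "(1 - e) * u1 > 0" "(1 - e) * v1 > 0" "(1 - e) * u2 > 0" "(1 - e) * v2 > 0"
    using e1 m by simp_all
  then have pos: "a0 > 0" "p1 > 0" "q1 > 0" "p2 > 0" "q2 > 0" using a0 p1 q1 p2 q2 by linarith+
  have P: "p1 * q1 \<le> (1 + 5 * e) * exp h1 * a0\<^sup>2"
  proof -
    have "p1 * q1 \<le> ((1 + e) * u1) * ((1 + e) * v1)" using p1 q1 pos e1 m by (intro mult_mono) auto
    also have "\<dots> = (1 + e)\<^sup>2 * (m0\<^sup>2 * exp h1)" unfolding h1[symmetric] by (simp add: power2_eq_square)
    also have "\<dots> \<le> ((1 + 5 * e) * (1 - e)\<^sup>2) * (m0\<^sup>2 * exp h1)"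
    proof (intro mult_right_mono)
      have "0 \<le> e * (1 - 10 * e + 5 * e\<^sup>2)" using e by (intro mult_nonneg_nonneg add_nonneg_nonneg) auto
      then show "(1 + e)\<^sup>2 \<le> (1 + 5 * e) * (1 - e)\<^sup>2" by (simp add: power2_eq_square algebra_simps)
    qed auto
    also have "\<dots> = (1 + 5 * e) * exp h1 * ((1 - e) * m0)\<^sup>2" by (simp add: power_mult_distrib)
    also have "\<dots> \<le> (1 + 5 * e) * exp h1 * a0\<^sup>2"
      using a0 mp e by (intro mult_left_mono power_mono) auto
    finally show ?thesis .
  qed
  define R where "R = sqrt (p2 * q2)"
  have R2: "R\<^sup>2 = p2 * q2" using pos by (simp add: R_def)
  have R0: "R \<ge> 0" using pos by (simp add: R_def)
  have R_le: "R \<le> (1 + 3 * e) * exp (h2 / 2) * a0"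
  proof (unfold R_def, rule real_le_lsqrt)
    have "p2 * q2 \<le> ((1 + e) * u2) * ((1 + e) * v2)" using p2 q2 pos e1 m by (intro mult_mono) auto
    also have "\<dots> = ((1 + e) * (exp (h2 / 2) * m0))\<^sup>2"
    proof -
      have "exp h2 = (exp (h2 / 2))\<^sup>2" by (simp flip: exp_of_nat_mult)
      then show ?thesis using h2 by (simp add: power_mult_distrib power2_eq_square mult_ac)
    qed
    also have "\<dots> \<le> ((1 + 3 * e) * exp (h2 / 2) * a0)\<^sup>2"
    proof (intro power_mono)
      have "0 \<le> e * (1 - 3 * e)" using e by simp
      then have "1 + e \<le> (1 + 3 * e) * (1 - e)" by (simp add: algebra_simps)
      then have "(1 + e) * (exp (h2 / 2) * m0) \<le> ((1 + 3 * e) * (1 - e)) * (exp (h2 / 2) * m0)"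
        using m by (intro mult_right_mono) auto
      also have "\<dots> = (1 + 3 * e) * exp (h2 / 2) * ((1 - e) * m0)" by simp
      also have "\<dots> \<le> (1 + 3 * e) * exp (h2 / 2) * a0" using a0 e by (intro mult_left_mono) auto
      finally show "(1 + e) * (exp (h2 / 2) * m0) \<le> (1 + 3 * e) * exp (h2 / 2) * a0" .
    qed (use e m in auto)
    finally show "p2 * q2 \<le> ((1 + 3 * e) * exp (h2 / 2) * a0)\<^sup>2" .
  qed (use pos e in auto)
  have R_ge: "R \<ge> (1 - 2 * e) * exp (h2 / 2) * a0"
  proof (unfold R_def, rule real_le_rsqrt)
    have "((1 - 2 * e) * exp (h2 / 2) * a0)\<^sup>2 \<le> ((1 - e) * (exp (h2 / 2) * m0))\<^sup>2"
    proof (intro power_mono)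
      have "(1 - 2 * e) * exp (h2 / 2) * a0 \<le> (1 - 2 * e) * exp (h2 / 2) * ((1 + e) * m0)"
        using a0 e by (intro mult_left_mono) auto
      also have "\<dots> = ((1 - 2 * e) * (1 + e)) * (exp (h2 / 2) * m0)" by simp
      also have "\<dots> \<le> (1 - e) * (exp (h2 / 2) * m0)"
        using m by (intro mult_right_mono) (auto simp: algebra_simps)
      finally show "(1 - 2 * e) * exp (h2 / 2) * a0 \<le> (1 - e) * (exp (h2 / 2) * m0)" .
    qed (use e pos in auto)
    also have "\<dots> = ((1 - e) * u2) * ((1 - e) * v2)"
    proof -
      have "exp h2 = (exp (h2 / 2))\<^sup>2" by (simp flip: exp_of_nat_mult)
      then show ?thesis using h2 by (simp add: power_mult_distrib power2_eq_square mult_ac)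
    qed
    also have "\<dots> \<le> p2 * q2" using p2 q2 mp pos by (intro mult_mono) auto
    finally show "((1 - 2 * e) * exp (h2 / 2) * a0)\<^sup>2 \<le> p2 * q2" .
  qed
  have f1: "a0 - R > 0"
  proof -
    have "(1 + 3 * e) * exp (h2 / 2) * a0 < 1 * a0" using C2 pos by (intro mult_strict_right_mono) auto
    then show ?thesis using R_le by linarith
  qed
  have f2: "a0\<^sup>2 + a0 * R - 2 * (p1 * q1) > 0"
  proof -
    have "2 * (p1 * q1) \<le> 2 * ((1 + 5 * e) * exp h1) * a0\<^sup>2" using P by simp
    also have "\<dots> < (1 + (1 - 2 * e) * exp (h2 / 2)) * a0\<^sup>2"
      using C1 pos by (intro mult_strict_right_mono) auto
    also have "\<dots> = a0\<^sup>2 + a0 * ((1 - 2 * e) * exp (h2 / 2) * a0)" by (simp add: algebra_simps power2_eq_square)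
    also have "\<dots> \<le> a0\<^sup>2 + a0 * R" using R_ge pos by (intro add_left_mono mult_left_mono) auto
    finally show ?thesis by simp
  qed
  have amgm: "2 * (p1 * q1) * R \<le> p1\<^sup>2 * q2 + p2 * q1\<^sup>2"
  proof -
    have "0 \<le> (p1 * sqrt q2 - q1 * sqrt p2)\<^sup>2" by simp
    also have "\<dots> = p1\<^sup>2 * (sqrt q2)\<^sup>2 + (sqrt p2)\<^sup>2 * q1\<^sup>2 - 2 * (p1 * q1) * (sqrt p2 * sqrt q2)"
      by (simp add: power2_eq_square algebra_simps)
    finally show ?thesis using pos by (simp add: R_def real_sqrt_mult)
  qed
  have "0 < (a0 - R) * (a0\<^sup>2 + a0 * R - 2 * (p1 * q1))" using f1 f2 by (rule mult_pos_pos)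
  also have "\<dots> = a0 ^ 3 - 2 * a0 * p1 * q1 + 2 * (p1 * q1) * R - a0 * R\<^sup>2"
    by (simp add: power2_eq_square power3_eq_cube algebra_simps)
  also have "\<dots> \<le> a0 ^ 3 - 2 * a0 * p1 * q1 + p1\<^sup>2 * q2 + p2 * q1\<^sup>2 - a0 * p2 * q2"
    using amgm unfolding R2 by (simp add: algebra_simps)
  finally show ?thesis .
qed

lemma approx_margin:
  fixes L h1 h2 e :: real
  assumes L: "L \<ge> 22"
    and h1: "h1 \<le> - (67 / 100) / L ^ 3"
    and h2: "\<bar>h2 - 4 * h1\<bar> \<le> 4 / L ^ 7"
    and e: "e = 1 / (50 * L ^ 6)"
  shows "0 \<le> e" "e \<le> 1 / 100"
    "2 * ((1 + 5 * e) * exp h1) < 1 + (1 - 2 * e) * exp (h2 / 2)"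
    "(1 + 3 * e) * exp (h2 / 2) < 1"
proof -
  define k where "k = 1 / L ^ 3"
  have L3: "L ^ 3 \<ge> 22 ^ 3" using L by (intro power_mono) auto
  have k: "0 < k" "k \<le> 1 / 10648" using L L3 by (auto simp: k_def intro!: divide_left_mono)
  have ek: "e = k\<^sup>2 / 50" unfolding e k_def by (simp add: power_divide flip: power_mult)
  have k2: "k\<^sup>2 \<le> k / 10648" using k mult_left_mono[of k "1/10648" k] by (simp add: power2_eq_square)
  show e0: "0 \<le> e" "e \<le> 1 / 100" unfolding ek using k k2 by auto
  have L7: "4 / L ^ 7 \<le> 2 / 11 * k\<^sup>2"
  proof -
    have "4 / L ^ 7 = 4 / L * k\<^sup>2" using L by (simp add: k_def power_divide field_simps flip: power_mult power_Suc)
    also have "\<dots> \<le> 4 / 22 * k\<^sup>2" using L by (intro mult_right_mono divide_left_mono) auto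
    finally show ?thesis by simp
  qed
  define d where "d = h2 / 2 - 2 * h1"
  have d: "\<bar>d\<bar> \<le> 1 / 11 * k\<^sup>2"
  proof -
    have "d = (h2 - 4 * h1) / 2" by (simp add: d_def)
    then have "\<bar>d\<bar> = \<bar>h2 - 4 * h1\<bar> / 2" by simp
    then show ?thesis using order_trans[OF h2 L7] by simp
  qed
  have h1k: "h1 \<le> - (67 / 100) * k" using h1 by (simp add: k_def)
  define E where "E = exp h1"
  have E: "0 < E" "E \<le> 1" using h1k k by (auto simp: E_def)
  have "1 - E \<ge> 66 / 100 * k"
  proof -
    have "E \<le> exp (- (67 / 100) * k)" unfolding E_def using h1k by simp
    also have "\<dots> = 1 / exp (67 / 100 * k)" by (simp add: exp_minus inverse_eq_divide)
    also have "\<dots> \<le> 1 / (1 + 67 / 100 * k)"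
      using exp_ge_add_one_self[of "67 / 100 * k"] k by (intro divide_left_mono) (auto simp: add_pos_pos)
    also have "\<dots> \<le> 1 - 66 / 100 * k"
    proof -
      have "1 \<le> (1 - 66 / 100 * k) * (1 + 67 / 100 * k)"
        using k2 k(1) by (simp add: algebra_simps power2_eq_square)
      then show ?thesis using k by (simp add: pos_divide_le_eq)
    qed
    finally show ?thesis by simp
  qed
  then have sq: "(1 - E)\<^sup>2 \<ge> (66 / 100 * k)\<^sup>2" using k by (intro power_mono) auto
  have X: "exp (h2 / 2) = E\<^sup>2 * exp d"
    unfolding E_def d_def by (simp add: power2_eq_square flip: exp_add)
  have X1: "exp (h2 / 2) \<ge> E\<^sup>2 - \<bar>d\<bar>"
  proof -
    have "E\<^sup>2 * (1 - \<bar>d\<bar>) \<le> E\<^sup>2 * exp d"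
    proof (rule mult_left_mono)
      show "1 - \<bar>d\<bar> \<le> exp d" using exp_ge_add_one_self[of d] abs_ge_minus_self[of d] by linarith
    qed simp
    moreover have "E\<^sup>2 * \<bar>d\<bar> \<le> 1 * \<bar>d\<bar>" using E by (intro mult_right_mono) (auto simp: power_le_one)
    ultimately show ?thesis unfolding X by (simp add: algebra_simps)
  qed
  have h2k: "h2 / 2 \<le> - k"
  proof -
    have "h2 / 2 = d + 2 * h1" by (simp add: d_def)
    moreover have "d \<le> 1 / 11 * k\<^sup>2" using abs_ge_self d by (rule order_trans)
    ultimately show ?thesis using h1k k2 k by linarith
  qed
  then have X2: "exp (h2 / 2) \<le> 1" using k by simp
  have "e * exp (h2 / 2) \<le> e * 1" using X2 e0 by (intro mult_left_mono) auto
  moreover have "e * E \<le> e * 1" using E e0 by (intro mult_left_mono) auto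
  moreover have "4356 / 10000 * k\<^sup>2 \<le> (1 - E)\<^sup>2" using sq by (simp add: power_mult_distrib power_divide)
  moreover have "(1 - E)\<^sup>2 = 1 - 2 * E + E\<^sup>2" by (simp add: power2_eq_square algebra_simps)
  moreover have "k\<^sup>2 > 0" using k by simp
  moreover have "2 * ((1 + 5 * e) * E) = 2 * E + 10 * (e * E)"
    "(1 - 2 * e) * exp (h2 / 2) = exp (h2 / 2) - 2 * (e * exp (h2 / 2))"
    by (simp_all add: algebra_simps)
  \<comment> \<open>The budget in units of \<open>k^2\<close>: the gain \<open>(1 - E)^2\<close> is
    at least 0.4356, against 1/11 for the fourth difference and 12/50 for the terms with
    \<open>e\<close>.\<close>
  ultimately show "2 * ((1 + 5 * e) * exp h1) < 1 + (1 - 2 * e) * exp (h2 / 2)"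
    using X1 d ek unfolding E_def[symmetric] by linarith
  have "(1 + 3 * e) * exp (h2 / 2) \<le> exp (3 * e) * exp (h2 / 2)"
    using exp_ge_add_one_self[of "3 * e"] by (intro mult_right_mono) auto
  also have "\<dots> = exp (3 * e + h2 / 2)" by (simp add: exp_add)
  also have "\<dots> < 1" using h2k k k2 ek by simp
  finally show "(1 + 3 * e) * exp (h2 / 2) < 1" .
qed

lemma exp_margin:
  fixes s :: real
  assumes s: "s \<ge> 22"
  shows "exp (17 / 10 * s) \<le> 1 / (50 * s ^ 6) * opart_approx (s\<^sup>2)"
proof -
  \<comment> \<open>The gap between \<open>pi\<close> and 17/10 exceeds 144/100 = 8 * 18/100, so it
    suffices to dominate a linear function by \<open>exp (18/100 s)\<close> and take the eighth
    power. At \<open>s = 22\<close> this reads \<open>48.4 <= exp 3.96\<close>, and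
    \<open>(22/10)^8 > 500\<close>. The factor 4/5 then leaves 400 = 8 * 50, as the statement
    requires.\<close>
  have "(22 / 10 * s) ^ 8 \<le> exp (18 / 100 * s) ^ 8"
  proof (intro power_mono)
    have "exp (33 / 100 :: real) \<ge> 1 + 33/100 + (33/100)\<^sup>2 / 2" by (rule exp_lower_Taylor_quadratic) simp
    then have "exp (33 / 100 :: real) ^ 12 \<ge> (1384 / 1000) ^ 12" by (intro power_mono) (auto simp: power2_eq_square)
    moreover have "exp (33 / 100 :: real) ^ 12 = exp (396 / 100)" by (simp flip: exp_of_nat_mult)
    ultimately have e4: "exp (396 / 100 :: real) \<ge> 484 / 10" by (simp add: eval_nat_numeral)
    have "18 / 100 * s = 396 / 100 + 18 / 100 * (s - 22)" by (simp add: right_diff_distrib)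
    then have "exp (18 / 100 * s) = exp (396 / 100) * exp (18 / 100 * (s - 22))" by (simp only: exp_add)
    also have "\<dots> \<ge> 484 / 10 * (1 + 18 / 100 * (s - 22))"
      using e4 exp_ge_add_one_self[of "18 / 100 * (s - 22)"] s by (intro mult_mono) auto
    also have "484 / 10 * (1 + 18 / 100 * (s - 22)) = 22 / 10 * s + 6512 / 1000 * (s - 22)" by (simp add: field_simps)
    finally have "22 / 10 * s + 6512 / 1000 * (s - 22) \<le> exp (18 / 100 * s)" .
    moreover have "0 \<le> 6512 / 1000 * (s - 22)" using s by simp
    ultimately show "22 / 10 * s \<le> exp (18 / 100 * s)" by linarith
  qed (use s in auto)
  moreover have "exp (18 / 100 * s) ^ 8 = exp (144 / 100 * s)" by (simp flip: exp_of_nat_mult)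
  moreover have "(22 / 10 * s) ^ 8 = (22 / 10) ^ 8 * s ^ 8" by (rule power_mult_distrib)
  moreover have "500 * s ^ 8 \<le> (22 / 10) ^ 8 * s ^ 8" using s by (intro mult_right_mono) (auto simp: eval_nat_numeral)
  ultimately have a: "500 * s ^ 8 \<le> exp (144 / 100 * s)" by linarith
  have "500 * s ^ 8 * exp (17 / 10 * s) \<le> exp (144 / 100 * s) * exp (17 / 10 * s)"
    using a by (intro mult_right_mono) auto
  also have "\<dots> \<le> exp (pi * s)"
    using mult_right_mono[of "314 / 100" pi s] pi_approx(1) s by (simp flip: exp_add)
  finally have b: "500 * s ^ 8 * exp (17 / 10 * s) \<le> exp (pi * s)" .
  have "1 / (pi * s) \<le> 1 / (3 * 22)" using s pi_gt3 assms by (intro frac_le mult_mono) auto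
  then have "4 / 5 \<le> 1 - 1 / (pi * s)" by simp
  then have "exp (pi * s) * (4 / 5) \<le> exp (pi * s) * (1 - 1 / (pi * s))" by (intro mult_left_mono) auto
  with b have "400 * s ^ 8 * exp (17 / 10 * s) \<le> exp (pi * s) * (1 - 1 / (pi * s))" by linarith
  then have "400 * s ^ 8 * exp (17 / 10 * s) / (400 * s ^ 8) \<le> exp (pi * s) * (1 - 1 / (pi * s)) / (400 * s ^ 8)"
    using s by (intro divide_right_mono) auto
  then have "exp (17 / 10 * s) \<le> exp (pi * s) * (1 - 1 / (pi * s)) / (400 * s ^ 8)" using s by simp
  also have "\<dots> = 1 / (50 * s ^ 6) * opart_approx (s\<^sup>2)"
    using s by (simp add: opart_approx_def eval_nat_numeral)
  finally show ?thesis .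
qed

section \<open>Exact values\<close>

lemma overpartition_count_squares:
  assumes "n > 0"
  shows "int (overpartition_count n) =
    2 * (\<Sum>i | 1 \<le> i \<and> i\<^sup>2 \<le> n. (-1) ^ (i - 1) * int (overpartition_count (n - i\<^sup>2)))"
proof -
  let ?I = "{i. 1 \<le> i \<and> i\<^sup>2 \<le> n}"
  have "i \<le> i\<^sup>2" for i :: nat by (simp add: power2_eq_square)
  then have fin: "finite ?I" by (intro finite_subset[of ?I "{..n}"]) (auto intro: order_trans)
  let ?t = "\<lambda>k. theta_coeff k * int (overpartition_count (n - k))"
  have "(\<Sum>k\<le>n. ?t k) = (\<Sum>k\<in>insert 0 ((\<lambda>i. i\<^sup>2) ` ?I). ?t k)"
  proof (rule sum.mono_neutral_right)
    show "\<forall>k\<in>{..n} - insert 0 ((\<lambda>i. i\<^sup>2) ` ?I). ?t k = 0"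
    proof
      fix k assume k: "k \<in> {..n} - insert 0 ((\<lambda>i. i\<^sup>2) ` ?I)"
      have "\<not> (\<exists>s. k = s\<^sup>2)"
      proof
        assume "\<exists>s. k = s\<^sup>2"
        then obtain s where s: "k = s\<^sup>2" by blast
        then have "s \<in> ?I" using k by (cases s) auto
        then show False using k s by blast
      qed
      then show "?t k = 0" using k by (simp add: theta_coeff_def)
    qed
  qed (use fin in auto)
  also have "\<dots> = ?t 0 + (\<Sum>k\<in>(\<lambda>i. i\<^sup>2) ` ?I. ?t k)"
    by (rule sum.insert) (use fin in auto)
  also have "(\<Sum>k\<in>(\<lambda>i. i\<^sup>2) ` ?I. ?t k) = (\<Sum>i\<in>?I. ?t (i\<^sup>2))"
    by (subst sum.reindex) (auto simp: inj_on_def)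
  also have "\<dots> = (\<Sum>i\<in>?I. - 2 * ((-1) ^ (i - 1) * int (overpartition_count (n - i\<^sup>2))))"
  proof (rule sum.cong)
    fix i assume "i \<in> ?I"
    then obtain j where "i = Suc j" by (cases i) auto
    then show "?t (i\<^sup>2) = - 2 * ((-1) ^ (i - 1) * int (overpartition_count (n - i\<^sup>2)))"
      by (auto simp: theta_coeff_def uminus_power_if)
  qed simp
  finally show ?thesis
    using overpartition_count_recurrence[of n] assms by (simp add: theta_coeff_def sum_distrib_left sum_negf)
qed

text \<open>Walks down a list of values in decreasing order of index, with \<open>k\<close> the next
  square root and \<open>j\<close> the number of entries to skip before it. From \<open>k^2\<close>
  to \<open>(k + 1)^2\<close> there are \<open>2 k\<close> entries in between, and the nested
  subtraction produces the alternating signs.\<close>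

fun squares_sum :: "nat \<Rightarrow> nat \<Rightarrow> int list \<Rightarrow> int" where
  "squares_sum k j [] = 0"
| "squares_sum k (Suc j) (x # xs) = squares_sum k j xs"
| "squares_sum k 0 (x # xs) = x - squares_sum (k + 1) (2 * k) xs"

definition history :: "nat \<Rightarrow> int list" where
  "history n = map (\<lambda>i. int (overpartition_count i)) (rev [0..<n])"

lemma history_Suc: "history (Suc n) = int (overpartition_count n) # history n"
  by (simp add: history_def)

text \<open>The hypothesis is the invariant of the walk: the head of \<open>history n\<close> has
  index \<open>n - 1\<close>, so after \<open>j\<close> skipped entries the index is
  \<open>m - k^2\<close>.\<close>

lemma squares_sum_history:
  assumes "n + k\<^sup>2 = m + 1 + j"
  shows "squares_sum k j (history n) =
    (\<Sum>i | k \<le> i \<and> i\<^sup>2 \<le> m. (-1) ^ (i - k) * int (overpartition_count (m - i\<^sup>2)))"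
  using assms
proof (induction n arbitrary: k j)
  case 0
  have "\<not> i\<^sup>2 \<le> m" if "k \<le> i" for i
  proof -
    have "k\<^sup>2 \<le> i\<^sup>2" using that by (rule power_mono) simp
    then show ?thesis using 0 by linarith
  qed
  then have "{i. k \<le> i \<and> i\<^sup>2 \<le> m} = {}" by blast
  then show ?case by (simp only: sum.empty) (simp add: history_def)
next
  case (Suc n)
  show ?case
  proof (cases j)
    case (Suc j')
    then show ?thesis using Suc.IH[of k j'] Suc.prems by (simp add: history_Suc)
  next
    case 0
    then have m: "m = n + k\<^sup>2" using Suc.prems by simp
    have IH: "squares_sum (k + 1) (2 * k) (history n) =
      (\<Sum>i | k + 1 \<le> i \<and> i\<^sup>2 \<le> m. (-1) ^ (i - (k + 1)) * int (overpartition_count (m - i\<^sup>2)))"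
      by (rule Suc.IH) (simp add: m power2_eq_square)
    let ?J = "{i. k + 1 \<le> i \<and> i\<^sup>2 \<le> m}"
    have "i \<le> i\<^sup>2" for i :: nat by (simp add: power2_eq_square)
    then have fin: "finite ?J" by (intro finite_subset[of ?J "{..m}"]) (auto intro: order_trans)
    have "{i. k \<le> i \<and> i\<^sup>2 \<le> m} = insert k ?J"
    proof (rule set_eqI)
      show "i \<in> {i. k \<le> i \<and> i\<^sup>2 \<le> m} \<longleftrightarrow> i \<in> insert k ?J" for i
        using m by (cases "i = k") auto
    qed
    then have "(\<Sum>i | k \<le> i \<and> i\<^sup>2 \<le> m. (-1) ^ (i - k) * int (overpartition_count (m - i\<^sup>2)))
      = int (overpartition_count n) + (\<Sum>i\<in>?J. (-1) ^ (i - k) * int (overpartition_count (m - i\<^sup>2)))"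
      using fin m by (simp add: sum.insert)
    also have "(\<Sum>i\<in>?J. (-1) ^ (i - k) * int (overpartition_count (m - i\<^sup>2))) =
      (\<Sum>i\<in>?J. - ((-1) ^ (i - (k + 1)) * int (overpartition_count (m - i\<^sup>2))))"
    proof (rule sum.cong)
      fix i assume "i \<in> ?J"
      then have "i - k = Suc (i - (k + 1))" by auto
      then show "(-1) ^ (i - k) * int (overpartition_count (m - i\<^sup>2)) = - ((-1) ^ (i - (k + 1)) * int (overpartition_count (m - i\<^sup>2)))"
        by simp
    qed simp
    finally show ?thesis using 0 IH by (simp only: history_Suc squares_sum.simps sum_negf)
  qed
qed

lemma overpartition_count_history:
  assumes "n > 0"
  shows "int (overpartition_count n) = 2 * squares_sum 1 0 (history n)"
  using overpartition_count_squares[OF assms] squares_sum_history[of n 1 n 0] by simp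

section \<open>Certified computation of log-concavity\<close>

text \<open>At \<open>n = 0\<close> the truncated subtraction makes the value
  \<open>1 * 1 - 1 * 2 = - 1\<close>, which seeds the computation below.\<close>

definition turan :: "nat \<Rightarrow> int" where
  "turan n = int (overpartition_count n) * int (overpartition_count n) -
     int (overpartition_count (n - 1)) * int (overpartition_count (n + 1))"

text \<open>A cheap sufficient test for \<open>a * c < b * b\<close> that multiplies only leading
  bits: \<open>a\<close> and \<open>c\<close> are rounded up, \<open>b\<close> is rounded
  down.\<close>

definition log_concave_at :: "nat \<Rightarrow> int \<Rightarrow> int \<Rightarrow> int \<Rightarrow> bool" where
  "log_concave_at d a b c \<longleftrightarrow> 0 \<le> a \<and> 0 \<le> c \<and>
     (drop_bit d a + 1) * (drop_bit d c + 1) \<le> drop_bit d b * drop_bit d b \<and> 0 \<le> b"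

lemma log_concave_at_imp:
  assumes "log_concave_at d a b c"
  shows "a * c < b * b"
proof -
  let ?D = "2 ^ d :: int"
  have lo: "drop_bit d x * ?D \<le> x" and hi: "x < (drop_bit d x + 1) * ?D" for x :: int
  proof -
    have "0 \<le> x mod ?D" "x mod ?D < ?D" by simp_all
    then show "drop_bit d x * ?D \<le> x" "x < (drop_bit d x + 1) * ?D"
      using div_mult_mod_eq[of x ?D] unfolding drop_bit_eq_div distrib_right by linarith+
  qed
  have nn: "0 \<le> a" "0 \<le> b" "0 \<le> c" using assms by (auto simp: log_concave_at_def)
  have "a * c < ((drop_bit d a + 1) * ?D) * ((drop_bit d c + 1) * ?D)"
    using hi[of a] hi[of c] nn by (intro mult_strict_mono) (auto intro: le_less_trans)
  also have "\<dots> = ((drop_bit d a + 1) * (drop_bit d c + 1)) * (?D * ?D)" by (simp only: mult_ac)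
  also have "\<dots> \<le> (drop_bit d b * drop_bit d b) * (?D * ?D)"
    using assms by (intro mult_right_mono) (auto simp: log_concave_at_def)
  also have "\<dots> = (drop_bit d b * ?D) * (drop_bit d b * ?D)" by (simp only: mult_ac)
  also have "\<dots> \<le> b * b"
    using lo[of b] nn by (intro mult_mono) auto
  finally show ?thesis .
qed

text \<open>The loop keeps the list of all earlier values together with the last two values of
  \<open>turan\<close>. The number of dropped bits only has to leave about 20 bits of precision.\<close>
fun turan_loop :: "nat \<Rightarrow> int \<Rightarrow> int \<Rightarrow> int list \<Rightarrow> bool" where
  "turan_loop 0 a b xs = True"
| "turan_loop (Suc n) a b (x # y # xs) =
    (let v = 2 * squares_sum 1 0 (x # y # xs) in let c = x * x - y * v in
     (if n < 444 then log_concave_at (if n < 245 then 80 else if n < 385 then 35 else 10) a b c else True)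
       \<and> turan_loop n b c (v # x # y # xs))"
| "turan_loop (Suc n) a b xs = False"

text \<open>\<open>m\<close> is the index of the value of \<open>turan\<close> produced in the
  current round. The condition \<open>m + n < i + 445\<close> says that fewer than 444 rounds follow
  round \<open>i\<close>, which is exactly when the test is switched on. With the start
  \<open>m = 2\<close>, \<open>n = 485\<close> it means \<open>i >= 43\<close>, so the first tested
  triple is centred at 42.\<close>

lemma turan_loop_sound:
  assumes "turan_loop n (turan (m - 2)) (turan (m - 1)) (history (m + 1))"
    and "m \<ge> 2" "m \<le> i" "i < m + n" "m + n < i + 445"
  shows "turan (i - 2) * turan i < turan (i - 1) * turan (i - 1)"
  using assms
proof (induction n arbitrary: m)
  case 0
  then show ?case by simp
next
  case (Suc n)
  obtain k where k: "m = Suc k" using Suc.prems(2) by (cases m) auto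
  have h: "history (m + 1) = int (overpartition_count m) # int (overpartition_count (m - 1)) # history (m - 1)"
    by (simp add: k history_Suc)
  have v: "2 * squares_sum 1 0 (history (m + 1)) = int (overpartition_count (m + 1))"
    by (rule overpartition_count_history[symmetric]) simp
  have h': "history (m + 1 + 1) = int (overpartition_count (m + 1)) # history (m + 1)"
    using history_Suc[of "m + 1"] by simp
  have t: "int (overpartition_count m) * int (overpartition_count m) - int (overpartition_count (m - 1)) * int (overpartition_count (m + 1)) = turan m"
    by (simp add: turan_def)
  have step: "(if n < 444 then log_concave_at (if n < 245 then 80 else if n < 385 then 35 else 10) (turan (m - 2)) (turan (m - 1)) (turan m) else True)
     \<and> turan_loop n (turan (m - 1)) (turan m) (history (m + 1 + 1))"
    using Suc.prems(1) unfolding h turan_loop.simps Let_def unfolding h[symmetric] v h'[symmetric] t .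
  show ?case
  proof (cases "i = m")
    case True
    then have "n < 444" using Suc.prems(5) by simp
    then have "log_concave_at (if n < 245 then 80 else if n < 385 then 35 else 10) (turan (m - 2)) (turan (m - 1)) (turan m)"
      using step by presburger
    from log_concave_at_imp[OF this] show ?thesis by (simp add: True)
  next
    case False
    have "m + 1 - 2 = m - 1" "m + 1 - 1 = m" using Suc.prems(2) by simp_all
    then show ?thesis using Suc.IH[of "m + 1"] step Suc.prems False by simp
  qed
qed

lemma squares_sum_numeral:
  "squares_sum k (numeral j) (x # xs) = squares_sum k (pred_numeral j) xs"
  "squares_sum k 1 (x # xs) = squares_sum k 0 xs"
  by (simp_all add: numeral_eq_Suc)

lemma turan_loop_numeral:
  "turan_loop (numeral n) a b (x # y # xs) =
    (let v = 2 * squares_sum 1 0 (x # y # xs) in let c = x * x - y * v in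
     (if pred_numeral n < (444::nat) then log_concave_at (if pred_numeral n < (245::nat) then 80 else if pred_numeral n < (385::nat) then 35 else 10) a b c else True)
       \<and> turan_loop (pred_numeral n) b c (v # x # y # xs))"
  "turan_loop 1 a b (x # y # xs) =
    (let v = 2 * squares_sum 1 0 (x # y # xs) in let c = x * x - y * v in log_concave_at 80 a b c)"
  by (simp_all add: numeral_eq_Suc Let_def)

lemma drop_bit_1_numeral:
  "drop_bit 1 (numeral (num.Bit0 k)) = (numeral k :: int)"
  "drop_bit 1 (numeral (num.Bit1 k)) = (numeral k :: int)"
  by (simp_all add: drop_bit_Suc)

text \<open>These congruence rules keep the simplifier from traversing the history again and again.\<close>
lemma squares_sum_cong: "k = k' \<Longrightarrow> j = j' \<Longrightarrow> squares_sum k j xs = squares_sum k' j' xs"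
  and turan_loop_cong: "n = n' \<Longrightarrow> turan_loop n a b xs = turan_loop n' a b xs"
  by simp_all

text \<open>The seeds are \<open>turan 0\<close>, \<open>turan 1\<close> and the counts at 2, 1, 0.
  The last of the 485 rounds produces \<open>turan 486\<close>, hence tests the triple centred at
  485.\<close>

lemma turan_loop_485: "turan_loop 485 (- 1) 0 [4, 2, 1]"
  by (simp add: squares_sum_numeral turan_loop_numeral log_concave_at_def drop_bit_1_numeral Let_def
      del: One_nat_def squares_sum.simps(2) turan_loop.simps(2)
      cong: squares_sum_cong turan_loop_cong let_weak_cong)

lemma turan_log_concave:
  assumes "42 \<le> n" "n \<le> 485"
  shows "turan (n - 1) * turan (n + 1) < turan n * turan n"
proof -
  have p0: "int (overpartition_count 0) = 1"
    using overpartition_count_recurrence[of 0] by (simp add: theta_coeff_def)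
  have p1: "int (overpartition_count 1) = 2"
    using overpartition_count_history[of 1] by (simp add: history_def p0)
  have p2: "int (overpartition_count 2) = 4"
    using overpartition_count_history[of 2] p1 by (simp add: history_def p0 numeral_2_eq_2)
  have h: "history 3 = [4, 2, 1]"
    using p0 p1 p2 by (simp add: history_def numeral_3_eq_3 numeral_2_eq_2)
  have t: "turan 0 = - 1" "turan 1 = 0" using p0 p1 p2 by (simp_all add: turan_def numeral_2_eq_2)
  have "turan_loop 485 (turan (2 - 2)) (turan (2 - 1)) (history (2 + 1))"
    using turan_loop_485 h t by simp
  from turan_loop_sound[OF this, of "n + 1"] assms show ?thesis by simp
qed

section \<open>The determinant\<close>

lemma overpart_matrix_det:
  assumes "n \<ge> 2"
  defines "p \<equiv> \<lambda>k. int (overpartition_count k)"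
  shows "det (overpart_matrix n) =
    p n ^ 3 - 2 * p n * p (n + 1) * p (n - 1) + (p (n + 1))\<^sup>2 * p (n - 2)
      + p (n + 2) * (p (n - 1))\<^sup>2 - p n * p (n + 2) * p (n - 2)"
  unfolding overpart_matrix_def Let_def p_def
  by (simp add: det_3 vector_3 power2_eq_square power3_eq_cube algebra_simps)

text \<open>Desnanot-Jacobi with central entry \<open>p(n)\<close>: two opposite corner minors are
  both \<open>turan n\<close>, the other two are \<open>turan (n + 1)\<close> and
  \<open>turan (n - 1)\<close>.\<close>

lemma overpart_matrix_det_turan:
  assumes "n \<ge> 2"
  shows "int (overpartition_count n) * det (overpart_matrix n) =
    turan n * turan n - turan (n - 1) * turan (n + 1)"
proof -
  obtain k where k: "n = Suc (Suc k)"
    using assms by (metis One_nat_def Suc_le_D Suc_1 Suc_le_mono)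
  show ?thesis
    unfolding overpart_matrix_det[OF assms] by (simp add: k turan_def numeral_2_eq_2 power2_eq_square power3_eq_cube algebra_simps)
qed

lemma det_pos_small:
  assumes "42 \<le> n" "n \<le> 485"
  shows "det (overpart_matrix n) > 0"
proof -
  have "0 < int (overpartition_count n) * det (overpart_matrix n)"
    using turan_log_concave[OF assms] overpart_matrix_det_turan[of n] assms by simp
  then show ?thesis by (simp add: zero_less_mult_iff)
qed

text \<open>\<open>L\<close> may be any lower bound for the square root, so that a single relative
  error serves all five indices in the determinant.\<close>

lemma overpartition_count_relative_error:
  assumes n: "n \<ge> 484" and L: "22 \<le> L" "L \<le> sqrt (real n)"
  defines "e \<equiv> 1 / (50 * L ^ 6)" and "m \<equiv> exp (lga (real n)) / 8"
  shows "(1 - e) * m \<le> real (overpartition_count n)" "real (overpartition_count n) \<le> (1 + e) * m"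
proof -
  have s: "sqrt (real n) \<ge> 22" using L by linarith
  have m: "opart_approx (real n) = m"
    unfolding m_def by (rule opart_approx_eq_exp) (use n in simp)
  have "\<bar>real (overpartition_count n) - m\<bar> \<le> exp (17 / 10 * sqrt (real n))"
    using overpartition_count_estimate[OF n] unfolding m .
  also have "\<dots> \<le> 1 / (50 * sqrt (real n) ^ 6) * m"
    using exp_margin[OF s] by (simp add: m)
  also have "\<dots> \<le> e * m"
    unfolding e_def using L n by (intro mult_right_mono divide_left_mono mult_left_mono power_mono mult_pos_pos) (auto simp: m_def)
  finally show "(1 - e) * m \<le> real (overpartition_count n)" "real (overpartition_count n) \<le> (1 + e) * m"
    by (simp_all add: abs_le_iff algebra_simps)
qed

lemma det_pos_large:
  assumes n: "n \<ge> 486"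
  shows "det (overpart_matrix n) > 0"
proof -
  \<comment> \<open>The smallest of the five indices decides; \<open>n >= 486\<close> gives
    \<open>L >= 22\<close>.\<close>
  define L where "L = sqrt (real n - 2)"
  define x where "x = real n"
  have x: "x \<ge> 486" using n by (simp add: x_def)
  have L2: "L\<^sup>2 = x - 2" using x by (simp add: L_def x_def)
  have L: "L \<ge> 22" unfolding L_def by (rule real_le_rsqrt) (use n in simp)
  define e where "e = 1 / (50 * L ^ 6)"
  let ?p = "\<lambda>k. real (overpartition_count k)"
  let ?m = "\<lambda>t. exp (lga t) / 8"
  have err: "(1 - e) * ?m (real k) \<le> ?p k" "?p k \<le> (1 + e) * ?m (real k)" if "k \<ge> n - 2" for k
  proof -
    have "real n - 2 \<le> real k" using that n by linarith
    then have "L \<le> sqrt (real k)" unfolding L_def by simp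
    then show "(1 - e) * ?m (real k) \<le> ?p k" "?p k \<le> (1 + e) * ?m (real k)"
      unfolding e_def using overpartition_count_relative_error[of k L] that n L by auto
  qed
  define h1 where "h1 = lga (x + 1) + lga (x - 1) - 2 * lga x"
  define h2 where "h2 = lga (x + 2) + lga (x - 2) - 2 * lga x"
  \<comment> \<open>The window has width 4, so \<open>t <= L^2 + 4 <= 1.0201 * L^2\<close>. The
    third power of 1.01 then costs little enough to pass from 7/10 to 67/100.\<close>
  have t: "t \<ge> 484" "L \<le> sqrt t" "sqrt t \<le> 101 / 100 * L" if "t \<in> {x-2..x+2}" for t
  proof -
    show "t \<ge> 484" using that x by simp
    show "L \<le> sqrt t" using that by (simp add: L_def x_def)
    show "sqrt t \<le> 101 / 100 * L"
    proof (rule real_le_lsqrt)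
      have "(101 / 100 * L)\<^sup>2 = 10201 / 10000 * (x - 2)" by (simp add: power_mult_distrib L2 power_divide)
      then show "t \<le> (101 / 100 * L)\<^sup>2" using that x by simp
    qed (use that x L in auto)
  qed
  have h1: "h1 \<le> - (67 / 100) / L ^ 3"
    unfolding h1_def
  proof (rule second_diff_le[of x lga lga1 lga2])
    fix u assume u: "u \<in> {x-1..x+1}"
    then have u': "u \<in> {x-2..x+2}" by auto
    show "(lga has_real_derivative lga1 u) (at u)" "(lga1 has_real_derivative lga2 u) (at u)"
      by (rule lga_deriv[OF t(1)[OF u']])+
    have "lga2 u \<le> - (7 / 10) / sqrt u ^ 3" by (rule lga2_le[OF t(1)[OF u']])
    also have "\<dots> \<le> - (67 / 100) / L ^ 3"
    proof -
      have "sqrt u ^ 3 \<le> (101 / 100 * L) ^ 3"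
        using t[OF u'] L by (intro power_mono) auto
      also have "\<dots> = 1030301 / 1000000 * L ^ 3" by (simp add: power_mult_distrib power_divide)
      finally have *: "sqrt u ^ 3 \<le> 1030301 / 1000000 * L ^ 3" .
      have "sqrt u ^ 3 > 0" "L ^ 3 > 0" using t[OF u'] L by simp_all
      moreover from this * have "67 / 100 * sqrt u ^ 3 \<le> 7 / 10 * L ^ 3" by linarith
      ultimately have "67 / 100 / L ^ 3 \<le> 7 / 10 / sqrt u ^ 3"
        by (simp add: divide_le_eq le_divide_eq)
      then show ?thesis by simp
    qed
    finally show "lga2 u \<le> - (67 / 100) / L ^ 3" .
  qed
  have h2: "\<bar>h2 - 4 * h1\<bar> \<le> 4 / L ^ 7"
    unfolding h1_def h2_def
  proof (rule abs_fourth_diff_le[of x lga lga1 lga2 lga3 lga4])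
    fix u assume u: "u \<in> {x-2..x+2}"
    show "(lga has_real_derivative lga1 u) (at u)" "(lga1 has_real_derivative lga2 u) (at u)"
      "(lga2 has_real_derivative lga3 u) (at u)" "(lga3 has_real_derivative lga4 u) (at u)"
      by (rule lga_deriv[OF t(1)[OF u]])+
    have "\<bar>lga4 u\<bar> \<le> 4 / sqrt u ^ 7" by (rule abs_lga4_le[OF t(1)[OF u]])
    also have "\<dots> \<le> 4 / L ^ 7"
    proof (rule frac_le)
      show "L ^ 7 \<le> sqrt u ^ 7" using t[OF u] L by (intro power_mono) auto
    qed (use L in auto)
    finally show "\<bar>lga4 u\<bar> \<le> 4 / L ^ 7" .
  qed
  note margin = approx_margin[OF L h1 h2 e_def]
  have e1: "?m (x + 1) * ?m (x - 1) = (?m x)\<^sup>2 * exp h1" and e2: "?m (x + 2) * ?m (x - 2) = (?m x)\<^sup>2 * exp h2"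
    unfolding h1_def h2_def by (simp_all add: power2_eq_square flip: exp_add)
  have rn: "real (n + 1) = x + 1" "real (n - 1) = x - 1" "real (n + 2) = x + 2" "real (n - 2) = x - 2" "real n = x"
    using n by (auto simp: x_def of_nat_diff)
  have "0 < ?p n ^ 3 - 2 * ?p n * ?p (n + 1) * ?p (n - 1) + (?p (n + 1))\<^sup>2 * ?p (n - 2)
      + ?p (n + 2) * (?p (n - 1))\<^sup>2 - ?p n * ?p (n + 2) * ?p (n - 2)"
    by (rule toeplitz_det_pos[OF margin(1,2) _ _ _ _ _ e1 e2 err[of n, unfolded rn] err[of "n + 1", unfolded rn]
        err[of "n - 1", unfolded rn] err[of "n + 2", unfolded rn] err[of "n - 2", unfolded rn] margin(3,4)]) (use n in auto)
  also have "\<dots> = real_of_int (det (overpart_matrix n))"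
    using n by (subst overpart_matrix_det) auto
  finally show ?thesis by simp
qed

theorem theorem1p6:
  fixes n :: nat
  assumes "n \<ge> 42"
  shows "det (overpart_matrix n) > 0"
  using det_pos_small[of n] det_pos_large[of n] assms by linarith

end
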